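(* Let $G$ be a $\mathbb{Z}$-symmetric graph. Then: (i) $\mathrm{rd}(G)\le 1$ if and only if $G$ has no minor isomorphic to the lift graph of $(K_3,0)$ nor to the lift graph of $(K_2^\bullet,z)$ for any simple labelling $z$; (ii) $\mathrm{rd}(G)\le 2$ if and only if $G$ has no minor isomorphic to the lift graph of $(K_4,0)$ nor to the lift graph of $(K_3^{\bullet\bullet},z)$ for any simple labelling $z$.
   Context: $\mathbb{Z}$ is the additive group of integers. A $\mathbb{Z}$-symmetric graph is a simple undirected (infinite) graph $G=(V,E)$ with a free action of $\mathbb{Z}$ on $G$ by graph automorphisms (the action of $\gamma$ written $v\mapsto v+\gamma$) such that the sets of vertex orbits and edge orbits are finite. Two $\mathbb{Z}$-symmetric graphs are isomorphic if there is a graph isomorphism compatible with the $\mathbb{Z}$-actions. A $\mathbb{Z}$-labelled graph $(\hat G,z)$ is a finite directed multigraph $\hat G=(\hat V,\hat E)$ (selfloops allowed) with a map $z:\hat E\to\mathbb{Z}$; an edge from $i$ to $j$ with label $\gamma$ is written $(i,j;\gamma)$. Labellings are always simple: selfloops have nonzero labels, and no two parallel edges have the same direction and the same label, nor opposite directions and opposite labels. Its lift graph is the $\mathbb{Z}$-symmetric graph with vertex set $\hat V\times\mathbb{Z}$ (elements written $i+\gamma$), edge set $\{\{i+\gamma,j+\gamma+z(e)\}: e=(i,j;z(e))\in\hat E,\ \gamma\in\mathbb{Z}\}$ and $\mathbb{Z}$ acting by translation. Conversely, for a $\mathbb{Z}$-symmetric graph $G$ and a set $\hat V\subset V$ containing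 exactly one vertex of each vertex orbit, every edge orbit is $\{\{i+\beta,j+\beta+\gamma\}:\beta\in\mathbb{Z}\}$ with $i,j\in\hat V$; recording it as an edge $(i,j;\gamma)$ gives the quotient $\mathbb{Z}$-labelled graph of $G$ with respect to $\hat V$. Minor operations on $\mathbb{Z}$-labelled graphs: edge inversion (reverse an edge and negate its label); switching at a vertex $i$ by $\gamma$ (each non-loop edge $(i,j;\alpha)$ becomes $(i,j;\alpha+\gamma)$, each non-loop edge $(j,i;\alpha)$ becomes $(j,i;\alpha-\gamma)$). Two $\mathbb{Z}$-labelled graphs are isomorphic if, after a sequence of edge inversions and switchings, there is a vertex bijection mapping labelled directed edges exactly onto labelled directed edges. Edge/vertex deletion deletes the edge/vertex (and incident edges) and restricts the labelling. Contraction of a non-loop edge $e=(i,j;0)$ identifies $i$ and $j$, removes $e$, restricts the labelling, and deletes selfloops with label $0$ and redundant parallel edges so that the labelling is simple. $(\hat G,z)$ is a minor of $(\hat H,w)$ if a $\mathbb{Z}$-labelled graph isomorphic to $(\hat G,z)$ is obtained from $(\hat H,w)$ by a sequence of edge deletions, vertex deletions and edge contractions. A $\mathbb{Z}$-symmetric graph $H$ is a minor of a $\mathbb{Z}$-symmetric graph $G$ if a quotient $\mathbb{Z}$-labelled graph of $H$ is a minor of a quotient $\mathbb{Z}$-labelled graph of $G$ (equivalently, $H$ is obtained from $G$ up to isomorphism by deleting or contracting vertex orbits and edge orbits in a way preserving $\mathbb{Z}$-symmetry). Periodic frameworks: for nonzero $\ell\in\mathbb{R}^d$, an $\ell$-periodic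 framework $(G,p)$ in $\mathbb{R}^d$ is a map $p:V(G)\to\mathbb{R}^d$ with $p(v+1)-p(v)=\ell$ for all $v$; $\ell$ is the lattice vector; a periodic framework is one that is $\ell$-periodic for some nonzero $\ell$. Two periodic frameworks $(G,p),(G,q)$, possibly in different dimensions, are equivalent if $\|p(u)-p(v)\|=\|q(u)-q(v)\|$ for every edge $uv$ and their lattice vectors have the same Euclidean length. $G$ is $d$-realizable if every periodic framework $(G,p)$ in any dimension admits an equivalent periodic framework in $\mathbb{R}^d$; the realizable dimension $\mathrm{rd}(G)$ is the least nonnegative integer $d$ such that $G$ is $d$-realizable. Special graphs: $(K_k,0)$ is the simple complete graph on $k$ vertices (each edge oriented arbitrarily) with all labels $0$. $K_2^\bullet$ is the directed multigraph on $\{1,2\}$ with two parallel edges from $1$ to $2$. $K_3^{\bullet\bullet}$ is the directed multigraph on $\{1,2,3\}$ with a single edge from $1$ to $2$, two parallel edges between $1$ and $3$, and two parallel edges between $2$ and $3$. *)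

theory Defs
  imports
    "HOL-Analysis.L2_Norm"
    "HOL-Library.Extended_Nat"
    "Graph_Theory.Digraph"
begin

text \<open>\<open>shift G \<gamma> v\<close> is the vertex \<open>v + \<gamma>\<close>; it is only meaningful for \<open>v \<in> zverts G\<close>.\<close>

record 'a zgraph =
  zverts :: "'a set"
  zedges :: "'a set set"
  shift :: "int \<Rightarrow> 'a \<Rightarrow> 'a"

definition vertex_orbit :: "'a zgraph \<Rightarrow> 'a \<Rightarrow> 'a set" where
  "vertex_orbit G v = {shift G \<gamma> v | \<gamma>. True}"

definition edge_orbit :: "'a zgraph \<Rightarrow> 'a set \<Rightarrow> 'a set set" where
  "edge_orbit G e = {shift G \<gamma> ` e | \<gamma>. True}"

definition vertex_orbits :: "'a zgraph \<Rightarrow> 'a set set" where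
  "vertex_orbits G = vertex_orbit G ` zverts G"

definition edge_orbits :: "'a zgraph \<Rightarrow> 'a set set set" where
  "edge_orbits G = edge_orbit G ` zedges G"

text \<open>An action of \<open>\<int>\<close> that is free on vertices is automatically free on edges.\<close>

locale Z_symmetric_graph =
  fixes G :: "'a zgraph"
  assumes edges_simple: "e \<in> zedges G \<Longrightarrow> e \<subseteq> zverts G \<and> card e = 2"
    and shift_closed: "v \<in> zverts G \<Longrightarrow> shift G \<gamma> v \<in> zverts G"
    and shift_zero: "v \<in> zverts G \<Longrightarrow> shift G 0 v = v"
    and shift_add: "v \<in> zverts G \<Longrightarrow> shift G (\<beta> + \<gamma>) v = shift G \<beta> (shift G \<gamma> v)"
    and shift_free: "v \<in> zverts G \<Longrightarrow> shift G \<gamma> v = v \<Longrightarrow> \<gamma> = 0"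
    and shift_edge: "e \<in> zedges G \<Longrightarrow> shift G \<gamma> ` e \<in> zedges G"
    and finite_vertex_orbits: "finite (vertex_orbits G)"
    and finite_edge_orbits: "finite (edge_orbits G)"

definition Z_graph_iso :: "'a zgraph \<Rightarrow> 'b zgraph \<Rightarrow> bool" where
  "Z_graph_iso G H \<longleftrightarrow> (\<exists>f. bij_betw f (zverts G) (zverts H)
     \<and> (\<forall>u\<in>zverts G. \<forall>v\<in>zverts G. {u, v} \<in> zedges G \<longleftrightarrow> {f u, f v} \<in> zedges H)
     \<and> (\<forall>v\<in>zverts G. \<forall>\<gamma>. f (shift G \<gamma> v) = shift H \<gamma> (f v)))"

text \<open>A \<open>\<int>\<close>-labelled graph is a finite directed multigraph (\<^const>\<open>fin_digraph\<close>) together with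
  a labelling of its arcs; labels of non-arcs are irrelevant.\<close>

type_synonym ('a, 'b) labelled_graph = "('a, 'b) pre_digraph \<times> ('b \<Rightarrow> int)"

text \<open>Two arcs coincide if they describe the same edge \<open>(i, j; \<gamma>)\<close> up to inversion. For selfloops
  this includes the case of opposite labels.\<close>

definition coincide :: "('a, 'b) pre_digraph \<Rightarrow> ('b \<Rightarrow> int) \<Rightarrow> 'b \<Rightarrow> 'b \<Rightarrow> bool" where
  "coincide D z e f \<longleftrightarrow>
     tail D e = tail D f \<and> head D e = head D f \<and> z e = z f \<or>
     tail D e = head D f \<and> head D e = tail D f \<and> z e = - z f"

definition simple_labelling :: "('a, 'b) pre_digraph \<Rightarrow> ('b \<Rightarrow> int) \<Rightarrow> bool" where
  "simple_labelling D z \<longleftrightarrow>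
     (\<forall>e\<in>arcs D. tail D e = head D e \<longrightarrow> z e \<noteq> 0) \<and>
     (\<forall>e\<in>arcs D. \<forall>f\<in>arcs D. e \<noteq> f \<longrightarrow> \<not> coincide D z e f)"

definition lift_graph :: "('a, 'b) pre_digraph \<Rightarrow> ('b \<Rightarrow> int) \<Rightarrow> ('a \<times> int) zgraph" where
  "lift_graph D z =
     \<lparr> zverts = verts D \<times> UNIV,
       zedges = {{(tail D e, \<gamma>), (head D e, \<gamma> + z e)} | e \<gamma>. e \<in> arcs D},
       shift = (\<lambda>\<gamma> (v, \<beta>). (v, \<beta> + \<gamma>)) \<rparr>"

definition orbit_representatives :: "'a zgraph \<Rightarrow> 'a set \<Rightarrow> bool" where
  "orbit_representatives G R \<longleftrightarrow> R \<subseteq> zverts G \<and> (\<forall>X\<in>vertex_orbits G. \<exists>!i. i \<in> R \<and> i \<in> X)"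

text \<open>The arcs of a quotient are the edge orbits themselves, the arc \<open>X\<close> being recorded as
  \<open>(tail D X, head D X; z X)\<close>. The quotient with respect to \<open>R\<close> is unique up to the choice of the
  direction (and, correspondingly, the sign of the label) of each arc, hence a relation.\<close>

definition quotient_wrt :: "'a zgraph \<Rightarrow> 'a set \<Rightarrow> ('a, 'a set set) labelled_graph \<Rightarrow> bool" where
  "quotient_wrt G R Q \<longleftrightarrow> (case Q of (D, z) \<Rightarrow>
     orbit_representatives G R \<and> verts D = R \<and> arcs D = edge_orbits G \<and>
     (\<forall>X\<in>arcs D. tail D X \<in> R \<and> head D X \<in> R \<and>
        X = {{shift G \<beta> (tail D X), shift G (\<beta> + z X) (head D X)} | \<beta>. True}))"

definition switch_label :: "('a, 'b) pre_digraph \<Rightarrow> 'a \<Rightarrow> int \<Rightarrow> ('b \<Rightarrow> int) \<Rightarrow> 'b \<Rightarrow> int" where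
  "switch_label D i \<gamma> z e =
     (if tail D e = head D e then z e
      else if tail D e = i then z e + \<gamma>
      else if head D e = i then z e - \<gamma>
      else z e)"

inductive relabel_step :: "('a, 'b) labelled_graph \<Rightarrow> ('a, 'b) labelled_graph \<Rightarrow> bool" where
  edge_inversion: "e \<in> arcs D \<Longrightarrow>
    relabel_step (D, z)
      (D\<lparr> tail := (tail D)(e := head D e), head := (head D)(e := tail D e) \<rparr>, z(e := - z e))"
| switching: "i \<in> verts D \<Longrightarrow> relabel_step (D, z) (D, switch_label D i \<gamma> z)"

definition exact_iso :: "('a, 'b) labelled_graph \<Rightarrow> ('c, 'd) labelled_graph \<Rightarrow> bool" where
  "exact_iso P Q \<longleftrightarrow> (case P of (D, z) \<Rightarrow> case Q of (D', z') \<Rightarrow>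
     \<exists>f g. bij_betw f (verts D) (verts D') \<and> bij_betw g (arcs D) (arcs D') \<and>
       (\<forall>e\<in>arcs D. tail D' (g e) = f (tail D e) \<and> head D' (g e) = f (head D e) \<and> z' (g e) = z e))"

definition labelled_iso :: "('a, 'b) labelled_graph \<Rightarrow> ('c, 'd) labelled_graph \<Rightarrow> bool" where
  "labelled_iso P Q \<longleftrightarrow> (\<exists>P'. relabel_step\<^sup>*\<^sup>* P P' \<and> exact_iso P' Q)"

text \<open>Identification of the ends of \<open>e\<close> (the merged vertex is called \<^term>\<open>tail D e\<close>) and removal
  of \<open>e\<close>.\<close>

definition identify_ends :: "('a, 'b) pre_digraph \<Rightarrow> 'b \<Rightarrow> ('a, 'b) pre_digraph" where
  "identify_ends D e =
     (let m = (\<lambda>v. if v = head D e then tail D e else v)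
      in \<lparr> verts = m ` verts D, arcs = arcs D - {e}, tail = m \<circ> tail D, head = m \<circ> head D \<rparr>)"

text \<open>\<open>S\<close> is what remains of the arcs after deleting the selfloops with label \<open>0\<close> and all but one
  arc of each class of coinciding arcs.\<close>

definition simplified_arcs :: "('a, 'b) pre_digraph \<Rightarrow> ('b \<Rightarrow> int) \<Rightarrow> 'b set \<Rightarrow> bool" where
  "simplified_arcs D z S \<longleftrightarrow> S \<subseteq> arcs D \<and> simple_labelling (D\<lparr> arcs := S \<rparr>) z \<and>
     (\<forall>f \<in> arcs D - S. tail D f = head D f \<and> z f = 0 \<or> (\<exists>f'\<in>S. coincide D z f f'))"

inductive minor_step :: "('a, 'b) labelled_graph \<Rightarrow> ('a, 'b) labelled_graph \<Rightarrow> bool" where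
  edge_deletion: "e \<in> arcs D \<Longrightarrow> minor_step (D, z) (pre_digraph.del_arc D e, z)"
| vertex_deletion: "v \<in> verts D \<Longrightarrow> minor_step (D, z) (pre_digraph.del_vert D v, z)"
| edge_contraction: "e \<in> arcs D \<Longrightarrow> tail D e \<noteq> head D e \<Longrightarrow> z e = 0 \<Longrightarrow>
    simplified_arcs (identify_ends D e) z S \<Longrightarrow>
    minor_step (D, z) ((identify_ends D e)\<lparr> arcs := S \<rparr>, z)"

definition labelled_minor :: "('a, 'b) labelled_graph \<Rightarrow> ('c, 'd) labelled_graph \<Rightarrow> bool" where
  "labelled_minor P Q \<longleftrightarrow> (\<exists>Q'. minor_step\<^sup>*\<^sup>* Q Q' \<and> labelled_iso Q' P)"

definition Z_minor :: "'a zgraph \<Rightarrow> 'b zgraph \<Rightarrow> bool" where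
  "Z_minor H G \<longleftrightarrow> (\<exists>R P S Q. quotient_wrt H R P \<and> quotient_wrt G S Q \<and> labelled_minor P Q)"

text \<open>Ranging over minors on the vertex type of \<open>L\<close> is no restriction, since being a minor
  is invariant under isomorphism.\<close>

definition has_minor_isomorphic_to :: "'a zgraph \<Rightarrow> 'b zgraph \<Rightarrow> bool" where
  "has_minor_isomorphic_to G L \<longleftrightarrow>
     (\<exists>H :: 'b zgraph. Z_symmetric_graph H \<and> Z_minor H G \<and> Z_graph_iso H L)"

text \<open>A point of \<open>\<real>\<^sup>d\<close> is given by its coordinates \<open>x 0, \<dots>, x (d - 1)\<close>; values at indices
  \<open>\<ge> d\<close> are irrelevant. The lattice vector \<open>l\<close> is part of the data of a framework.\<close>

definition periodic_framework ::
    "'a zgraph \<Rightarrow> nat \<Rightarrow> (nat \<Rightarrow> real) \<Rightarrow> ('a \<Rightarrow> nat \<Rightarrow> real) \<Rightarrow> bool" where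
  "periodic_framework G d l p \<longleftrightarrow>
     (\<exists>k<d. l k \<noteq> 0) \<and> (\<forall>v\<in>zverts G. \<forall>k<d. p (shift G 1 v) k - p v k = l k)"

definition equivalent_frameworks ::
    "'a zgraph \<Rightarrow> nat \<Rightarrow> (nat \<Rightarrow> real) \<Rightarrow> ('a \<Rightarrow> nat \<Rightarrow> real)
       \<Rightarrow> nat \<Rightarrow> (nat \<Rightarrow> real) \<Rightarrow> ('a \<Rightarrow> nat \<Rightarrow> real) \<Rightarrow> bool" where
  "equivalent_frameworks G c l p d m q \<longleftrightarrow>
     (\<forall>u v. {u, v} \<in> zedges G \<longrightarrow>
        L2_set (\<lambda>k. p u k - p v k) {..<c} = L2_set (\<lambda>k. q u k - q v k) {..<d}) \<and>
     L2_set l {..<c} = L2_set m {..<d}"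

definition realizable :: "nat \<Rightarrow> 'a zgraph \<Rightarrow> bool" where
  "realizable d G \<longleftrightarrow>
     (\<forall>c l p. periodic_framework G c l p \<longrightarrow>
        (\<exists>m q. periodic_framework G d m q \<and> equivalent_frameworks G c l p d m q))"

definition rd :: "'a zgraph \<Rightarrow> enat" where
  "rd G = Inf {enat d | d. realizable d G}"

definition complete_digraph :: "nat \<Rightarrow> (nat, nat \<times> nat) pre_digraph" where
  "complete_digraph k =
     \<lparr> verts = {1..k}, arcs = {(i, j). i \<in> {1..k} \<and> j \<in> {1..k} \<and> i < j}, tail = fst, head = snd \<rparr>"

text \<open>In the following two multigraphs the arc \<open>(i, j, n)\<close> is the \<open>n\<close>-th parallel arc from \<open>i\<close> to \<open>j\<close>.\<close>

definition K2_dot :: "(nat, nat \<times> nat \<times> nat) pre_digraph" where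
  "K2_dot =
     \<lparr> verts = {1, 2}, arcs = {(1, 2, 0), (1, 2, 1)}, tail = fst, head = fst \<circ> snd \<rparr>"

definition K3_dot_dot :: "(nat, nat \<times> nat \<times> nat) pre_digraph" where
  "K3_dot_dot =
     \<lparr> verts = {1, 2, 3}, arcs = {(1, 2, 0), (1, 3, 0), (1, 3, 1), (2, 3, 0), (2, 3, 1)},
       tail = fst, head = fst \<circ> snd \<rparr>"

end

theory Submission
  imports Defs
begin

text \<open>
  After choosing representatives, a periodic framework is a placement of the vertices of the quotient
  together with a lattice vector \<open>l\<close>, an edge \<open>(i, j; g)\<close> having length \<open>\<parallel>p i - p j - g l\<parallel>\<close>. Deleting an
  edge drops a constraint and contracting one prescribes length \<open>0\<close>, so realizability passes to
  minors; in each forbidden minor the lengths determine the Gram matrix of \<open>d + 1\<close> vectors, which may be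
  chosen independent.

  Conversely, realize a graph without forbidden minors by induction. If every vertex has at least
  three neighbours, rotating a longest path produces a \<open>K\<^sub>4\<close> minor with arbitrary gains; either it is
  balanced, or two of its triangles are unbalanced and contracting their common edge leaves
  \<open>K\<^sub>3\<close> with two double edges. So some vertex \<open>v\<close> has at most two neighbours \<open>u\<close>, \<open>w\<close>. If both are joined to
  \<open>v\<close> by single edges, contract one of them and reinsert \<open>v\<close> by a triangle. If \<open>v\<close> and \<open>u\<close> are joined by several
  edges, then, up to gluing along a cut vertex, the graph without \<open>v\<close> is balanced: otherwise moving
  vertices one by one from the side of \<open>u\<close> to the side of \<open>w\<close> exhibits a \<open>K\<^sub>3\<close> with two double
  edges. A balanced graph can be realized before \<open>l\<close> is chosen, and \<open>l\<close> is then adapted to \<open>v\<close>.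
\<close>

section \<open>Gain graphs and minor models\<close>

text \<open>The minor relation contracts only arcs labelled \<open>0\<close> and relabels only after
  the last contraction, so a switching wanted before a contraction has no place in it. A minor is
  therefore found as a model: one map \<phi> whose fibres are the branch sets and one switching
  \<pi> after which each branch set is connected by edges labelled \<open>0\<close>. Changing the
  orbit representatives of the big graph carries out \<pi> in a single stroke.

  In the converse, the delicate vertex v has edges of several gains to u and one edge to w, switched
  to gain 0. The lengths involve the three vectors l, v - u and w - u, whose Gram matrix may have
  rank three. The edges at v leave the product of l with w - u unconstrained. If the rest of the
  graph is balanced, its lengths do not see l after switching, so this product stays free and the
  three vectors fit into the plane. This is why balance is the dividing line.\<close>

definition gain_graph :: "'v set \<Rightarrow> ('v \<times> 'v \<times> int) set \<Rightarrow> bool" where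
  "gain_graph V E \<longleftrightarrow> finite V \<and>
     (\<forall>i j g. (i, j, g) \<in> E \<longrightarrow> i \<in> V \<and> j \<in> V \<and> i \<noteq> j \<and> (j, i, - g) \<in> E)"

text \<open>These are the edges that have label \<open>0\<close> after switching by \<pi> and stay
  inside one branch set, that is, the edges ready for contraction.\<close>

definition tight :: "('v \<times> 'v \<times> int) set \<Rightarrow> ('v \<Rightarrow> nat) \<Rightarrow> ('v \<Rightarrow> int) \<Rightarrow> 'v \<Rightarrow> 'v \<Rightarrow> bool" where
  "tight E \<phi> \<pi> i j \<longleftrightarrow> \<phi> i = \<phi> j \<and> (i, j, \<pi> j - \<pi> i) \<in> E"

text \<open>Vertices with \<phi>-value outside K are those deleted in the minor. A fibre over an
  element of K may be empty here; for the models used below the crossing edges exclude this, because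
  every vertex of a target graph lies on an arc.\<close>

definition connected_fibres ::
    "'v set \<Rightarrow> ('v \<times> 'v \<times> int) set \<Rightarrow> ('v \<Rightarrow> nat) \<Rightarrow> ('v \<Rightarrow> int) \<Rightarrow> nat set \<Rightarrow> bool" where
  "connected_fibres V E \<phi> \<pi> K \<longleftrightarrow>
     (\<forall>i\<in>V. \<forall>j\<in>V. \<phi> i = \<phi> j \<and> \<phi> i \<in> K \<longrightarrow> (tight E \<phi> \<pi>)\<^sup>*\<^sup>* i j)"

text \<open>Switching every vertex \<open>i\<close> by \<open>\<pi> i\<close> turns an edge \<open>(i, j, g)\<close> into \<open>(i, j, g + \<pi> i - \<pi> j)\<close>.\<close>

definition cross ::
    "('v \<times> 'v \<times> int) set \<Rightarrow> ('v \<Rightarrow> nat) \<Rightarrow> ('v \<Rightarrow> int) \<Rightarrow> nat \<Rightarrow> nat \<Rightarrow> int \<Rightarrow> bool" where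
  "cross E \<phi> \<pi> k l g \<longleftrightarrow> (\<exists>i j. (i, j, g - \<pi> i + \<pi> j) \<in> E \<and> \<phi> i = k \<and> \<phi> j = l)"

definition has_model ::
    "'v set \<Rightarrow> ('v \<times> 'v \<times> int) set \<Rightarrow> (nat, 'b) pre_digraph \<Rightarrow> ('b \<Rightarrow> int) \<Rightarrow> bool" where
  "has_model V E D z \<longleftrightarrow> (\<exists>\<phi> \<pi>. connected_fibres V E \<phi> \<pi> (verts D) \<and>
     (\<forall>a\<in>arcs D. cross E \<phi> \<pi> (tail D a) (head D a) (z a)))"

lemma gain_graphD:
  assumes "gain_graph V E" "(i, j, g) \<in> E"
  shows "i \<in> V" "j \<in> V" "i \<noteq> j" "(j, i, - g) \<in> E"
  using assms unfolding gain_graph_def by blast+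

lemma gain_graph_restrict:
  assumes "gain_graph V E" "U \<subseteq> V"
  shows "gain_graph U {(i, j, g) \<in> E. i \<in> U \<and> j \<in> U}"
  using assms unfolding gain_graph_def by (auto intro: finite_subset)

lemma cross_sym:
  assumes "gain_graph V E" "cross E \<phi> \<pi> k l g"
  shows "cross E \<phi> \<pi> l k (- g)"
proof -
  obtain i j where ij: "(i, j, g - \<pi> i + \<pi> j) \<in> E" "\<phi> i = k" "\<phi> j = l"
    using assms(2) unfolding cross_def by blast
  have "(j, i, - (g - \<pi> i + \<pi> j)) \<in> E"
    using gain_graphD(4)[OF assms(1) ij(1)] .
  then have "(j, i, - g - \<pi> j + \<pi> i) \<in> E" by (simp add: algebra_simps)
  then show ?thesis unfolding cross_def using ij by blast
qed

lemma crossI: "(i, j, g) \<in> E \<Longrightarrow> \<phi> i = k \<Longrightarrow> \<phi> j = l \<Longrightarrow> h = g + \<pi> i - \<pi> j \<Longrightarrow> cross E \<phi> \<pi> k l h"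
  unfolding cross_def by (rule exI[of _ i], rule exI[of _ j]) simp

lemma tight_rtranclp_mono:
  assumes "(tight E \<phi> \<pi>)\<^sup>*\<^sup>* i j" "\<And>a b. tight E \<phi> \<pi> a b \<Longrightarrow> (tight E' \<phi>' \<pi>')\<^sup>*\<^sup>* a b"
  shows "(tight E' \<phi>' \<pi>')\<^sup>*\<^sup>* i j"
  using assms(1)
proof (induction rule: rtranclp_induct)
  case (step y z)
  then show ?case using assms(2) by (meson rtranclp_trans)
qed simp

text \<open>The vertices outside U are sent to \<open>0\<close>, which is not a vertex of D, and so
  count as deleted.\<close>

lemma has_model_mono:
  assumes "has_model U F D z" "gain_graph U F" "gain_graph V E" "U \<subseteq> V" "F \<subseteq> E" "0 \<notin> verts D"
  shows "has_model V E D z"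
proof -
  obtain \<phi> \<pi> where m: "connected_fibres U F \<phi> \<pi> (verts D)"
      "\<And>a. a \<in> arcs D \<Longrightarrow> cross F \<phi> \<pi> (tail D a) (head D a) (z a)"
    using assms(1) unfolding has_model_def by blast
  define \<psi> where "\<psi> = (\<lambda>v. if v \<in> U then \<phi> v else 0)"
  have inU: "a \<in> U" "b \<in> U" if "(a, b, g) \<in> F" for a b g
    using gain_graphD[OF assms(2) that] by auto
  have t: "(tight E \<psi> \<pi>)\<^sup>*\<^sup>* a b" if "tight F \<phi> \<pi> a b" for a b
    using that inU assms(5) unfolding tight_def \<psi>_def by (intro r_into_rtranclp) auto
  have "connected_fibres V E \<psi> \<pi> (verts D)"
    unfolding connected_fibres_def
  proof (intro ballI impI)
    fix i j assume "i \<in> V" "j \<in> V" and ij: "\<psi> i = \<psi> j \<and> \<psi> i \<in> verts D"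
    then have "i \<in> U" "j \<in> U" using assms(6) unfolding \<psi>_def by (auto split: if_splits)
    then have "(tight F \<phi> \<pi>)\<^sup>*\<^sup>* i j"
      using m(1) ij unfolding connected_fibres_def \<psi>_def by auto
    then show "(tight E \<psi> \<pi>)\<^sup>*\<^sup>* i j" by (rule tight_rtranclp_mono) (rule t)
  qed
  moreover have "cross E \<psi> \<pi> (tail D a) (head D a) (z a)" if "a \<in> arcs D" for a
  proof -
    obtain i j where ij: "(i, j, z a - \<pi> i + \<pi> j) \<in> F" "\<phi> i = tail D a" "\<phi> j = head D a"
      using m(2) \<open>a \<in> arcs D\<close> unfolding cross_def by blast
    then have "(i, j, z a - \<pi> i + \<pi> j) \<in> E" using assms(5) by blast
    then show ?thesis by (rule crossI) (use ij inU in \<open>auto simp: \<psi>_def\<close>)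
  qed
  ultimately show ?thesis unfolding has_model_def by blast
qed

text \<open>Contracting the edge vu turns vw into an edge uw of gain b - a, and F contains at most
  this edge besides edges of E. In the lifted model v joins the branch set of u, switched so that vu
  is tight; then vw has the same switched gain as the new edge and takes its place, both inside a
  branch set and between two of them.\<close>

lemma has_model_contract:
  assumes "has_model (V - {v}) F D z" "gain_graph (V - {v}) F" "gain_graph V E"
    and F: "F \<subseteq> E \<union> {(u, w, b - a), (w, u, a - b)}"
    and vu: "(v, u, a) \<in> E" and vw: "(v, w, b) \<in> E"
  shows "has_model V E D z"
proof -
  obtain \<phi> \<pi> where m: "connected_fibres (V - {v}) F \<phi> \<pi> (verts D)"
      "\<And>e. e \<in> arcs D \<Longrightarrow> cross F \<phi> \<pi> (tail D e) (head D e) (z e)"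
    using assms(1) unfolding has_model_def by blast
  define \<psi> where "\<psi> = \<phi>(v := \<phi> u)"
  define \<rho> where "\<rho> = \<pi>(v := \<pi> u - a)"
  have uv: "(u, v, - a) \<in> E" and wv: "(w, v, - b) \<in> E"
    using gain_graphD(4)[OF assms(3)] vu vw by auto
  have ne: "u \<noteq> v" "w \<noteq> v" "u \<in> V" using gain_graphD[OF assms(3)] vu vw by blast+
  have inU: "i \<noteq> v" "j \<noteq> v" if "(i, j, g) \<in> F" for i j g
    using gain_graphD[OF assms(2) that] by auto
  have tuv: "tight E \<psi> \<rho> u v" "tight E \<psi> \<rho> v u"
    using uv vu ne unfolding tight_def \<psi>_def \<rho>_def by auto
  have t: "(tight E \<psi> \<rho>)\<^sup>*\<^sup>* i j" if tt: "tight F \<phi> \<pi> i j" for i j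
  proof -
    have e: "(i, j, \<pi> j - \<pi> i) \<in> F" and p: "\<phi> i = \<phi> j" using tt unfolding tight_def by auto
    have nv: "i \<noteq> v" "j \<noteq> v" using inU e by auto
    consider "(i, j, \<pi> j - \<pi> i) \<in> E" | "i = u" "j = w" "\<pi> j - \<pi> i = b - a"
      | "i = w" "j = u" "\<pi> j - \<pi> i = a - b" using e F by auto
    then show ?thesis
    proof cases
      case 1
      then show ?thesis using p nv unfolding tight_def \<psi>_def \<rho>_def by (intro r_into_rtranclp) auto
    next
      case 2
      have "\<rho> w - \<rho> v = b" using 2 nv unfolding \<rho>_def by simp
      then have "tight E \<psi> \<rho> v w" using p 2 vw nv unfolding tight_def \<psi>_def by simp
      then show ?thesis using tuv 2 by (meson converse_rtranclp_into_rtranclp r_into_rtranclp)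
    next
      case 3
      have "\<rho> v - \<rho> w = - b" using 3 nv unfolding \<rho>_def by simp
      then have "tight E \<psi> \<rho> w v" using p 3 wv nv unfolding tight_def \<psi>_def by simp
      then show ?thesis using tuv 3 by (meson converse_rtranclp_into_rtranclp r_into_rtranclp)
    qed
  qed
  have base: "(tight E \<psi> \<rho>)\<^sup>*\<^sup>* i j" if "i \<in> V - {v}" "j \<in> V - {v}" "\<phi> i = \<phi> j" "\<phi> i \<in> verts D" for i j
  proof -
    have "(tight F \<phi> \<pi>)\<^sup>*\<^sup>* i j" using m(1) that unfolding connected_fibres_def by blast
    then show ?thesis by (rule tight_rtranclp_mono) (rule t)
  qed
  have "connected_fibres V E \<psi> \<rho> (verts D)"
    unfolding connected_fibres_def
  proof (intro ballI impI)
    fix i j assume ij: "i \<in> V" "j \<in> V" "\<psi> i = \<psi> j \<and> \<psi> i \<in> verts D"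
    define i' where "i' = (if i = v then u else i)"
    define j' where "j' = (if j = v then u else j)"
    have "(tight E \<psi> \<rho>)\<^sup>*\<^sup>* i' j'"
      by (rule base) (use ij ne in \<open>auto simp: i'_def j'_def \<psi>_def split: if_splits\<close>)
    moreover have "(tight E \<psi> \<rho>)\<^sup>*\<^sup>* i i'" "(tight E \<psi> \<rho>)\<^sup>*\<^sup>* j' j"
      using tuv unfolding i'_def j'_def by auto
    ultimately show "(tight E \<psi> \<rho>)\<^sup>*\<^sup>* i j" by (meson rtranclp_trans)
  qed
  moreover have "cross E \<psi> \<rho> (tail D e) (head D e) (z e)" if "e \<in> arcs D" for e
  proof -
    obtain i j where ij: "(i, j, z e - \<pi> i + \<pi> j) \<in> F" "\<phi> i = tail D e" "\<phi> j = head D e"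
      using m(2) \<open>e \<in> arcs D\<close> unfolding cross_def by blast
    have nv: "i \<noteq> v" "j \<noteq> v" using inU ij by auto
    consider "(i, j, z e - \<pi> i + \<pi> j) \<in> E" | "i = u" "j = w" "z e - \<pi> i + \<pi> j = b - a"
      | "i = w" "j = u" "z e - \<pi> i + \<pi> j = a - b" using ij F by auto
    then show ?thesis
    proof cases
      case 1
      then show ?thesis by (rule crossI) (use ij nv in \<open>auto simp: \<psi>_def \<rho>_def\<close>)
    next
      case 2
      show ?thesis by (rule crossI[OF vw]) (use ij nv 2 in \<open>auto simp: \<psi>_def \<rho>_def\<close>)
    next
      case 3
      show ?thesis by (rule crossI[OF wv]) (use ij nv 3 in \<open>auto simp: \<psi>_def \<rho>_def\<close>)
    qed
  qed
  ultimately show ?thesis unfolding has_model_def by blast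
qed

section \<open>Models of the four forbidden minors\<close>

definition K4_model :: "'v set \<Rightarrow> ('v \<times> 'v \<times> int) set \<Rightarrow> bool" where
  "K4_model V E \<longleftrightarrow> has_model V E (complete_digraph 4) (\<lambda>_. 0)"

definition K3dd_model :: "'v set \<Rightarrow> ('v \<times> 'v \<times> int) set \<Rightarrow> bool" where
  "K3dd_model V E \<longleftrightarrow> (\<exists>z. simple_labelling K3_dot_dot z \<and> has_model V E K3_dot_dot z)"

definition K3_model :: "'v set \<Rightarrow> ('v \<times> 'v \<times> int) set \<Rightarrow> bool" where
  "K3_model V E \<longleftrightarrow> has_model V E (complete_digraph 3) (\<lambda>_. 0)"

definition K2d_model :: "'v set \<Rightarrow> ('v \<times> 'v \<times> int) set \<Rightarrow> bool" where
  "K2d_model V E \<longleftrightarrow> (\<exists>z. simple_labelling K2_dot z \<and> has_model V E K2_dot z)"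

lemma complete_digraph_4:
  "verts (complete_digraph 4) = {1, 2, 3, 4}"
  "arcs (complete_digraph 4) = {(1, 2), (1, 3), (1, 4), (2, 3), (2, 4), (3, 4)}"
  unfolding complete_digraph_def by auto

lemma complete_digraph_3:
  "verts (complete_digraph 3) = {1, 2, 3}"
  "arcs (complete_digraph 3) = {(1, 2), (1, 3), (2, 3)}"
  unfolding complete_digraph_def by auto

lemma complete_digraph_ends:
  "tail (complete_digraph k) = fst" "head (complete_digraph k) = snd"
  unfolding complete_digraph_def by auto

lemma K4_modelI:
  assumes "connected_fibres V E \<phi> \<pi> {1, 2, 3, 4}"
    "cross E \<phi> \<pi> 1 2 0" "cross E \<phi> \<pi> 1 3 0" "cross E \<phi> \<pi> 1 4 0"
    "cross E \<phi> \<pi> 2 3 0" "cross E \<phi> \<pi> 2 4 0" "cross E \<phi> \<pi> 3 4 0"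
  shows "K4_model V E"
  unfolding K4_model_def has_model_def using assms
  by (intro exI[of _ \<phi>] exI[of _ \<pi>]) (simp add: complete_digraph_4 complete_digraph_ends)

lemma K3_modelI:
  assumes "connected_fibres V E \<phi> \<pi> {1, 2, 3}"
    "cross E \<phi> \<pi> 1 2 0" "cross E \<phi> \<pi> 1 3 0" "cross E \<phi> \<pi> 2 3 0"
  shows "K3_model V E"
  unfolding K3_model_def has_model_def using assms
  by (intro exI[of _ \<phi>] exI[of _ \<pi>]) (simp add: complete_digraph_3 complete_digraph_ends)

lemma K3dd_modelI:
  assumes "connected_fibres V E \<phi> \<pi> {1, 2, 3}" "cross E \<phi> \<pi> 1 2 a"
    "cross E \<phi> \<pi> 1 3 b" "cross E \<phi> \<pi> 1 3 b'" "b \<noteq> b'"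
    "cross E \<phi> \<pi> 2 3 c" "cross E \<phi> \<pi> 2 3 c'" "c \<noteq> c'"
  shows "K3dd_model V E"
proof -
  define z :: "nat \<times> nat \<times> nat \<Rightarrow> int" where
    "z = (\<lambda>_. 0)((1, 2, 0) := a, (1, 3, 0) := b, (1, 3, 1) := b', (2, 3, 0) := c, (2, 3, 1) := c')"
  have "simple_labelling K3_dot_dot z"
    using assms(5,8) unfolding simple_labelling_def coincide_def K3_dot_dot_def z_def by auto
  moreover have "has_model V E K3_dot_dot z"
    unfolding has_model_def using assms
    by (intro exI[of _ \<phi>] exI[of _ \<pi>]) (simp add: K3_dot_dot_def z_def)
  ultimately show ?thesis unfolding K3dd_model_def by blast
qed

lemma K2d_modelI:
  assumes "connected_fibres V E \<phi> \<pi> {1, 2}"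
    "cross E \<phi> \<pi> 1 2 b" "cross E \<phi> \<pi> 1 2 b'" "b \<noteq> b'"
  shows "K2d_model V E"
proof -
  define z :: "nat \<times> nat \<times> nat \<Rightarrow> int" where "z = (\<lambda>_. 0)((1, 2, 0) := b, (1, 2, 1) := b')"
  have "simple_labelling K2_dot z"
    using assms(4) unfolding simple_labelling_def coincide_def K2_dot_def z_def by auto
  moreover have "has_model V E K2_dot z"
    unfolding has_model_def using assms
    by (intro exI[of _ \<phi>] exI[of _ \<pi>]) (simp add: K2_dot_def z_def)
  ultimately show ?thesis unfolding K2d_model_def by blast
qed

lemma models_mono:
  assumes "gain_graph U F" "gain_graph V E" "U \<subseteq> V" "F \<subseteq> E"
  shows "K4_model U F \<Longrightarrow> K4_model V E" "K3dd_model U F \<Longrightarrow> K3dd_model V E"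
    "K3_model U F \<Longrightarrow> K3_model V E" "K2d_model U F \<Longrightarrow> K2d_model V E"
proof -
  note mono = has_model_mono[OF _ assms]
  show "K4_model U F \<Longrightarrow> K4_model V E"
    unfolding K4_model_def by (rule mono) (simp_all add: complete_digraph_4)
  show "K3_model U F \<Longrightarrow> K3_model V E"
    unfolding K3_model_def by (rule mono) (simp_all add: complete_digraph_3)
  have "0 \<notin> verts K3_dot_dot" "0 \<notin> verts K2_dot" by (simp_all add: K3_dot_dot_def K2_dot_def)
  then show "K3dd_model U F \<Longrightarrow> K3dd_model V E" "K2d_model U F \<Longrightarrow> K2d_model V E"
    unfolding K3dd_model_def K2d_model_def by (blast intro: mono)+
qed

section \<open>Connectivity and balance\<close>

definition conn :: "('v \<times> 'v \<times> int) set \<Rightarrow> 'v set \<Rightarrow> bool" where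
  "conn E U \<longleftrightarrow> (\<forall>i\<in>U. \<forall>j\<in>U. (\<lambda>i j. i \<in> U \<and> j \<in> U \<and> (\<exists>g. (i, j, g) \<in> E))\<^sup>*\<^sup>* i j)"

text \<open>Enough edges of U to connect it are tight, as for a spanning tree; the other edges of U
  are unrestricted. In \<open>balanced\<close> every edge of U is tight.\<close>

definition tconn :: "('v \<times> 'v \<times> int) set \<Rightarrow> 'v set \<Rightarrow> ('v \<Rightarrow> int) \<Rightarrow> bool" where
  "tconn E U \<pi> \<longleftrightarrow> (\<forall>i\<in>U. \<forall>j\<in>U. (\<lambda>i j. i \<in> U \<and> j \<in> U \<and> (i, j, \<pi> j - \<pi> i) \<in> E)\<^sup>*\<^sup>* i j)"

definition balanced :: "('v \<times> 'v \<times> int) set \<Rightarrow> 'v set \<Rightarrow> ('v \<Rightarrow> int) \<Rightarrow> bool" where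
  "balanced E U \<pi> \<longleftrightarrow> (\<forall>i\<in>U. \<forall>j\<in>U. \<forall>g. (i, j, g) \<in> E \<longrightarrow> g = \<pi> j - \<pi> i)"

lemma rtranclp_le:
  assumes "r\<^sup>*\<^sup>* i j" "\<And>a b. r a b \<Longrightarrow> s a b"
  shows "s\<^sup>*\<^sup>* i j"
  using rtranclp_mono[of r s] assms by blast

lemma conn_singleton [simp]: "conn E {v}" by (simp add: conn_def)
lemma tconn_singleton [simp]: "tconn E {v} \<pi>" by (simp add: tconn_def)

lemma balanced_singleton: "gain_graph V E \<Longrightarrow> balanced E {v} \<pi>"
  unfolding balanced_def by (auto dest: gain_graphD(3))

lemma tconn_cong:
  assumes "tconn E U \<pi>" "\<And>i. i \<in> U \<Longrightarrow> \<rho> i = \<pi> i"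
  shows "tconn E U \<rho>"
proof -
  have "(\<lambda>i j. i \<in> U \<and> j \<in> U \<and> (i, j, \<rho> j - \<rho> i) \<in> E)
      = (\<lambda>i j. i \<in> U \<and> j \<in> U \<and> (i, j, \<pi> j - \<pi> i) \<in> E)"
    using assms(2) by (intro ext) auto
  then show ?thesis using assms(1) unfolding tconn_def by simp
qed

lemma balanced_conn_tconn:
  assumes "conn E U" "balanced E U \<pi>"
  shows "tconn E U \<pi>"
proof -
  have "(i, j, \<pi> j - \<pi> i) \<in> E \<longleftrightarrow> (\<exists>g. (i, j, g) \<in> E)" if "i \<in> U" "j \<in> U" for i j
    using that assms(2) unfolding balanced_def by blast
  then have "(\<lambda>i j. i \<in> U \<and> j \<in> U \<and> (i, j, \<pi> j - \<pi> i) \<in> E)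
      = (\<lambda>i j. i \<in> U \<and> j \<in> U \<and> (\<exists>g. (i, j, g) \<in> E))" by (intro ext) blast
  then show ?thesis using assms(1) unfolding conn_def tconn_def by simp
qed

lemma tconn_insert:
  assumes "gain_graph V E" "tconn E U \<pi>" "x \<notin> U" "y \<in> U" "(x, y, g) \<in> E"
  shows "tconn E (insert x U) (\<pi>(x := \<pi> y - g))"
proof -
  let ?r = "\<pi>(x := \<pi> y - g)" and ?U = "insert x U"
  let ?T = "\<lambda>i j. i \<in> ?U \<and> j \<in> ?U \<and> (i, j, ?r j - ?r i) \<in> E"
  have "tconn E U ?r" using assms(2) by (rule tconn_cong) (use assms(3) in auto)
  then have U: "?T\<^sup>*\<^sup>* i j" if "i \<in> U" "j \<in> U" for i j
  proof -
    have "(\<lambda>i j. i \<in> U \<and> j \<in> U \<and> (i, j, ?r j - ?r i) \<in> E)\<^sup>*\<^sup>* i j"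
      using \<open>tconn E U ?r\<close> that unfolding tconn_def by blast
    then show ?thesis by (rule rtranclp_le) blast
  qed
  have xy: "?T x y" "?T y x"
    using assms(3-5) gain_graphD(4)[OF assms(1,5)] by auto
  have "?T\<^sup>*\<^sup>* i y \<and> ?T\<^sup>*\<^sup>* y i" if "i \<in> ?U" for i
    using that U assms(4) xy by (cases "i = x") blast+
  then show ?thesis unfolding tconn_def by (meson rtranclp_trans)
qed

lemma tconn_imp_conn: "tconn E U \<pi> \<Longrightarrow> conn E U"
  unfolding tconn_def conn_def by (intro ballI, elim ballE, rule rtranclp_le) blast+

lemma conn_edge_out:
  assumes "conn E U" "S \<subseteq> U" "S \<noteq> {}" "S \<noteq> U"
  obtains i j g where "i \<in> S" "j \<in> U - S" "(i, j, g) \<in> E"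
proof -
  obtain s t where st: "s \<in> S" "t \<in> U - S" using assms by blast
  have "(\<lambda>i j. i \<in> U \<and> j \<in> U \<and> (\<exists>g. (i, j, g) \<in> E))\<^sup>*\<^sup>* s t"
    using assms(1,2) st unfolding conn_def by blast
  then have "t \<in> S \<or> (\<exists>i\<in>S. \<exists>j\<in>U - S. \<exists>g. (i, j, g) \<in> E)"
    by (induction rule: rtranclp_induct) (use st in blast)+
  then show ?thesis using st that by blast
qed

text \<open>A spanning tree can be switched to label \<open>0\<close>: a set S with a potential is
  enlarged by one vertex along an edge leaving it, the new value being forced by that edge.\<close>

lemma conn_imp_tconn:
  assumes "gain_graph V E" "conn E U" "finite U"
  shows "\<exists>\<pi>. tconn E U \<pi>"
proof (cases "U = {}")
  case False
  then obtain u where "u \<in> U" by blast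
  have "\<exists>\<rho>. tconn E U \<rho>" if "S \<subseteq> U" "S \<noteq> {}" "tconn E S \<pi>" for S \<pi>
    using that
  proof (induction "card (U - S)" arbitrary: S \<pi> rule: less_induct)
    case less
    show ?case
    proof (cases "S = U")
      case False
      obtain i j g where e: "i \<in> S" "j \<in> U - S" "(i, j, g) \<in> E"
        using conn_edge_out[OF assms(2) less.prems(1,2) False] .
      have "tconn E (insert j S) (\<pi>(j := \<pi> i - - g))"
        by (rule tconn_insert[OF assms(1) less.prems(3)]) (use e gain_graphD(4)[OF assms(1)] in auto)
      moreover have "card (U - insert j S) < card (U - S)"
        using assms(3) e by (intro psubset_card_mono) auto
      ultimately show ?thesis using less e by (metis DiffD1 insert_not_empty insert_subset)
    qed (use less in blast)
  qed
  from this[of "{u}"] show ?thesis using \<open>u \<in> U\<close> by simp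
qed (simp add: tconn_def)

lemma conn_insert:
  assumes "gain_graph V E" "conn E U" "y \<in> U" "(x, y, g) \<in> E" "finite U"
  shows "conn E (insert x U)"
proof (cases "x \<in> U")
  case False
  then show ?thesis
    using conn_imp_tconn[OF assms(1,2,5)] tconn_insert[OF assms(1) _ False assms(3,4)] tconn_imp_conn
    by blast
qed (use assms in \<open>simp add: insert_absorb\<close>)

text \<open>C is an inclusion-maximal connected subset of U through r; an edge leaving it within U
  would allow an enlargement by \<open>conn_insert\<close>.\<close>

lemma conn_component:
  assumes "gain_graph V E" "r \<in> U" "U \<subseteq> V"
  obtains C where "r \<in> C" "C \<subseteq> U" "conn E C"
    "\<And>i j g. i \<in> C \<Longrightarrow> j \<in> U - C \<Longrightarrow> (i, j, g) \<notin> E"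
proof -
  have "finite U" using assms unfolding gain_graph_def by (auto intro: finite_subset)
  define \<C> where "\<C> = {C. r \<in> C \<and> C \<subseteq> U \<and> conn E C}"
  have "finite \<C>" "{r} \<in> \<C>" using \<open>finite U\<close> assms(2) unfolding \<C>_def by auto
  then obtain C where C: "C \<in> \<C>" "\<And>B. B \<in> \<C> \<Longrightarrow> C \<subseteq> B \<Longrightarrow> C = B"
    using finite_has_maximal[of \<C>] by blast
  have "(i, j, g) \<notin> E" if "i \<in> C" "j \<in> U - C" for i j g
  proof
    assume "(i, j, g) \<in> E"
    then have "(j, i, - g) \<in> E" by (rule gain_graphD(4)[OF assms(1)])
    moreover have "conn E C" "finite C" using C(1) \<open>finite U\<close> unfolding \<C>_def
      by (auto intro: finite_subset)
    ultimately have "conn E (insert j C)" using conn_insert[OF assms(1)] that(1) by blast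
    then have "insert j C \<in> \<C>" using C(1) that unfolding \<C>_def by auto
    then show False using C(2)[of "insert j C"] that by blast
  qed
  then show ?thesis using that C(1) unfolding \<C>_def by blast
qed

lemma connected_fibresI:
  assumes "\<And>k. k \<in> K \<Longrightarrow> tconn E {v \<in> V. \<phi> v = k} \<pi>"
  shows "connected_fibres V E \<phi> \<pi> K"
  unfolding connected_fibres_def
proof (intro ballI impI)
  fix i j assume ij: "i \<in> V" "j \<in> V" "\<phi> i = \<phi> j \<and> \<phi> i \<in> K"
  define U where "U = {v \<in> V. \<phi> v = \<phi> i}"
  have "tconn E U \<pi>" "i \<in> U" "j \<in> U" using assms ij unfolding U_def by auto
  then have "(\<lambda>i j. i \<in> U \<and> j \<in> U \<and> (i, j, \<pi> j - \<pi> i) \<in> E)\<^sup>*\<^sup>* i j"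
    unfolding tconn_def by blast
  then show "(tight E \<phi> \<pi>)\<^sup>*\<^sup>* i j"
    by (rule rtranclp_le) (auto simp: tight_def U_def)
qed

text \<open>The sets are disjoint, so their potentials combine to one switching. C becomes vertex 3,
  where the two double edges meet; the two inequalities say that the parallel edges have different
  labels after switching.\<close>

lemma K3dd_model_of_sets:
  assumes "gain_graph V E" "A \<subseteq> V" "B \<subseteq> V" "C \<subseteq> V" "A \<inter> B = {}" "A \<inter> C = {}" "B \<inter> C = {}"
    and t: "tconn E A \<alpha>" "tconn E B \<beta>" "tconn E C \<gamma>"
    and AB: "i0 \<in> A" "j0 \<in> B" "(i0, j0, g0) \<in> E"
    and AC: "i1 \<in> A" "j1 \<in> C" "(i1, j1, g1) \<in> E" "i2 \<in> A" "j2 \<in> C" "(i2, j2, g2) \<in> E"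
      "g1 + \<alpha> i1 - \<gamma> j1 \<noteq> g2 + \<alpha> i2 - \<gamma> j2"
    and BC: "i3 \<in> B" "j3 \<in> C" "(i3, j3, g3) \<in> E" "i4 \<in> B" "j4 \<in> C" "(i4, j4, g4) \<in> E"
      "g3 + \<beta> i3 - \<gamma> j3 \<noteq> g4 + \<beta> i4 - \<gamma> j4"
  shows "K3dd_model V E"
proof -
  define \<phi> :: "'a \<Rightarrow> nat" where
    "\<phi> = (\<lambda>v. if v \<in> A then 1 else if v \<in> B then 2 else if v \<in> C then 3 else 0)"
  define \<pi> where "\<pi> = (\<lambda>v. if v \<in> A then \<alpha> v else if v \<in> B then \<beta> v else \<gamma> v)"
  have A: "\<phi> v = 1" "\<pi> v = \<alpha> v" if "v \<in> A" for v using that unfolding \<phi>_def \<pi>_def by auto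
  have B: "\<phi> v = 2" "\<pi> v = \<beta> v" if "v \<in> B" for v
    using that assms(5) unfolding \<phi>_def \<pi>_def by auto
  have C: "\<phi> v = 3" "\<pi> v = \<gamma> v" if "v \<in> C" for v
    using that assms(6,7) unfolding \<phi>_def \<pi>_def by auto
  have "{v \<in> V. \<phi> v = 1} = A" "{v \<in> V. \<phi> v = 2} = B" "{v \<in> V. \<phi> v = 3} = C"
    using assms(2-7) unfolding \<phi>_def by auto
  moreover have "tconn E A \<pi>" "tconn E B \<pi>" "tconn E C \<pi>"
    using t A B C by (blast intro: tconn_cong)+
  ultimately have "connected_fibres V E \<phi> \<pi> {1, 2, 3}"
    by (intro connected_fibresI) auto
  then show ?thesis
    by (rule K3dd_modelI[where a = "g0 + \<alpha> i0 - \<beta> j0"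
          and b = "g1 + \<alpha> i1 - \<gamma> j1" and b' = "g2 + \<alpha> i2 - \<gamma> j2"
          and c = "g3 + \<beta> i3 - \<gamma> j3" and c' = "g4 + \<beta> i4 - \<gamma> j4"])
      (use AB AC BC A B C in \<open>auto intro: crossI\<close>)
qed

section \<open>Vertices with two neighbours in a nonseparable graph\<close>

definition separable :: "'v set \<Rightarrow> ('v \<times> 'v \<times> int) set \<Rightarrow> bool" where
  "separable V E \<longleftrightarrow> (\<exists>A B x. A \<union> B = V \<and> A \<noteq> V \<and> B \<noteq> V \<and> A \<inter> B \<subseteq> {x} \<and>
     (\<forall>i j g. (i, j, g) \<in> E \<longrightarrow> i \<in> A \<and> j \<in> A \<or> i \<in> B \<and> j \<in> B))"

text \<open>Without such an edge, D together with x and the complement of D would be a separation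
  with common part inside {x}. Since \<open>separable\<close> also admits an empty common part,
  disconnected graphs are covered.\<close>

lemma nonseparable_edge_out:
  assumes "gain_graph V E" "\<not> separable V E" "D \<subseteq> V" "D \<noteq> {}" "x \<in> V" "insert x D \<noteq> V"
  shows "\<exists>i\<in>D. \<exists>j\<in>V - insert x D. \<exists>g. (i, j, g) \<in> E"
proof (rule ccontr)
  assume no_edge: "\<not> ?thesis"
  have *: "j \<in> insert x D" if "i \<in> D" "(i, j, g) \<in> E" for i j g
    using no_edge that gain_graphD(2)[OF assms(1) that(2)] by blast
  have "i \<in> insert x D \<and> j \<in> insert x D \<or> i \<in> V - D \<and> j \<in> V - D" if "(i, j, g) \<in> E" for i j g
    using *[of i j g] *[of j i "- g"] gain_graphD[OF assms(1) that] that by blast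
  then have "separable V E" unfolding separable_def
    by (intro exI[of _ "insert x D"] exI[of _ "V - D"] exI[of _ x]) (use assms(3-6) in blast)
  then show False using assms(2) by simp
qed

text \<open>Vertices of V - {v, w} outside the component of u could leave their set only through w:
  the other edges at v lead to u, which lies in the component.\<close>

lemma conn_delete_two:
  assumes G: "gain_graph V E" and "\<not> separable V E" "v \<in> V" "u \<in> V" "w \<in> V"
    and ne: "u \<noteq> v" "w \<noteq> v" "u \<noteq> w"
    and nbr: "\<forall>j g. (v, j, g) \<in> E \<longrightarrow> j \<in> {u, w}"
  shows "conn E (V - {v, w})"
proof -
  obtain C where C: "u \<in> C" "C \<subseteq> V - {v, w}" "conn E C"
    "\<And>i j g. i \<in> C \<Longrightarrow> j \<in> V - {v, w} - C \<Longrightarrow> (i, j, g) \<notin> E"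
    using conn_component[OF G, of u "V - {v, w}"] assms(4) ne by blast
  have "C = V - {v, w}"
  proof (rule ccontr)
    assume "C \<noteq> V - {v, w}"
    then have "V - {v, w} - C \<noteq> {}" using C(2) by blast
    moreover have "v \<notin> insert w (V - {v, w} - C)" using ne(2) by auto
    then have "insert w (V - {v, w} - C) \<noteq> V" using assms(3) by metis
    ultimately obtain i j g where e: "i \<in> V - {v, w} - C" "j \<in> V - insert w (V - {v, w} - C)" "(i, j, g) \<in> E"
      using nonseparable_edge_out[OF G assms(2), of "V - {v, w} - C" w] assms(5) by blast
    have "(j, i, - g) \<in> E" using gain_graphD(4)[OF G e(3)] .
    then show False using e C nbr by blast
  qed
  then show ?thesis using C(3) by simp
qed

text \<open>This supplies the vertex that can pass from the side of u to the side of w with both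
  sides staying connected. Among the vertices of U other than u with an edge to W, one is sought
  whose removal does not cut anything off from u. If x cuts off a part, nonseparability gives an
  edge from that part avoiding x; it must end in W, and its end in the cut-off part is the better
  candidate.\<close>

lemma movable_vertex:
  assumes G: "gain_graph V E" and ns: "\<not> separable V E" and "v \<in> V"
    and nbr: "\<forall>j g. (v, j, g) \<in> E \<longrightarrow> j \<in> {u, w}"
    and UW: "U \<union> W = V - {v}" "U \<inter> W = {}" "u \<in> U" "w \<in> W" and "conn E U" "U \<noteq> {u}"
  shows "\<exists>x\<in>U - {u}. \<exists>y\<in>W. \<exists>g. (x, y, g) \<in> E \<and> conn E (U - {x})"
proof -
  have finU: "finite U" using G UW unfolding gain_graph_def by (metis Un_infinite finite_Diff)
  have toW: "j \<in> W" if "i \<in> U - {u}" "(i, j, g) \<in> E" "j \<notin> U" for i j g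
  proof -
    have "(j, i, - g) \<in> E" "j \<in> V" using gain_graphD[OF G that(2)] by auto
    then show ?thesis using nbr that UW by blast
  qed
  have main: "\<exists>x\<in>U - {u}. \<exists>y\<in>W. \<exists>g. (x, y, g) \<in> E \<and> conn E (U - {x})"
    if "x \<in> U - {u}" "y \<in> W" "(x, y, g) \<in> E" "u \<in> C" "C \<subseteq> U - {x}" "conn E C"
      "\<And>i j g. i \<in> C \<Longrightarrow> j \<in> U - {x} - C \<Longrightarrow> (i, j, g) \<notin> E" for x y g C
    using that
  proof (induction "card (U - {x} - C)" arbitrary: x y g C rule: less_induct)
    case less
    show ?case
    proof (cases "C = U - {x}")
      case True
      then show ?thesis using less.prems by blast
    next
      case False
      let ?D = "U - {x} - C"
      have "?D \<noteq> {}" using False less.prems(5) by blast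
      moreover have "?D \<subseteq> V" "x \<in> V" "v \<notin> insert x ?D" using less.prems(1) UW(1) by auto
      then have "insert x ?D \<noteq> V" using \<open>v \<in> V\<close> by metis
      ultimately obtain i j h where e: "i \<in> ?D" "j \<in> V - insert x ?D" "(i, j, h) \<in> E"
        using nonseparable_edge_out[OF G ns, of ?D x] \<open>?D \<subseteq> V\<close> \<open>x \<in> V\<close> by blast
      have iU: "i \<in> U - {u}" using e(1) less.prems(4) by blast
      have "j \<notin> C" using less.prems(7)[of j i "- h"] e(1) gain_graphD(4)[OF G e(3)] by blast
      then have "j \<in> W" using toW[OF iU e(3)] e(2) by blast
      obtain C' where C': "u \<in> C'" "C' \<subseteq> U - {i}" "conn E C'"
        "\<And>a b g. a \<in> C' \<Longrightarrow> b \<in> U - {i} - C' \<Longrightarrow> (a, b, g) \<notin> E"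
        using conn_component[OF G, of u "U - {i}"] iU UW by blast
      obtain c d k where cd: "c \<in> C" "d \<in> U - C" "(c, d, k) \<in> E"
        using conn_edge_out[OF \<open>conn E U\<close>, of C] less.prems(1,4,5) by blast
      then have "d = x" using less.prems(7) by blast
      then have "(x, c, - k) \<in> E" using gain_graphD(4)[OF G cd(3)] by simp
      then have cx: "conn E (insert x C)"
        using conn_insert[OF G less.prems(6) cd(1)] finU less.prems(5)
        by (meson finite_Diff finite_subset)
      have "insert x C \<subseteq> C'"
      proof (rule ccontr)
        assume "\<not> insert x C \<subseteq> C'"
        then obtain a b l where "a \<in> C' \<inter> insert x C" "b \<in> insert x C - (C' \<inter> insert x C)" "(a, b, l) \<in> E"
          using conn_edge_out[OF cx, of "C' \<inter> insert x C"] C'(1) less.prems(4) by blast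
        moreover have "insert x C \<subseteq> U - {i}" using less.prems(1,5) e(1) by blast
        ultimately show False using C'(4) by blast
      qed
      \<comment> \<open>The component of u in U - {i} contains x and all of C, so what i cuts off
        lies within the part cut off by x and misses i itself.\<close>
      then have "card (U - {i} - C') < card ?D"
        using e(1) finU by (intro psubset_card_mono) blast+
      then show ?thesis using less.hyps iU \<open>j \<in> W\<close> e(3) C' by blast
    qed
  qed
  have "v \<notin> U" "U \<subseteq> V" using UW(1) by auto
  then have "U - {u} \<subseteq> V" "U - {u} \<noteq> {}" "u \<in> V" "insert u (U - {u}) \<noteq> V"
    using UW(3) \<open>U \<noteq> {u}\<close> \<open>v \<in> V\<close> by auto
  then obtain i j g where e: "i \<in> U - {u}" "j \<in> V - insert u (U - {u})" "(i, j, g) \<in> E"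
    using nonseparable_edge_out[OF G ns, of "U - {u}" u] by blast
  then have "j \<in> W" using toW[OF e(1) e(3)] by blast
  obtain C where "u \<in> C" "C \<subseteq> U - {i}" "conn E C"
    "\<And>a b g. a \<in> C \<Longrightarrow> b \<in> U - {i} - C \<Longrightarrow> (a, b, g) \<notin> E"
    using conn_component[OF G, of u "U - {i}"] e(1) UW by blast
  then show ?thesis using main[OF e(1) \<open>j \<in> W\<close> e(3)] by blast
qed

text \<open>The three branch sets are {v}, W and U. The pair v, U is joined by the two edges to u;
  the pair W, U is joined by two edges from x with different switched gains, which exist because U
  is balanced but loses balance when x is added.\<close>

lemma K3dd_of_unbalanced_insert:
  assumes G: "gain_graph V E" and "v \<in> V"
    and vE: "(v, u, a) \<in> E" "(v, u, a') \<in> E" "a \<noteq> a'" "(v, w, b) \<in> E"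
    and UW: "U \<subseteq> V - {v}" "W \<subseteq> V - {v}" "U \<inter> W = {}" "u \<in> U" "w \<in> W" "conn E U" "conn E W"
    and bal: "balanced E U \<pi>" and x: "x \<in> W" and unb: "\<nexists>\<rho>. balanced E (insert x U) \<rho>"
  shows "K3dd_model V E"
proof -
  have "finite V" using G unfolding gain_graph_def by simp
  obtain \<beta> where \<beta>: "tconn E W \<beta>"
    using conn_imp_tconn[OF G UW(7)] \<open>finite V\<close> UW(2) by (meson finite_Diff finite_subset)
  have "\<exists>j\<in>U. \<exists>j'\<in>U. \<exists>g g'. (x, j, g) \<in> E \<and> (x, j', g') \<in> E \<and> g - \<pi> j \<noteq> g' - \<pi> j'"
  proof (rule ccontr)
    assume con: "\<not> ?thesis"
    obtain t where t: "g - \<pi> j = t" if "(x, j, g) \<in> E" "j \<in> U" for j g using con by metis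
    have "x \<notin> U" using x UW by blast
    \<comment> \<open>If all edges from x into U have the same switched gain t, the value -t at x
      makes them tight.\<close>
    have "balanced E (insert x U) (\<pi>(x := - t))"
      unfolding balanced_def
    proof (intro ballI allI impI)
      fix i j g assume ij: "i \<in> insert x U" "j \<in> insert x U" "(i, j, g) \<in> E"
      have "i \<noteq> j" "(j, i, - g) \<in> E" using gain_graphD[OF G ij(3)] by auto
      then consider "i \<in> U" "j \<in> U" | "i = x" "j \<in> U" | "j = x" "i \<in> U" using ij by blast
      then show "g = (\<pi>(x := - t)) j - (\<pi>(x := - t)) i"
      proof cases
        case 1
        then show ?thesis using bal ij(3) \<open>x \<notin> U\<close> unfolding balanced_def by auto
      next
        case 2
        then show ?thesis using t[of j g] ij(3) \<open>x \<notin> U\<close> by auto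
      next
        case 3
        then show ?thesis using t[of i "- g"] \<open>(j, i, - g) \<in> E\<close> \<open>x \<notin> U\<close> by auto
      qed
    qed
    then show False using unb by blast
  qed
  then obtain j j' g g' where j: "j \<in> U" "j' \<in> U" "(x, j, g) \<in> E" "(x, j', g') \<in> E" "g - \<pi> j \<noteq> g' - \<pi> j'"
    by blast
  show ?thesis
    by (rule K3dd_model_of_sets[OF G, of "{v}" W U "\<lambda>_. 0" \<beta> \<pi> v w b v u a v u a' x j g x j' g'])
      (use assms(2) vE UW x j \<beta> balanced_conn_tconn[OF UW(6) bal] in auto)
qed

text \<open>Vertices move from U to W until U becomes balanced, which happens at the latest at U =
  {u}. The vertex moved last is the x of \<open>K3dd_of_unbalanced_insert\<close>.\<close>

lemma K3dd_of_unbalanced_part: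
  assumes G: "gain_graph V E" and ns: "\<not> separable V E" and v: "v \<in> V"
    and nbr: "\<forall>j g. (v, j, g) \<in> E \<longrightarrow> j \<in> {u, w}"
    and vE: "(v, u, a) \<in> E" "(v, u, a') \<in> E" "a \<noteq> a'" "(v, w, b) \<in> E"
    and "U \<union> W = V - {v}" "U \<inter> W = {}" "u \<in> U" "w \<in> W" "conn E U" "conn E W"
    and "\<nexists>\<rho>. balanced E U \<rho>"
  shows "K3dd_model V E"
  using assms(9-)
proof (induction "card U" arbitrary: U W rule: less_induct)
  case less
  have fin: "finite U" "finite W"
    using G less.prems(1) unfolding gain_graph_def by (metis finite_Diff finite_Un)+
  have "U \<noteq> {u}" using less.prems(7) balanced_singleton[OF G] by metis
  then obtain x y g where x: "x \<in> U - {u}" "y \<in> W" "(x, y, g) \<in> E" "conn E (U - {x})"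
    using movable_vertex[OF G ns v nbr less.prems(1-5)] by blast
  have W: "conn E (insert x W)" using conn_insert[OF G less.prems(6) x(2,3) fin(2)] .
  have UW: "(U - {x}) \<union> insert x W = V - {v}" "(U - {x}) \<inter> insert x W = {}" "u \<in> U - {x}" "w \<in> insert x W"
    using less.prems(1-4) x(1) by blast+
  show ?case
  proof (cases "\<exists>\<rho>. balanced E (U - {x}) \<rho>")
    case True
    then obtain \<rho> where \<rho>: "balanced E (U - {x}) \<rho>" by blast
    have "insert x (U - {x}) = U" using x(1) by blast
    then show ?thesis
      using K3dd_of_unbalanced_insert[OF G v vE, of "U - {x}" "insert x W" \<rho> x] UW x(4) W \<rho> less.prems(7)
      by auto
  next
    case False
    have "card (U - {x}) < card U" using fin(1) x(1) by (intro psubset_card_mono) auto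
    then show ?thesis using less.hyps UW x(4) W False by blast
  qed
qed

text \<open>The process starts with W = {w}. If V - {v, w} is already balanced, only w can destroy
  the balance of V - {v}, and w plays the part of x.\<close>

lemma balanced_or_K3dd:
  assumes G: "gain_graph V E" and ns: "\<not> separable V E" and v: "v \<in> V" and "u \<noteq> w"
    and nbr: "\<forall>j g. (v, j, g) \<in> E \<longrightarrow> j \<in> {u, w}"
    and vE: "(v, u, a) \<in> E" "(v, u, a') \<in> E" "a \<noteq> a'" "(v, w, b) \<in> E"
  shows "(\<exists>\<rho>. balanced E (V - {v}) \<rho>) \<or> K3dd_model V E"
proof -
  have uw: "u \<in> V" "w \<in> V" "u \<noteq> v" "w \<noteq> v" using gain_graphD[OF G] vE by blast+
  have c: "conn E (V - {v, w})" using conn_delete_two[OF G ns v uw assms(4) nbr] .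
  have UW: "(V - {v, w}) \<union> {w} = V - {v}" "(V - {v, w}) \<inter> {w} = {}" "u \<in> V - {v, w}" "w \<in> {w}"
    using uw assms(4) by auto
  show ?thesis
  proof (cases "\<exists>\<rho>. balanced E (V - {v, w}) \<rho>")
    case False
    then show ?thesis
      using K3dd_of_unbalanced_part[OF G ns v nbr vE UW c conn_singleton] by blast
  next
    case True
    then obtain \<rho> where \<rho>: "balanced E (V - {v, w}) \<rho>" by blast
    have "insert w (V - {v, w}) = V - {v}" using uw by auto
    then show ?thesis
      using K3dd_of_unbalanced_insert[OF G v vE, of "V - {v, w}" "{w}" \<rho> w] UW c \<rho> by auto
  qed
qed

text \<open>Here v alone is the vertex at which the double edges meet; u and everything else are the
  other two branch sets, adjacent because v does not separate u from the rest.\<close>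

lemma K3dd_of_two_double:
  assumes G: "gain_graph V E" and ns: "\<not> separable V E" and v: "v \<in> V" and "u \<noteq> w"
    and nbr: "\<forall>j g. (v, j, g) \<in> E \<longrightarrow> j \<in> {u, w}"
    and vE: "(v, u, a) \<in> E" "(v, u, a') \<in> E" "a \<noteq> a'" "(v, w, b) \<in> E" "(v, w, b') \<in> E" "b \<noteq> b'"
  shows "K3dd_model V E"
proof -
  have uw: "u \<in> V" "w \<in> V" "u \<noteq> v" "w \<noteq> v" using gain_graphD[OF G] vE by blast+
  have "conn E (V - {v, u})"
    by (rule conn_delete_two[OF G ns v uw(2,1,4,3)]) (use assms(4) nbr in auto)
  moreover have "finite (V - {v, u})" using G unfolding gain_graph_def by simp
  ultimately obtain \<beta> where \<beta>: "tconn E (V - {v, u}) \<beta>" using conn_imp_tconn[OF G] by blast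
  obtain j g where j: "j \<in> V - {v, u}" "(u, j, g) \<in> E"
    using nonseparable_edge_out[OF G ns, of "{u}" v] uw v assms(4) by auto
  have vE': "(u, v, - a) \<in> E" "(u, v, - a') \<in> E" "(w, v, - b) \<in> E" "(w, v, - b') \<in> E"
    using gain_graphD(4)[OF G] vE by blast+
  show ?thesis
    by (rule K3dd_model_of_sets[OF G, of "{u}" "V - {v, u}" "{v}" "\<lambda>_. 0" \<beta> "\<lambda>_. 0" u j g
          u v "- a" u v "- a'" w v "- b" w v "- b'"])
      (use uw v vE vE' j \<beta> assms(4) in auto)
qed

section \<open>Graphs of large minimum degree\<close>

text \<open>The two inequalities say that the triangles a, b, c and a, b, d are unbalanced.
  Contracting their common edge ab gives the vertex of the double edges, and the edge cd survives as
  the single one.\<close>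

lemma K3dd_of_merge:
  assumes G: "gain_graph V E" and cf: "connected_fibres V E \<phi> \<pi> K" and "{a, b, c, d} \<subseteq> K"
    and dist: "distinct [a, b, c, d]"
    and cr: "cross E \<phi> \<pi> a b g" "cross E \<phi> \<pi> a c p" "cross E \<phi> \<pi> b c q" "p \<noteq> g + q"
      "cross E \<phi> \<pi> a d r" "cross E \<phi> \<pi> b d s" "r \<noteq> g + s" "cross E \<phi> \<pi> c d t"
  shows "K3dd_model V E"
proof -
  define \<psi> :: "'a \<Rightarrow> nat" where
    "\<psi> = (\<lambda>v. if \<phi> v = c then 1 else if \<phi> v = d then 2 else if \<phi> v = a \<or> \<phi> v = b then 3 else 0)"
  \<comment> \<open>Shifting the fibre of b by g gives the edge from a to b gain \<open>0\<close>,
    so the two fibres merge along a tight edge.\<close>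
  define \<rho> where "\<rho> = (\<lambda>v. \<pi> v + (if \<phi> v = b then g else 0))"
  have crI: "cross E \<psi> \<rho> k' l' h'"
    if "cross E \<phi> \<pi> k l h" "\<And>v. \<phi> v = k \<Longrightarrow> \<psi> v = k'" "\<And>v. \<phi> v = l \<Longrightarrow> \<psi> v = l'"
      "h' = h + (if k = b then g else 0) - (if l = b then g else 0)" for k l h k' l' h'
  proof -
    obtain i j where "(i, j, h - \<pi> i + \<pi> j) \<in> E" "\<phi> i = k" "\<phi> j = l"
      using \<open>cross E \<phi> \<pi> k l h\<close> unfolding cross_def by blast
    then show ?thesis using that(2-) by (intro crossI[of i j]) (auto simp: \<rho>_def)
  qed
  have t: "tight E \<psi> \<rho> i j" if "tight E \<phi> \<pi> i j" for i j
    using that unfolding tight_def \<psi>_def \<rho>_def by auto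
  have same: "(tight E \<psi> \<rho>)\<^sup>*\<^sup>* i j" if "i \<in> V" "j \<in> V" "\<phi> i = \<phi> j" "\<phi> i \<in> K" for i j
  proof -
    have "(tight E \<phi> \<pi>)\<^sup>*\<^sup>* i j" using that cf unfolding connected_fibres_def by blast
    then show ?thesis by (rule rtranclp_le) (rule t)
  qed
  obtain i0 j0 where e: "(i0, j0, g - \<pi> i0 + \<pi> j0) \<in> E" "\<phi> i0 = a" "\<phi> j0 = b"
    using cr(1) unfolding cross_def by blast
  have e': "i0 \<in> V" "j0 \<in> V" "(j0, i0, - (g - \<pi> i0 + \<pi> j0)) \<in> E" using gain_graphD[OF G e(1)] by auto
  have "\<rho> j0 - \<rho> i0 = g - \<pi> i0 + \<pi> j0" using e dist by (auto simp: \<rho>_def)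
  then have t0: "tight E \<psi> \<rho> i0 j0" "tight E \<psi> \<rho> j0 i0"
    using e e' dist unfolding tight_def by (auto simp: \<psi>_def minus_diff_eq[of "\<rho> j0" "\<rho> i0", symmetric] simp del: minus_diff_eq)
  have ab: "(tight E \<psi> \<rho>)\<^sup>*\<^sup>* i j \<and> (tight E \<psi> \<rho>)\<^sup>*\<^sup>* j i"
    if "i \<in> V" "j \<in> V" "\<phi> i = a" "\<phi> j = b" for i j
  proof -
    have "(tight E \<psi> \<rho>)\<^sup>*\<^sup>* i i0" "(tight E \<psi> \<rho>)\<^sup>*\<^sup>* j0 j" "(tight E \<psi> \<rho>)\<^sup>*\<^sup>* i0 i" "(tight E \<psi> \<rho>)\<^sup>*\<^sup>* j j0"
      using same that e e' assms(3) by auto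
    then show ?thesis using t0 by (meson rtranclp.rtrancl_into_rtrancl rtranclp_trans)
  qed
  have "connected_fibres V E \<psi> \<rho> {1, 2, 3}"
    unfolding connected_fibres_def
  proof (intro ballI impI)
    fix i j assume ij: "i \<in> V" "j \<in> V" "\<psi> i = \<psi> j \<and> \<psi> i \<in> {1, 2, 3}"
    then consider "\<phi> i = \<phi> j" "\<phi> i \<in> K" | "\<phi> i = a" "\<phi> j = b" | "\<phi> i = b" "\<phi> j = a"
      using assms(3) unfolding \<psi>_def by (auto split: if_splits)
    then show "(tight E \<psi> \<rho>)\<^sup>*\<^sup>* i j" using ij same ab by cases blast+
  qed
  moreover have "cross E \<psi> \<rho> 1 2 t"
    by (rule crI[OF cr(8)]) (use dist in \<open>auto simp: \<psi>_def\<close>)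
  moreover have "cross E \<psi> \<rho> 3 1 p"
    by (rule crI[OF cr(2)]) (use dist in \<open>auto simp: \<psi>_def\<close>)
  moreover have "cross E \<psi> \<rho> 3 1 (g + q)"
    by (rule crI[OF cr(3)]) (use dist in \<open>auto simp: \<psi>_def\<close>)
  moreover have "cross E \<psi> \<rho> 3 2 r"
    by (rule crI[OF cr(5)]) (use dist in \<open>auto simp: \<psi>_def\<close>)
  moreover have "cross E \<psi> \<rho> 3 2 (g + s)"
    by (rule crI[OF cr(6)]) (use dist in \<open>auto simp: \<psi>_def\<close>)
  ultimately show ?thesis
    using K3dd_modelI[of V E \<psi> \<rho> t "- p" "- (g + q)" "- r" "- (g + s)"] cr(4,7) cross_sym[OF G] by (metis neg_equal_iff_equal)
qed

text \<open>The triangles 123, 234, 134, 124 have gains \<alpha>, \<gamma>, \<beta> - \<alpha>,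
  \<beta> - \<gamma> up to sign. If three of them vanish, so does the fourth; hence an unbalanced
  case has two unbalanced triangles. Any two triangles share an edge, and the cases run over the
  choices of this edge.\<close>

lemma K4_or_K3dd_of_gains:
  assumes G: "gain_graph V E" and cf: "connected_fibres V E \<phi> \<pi> {1, 2, 3, 4}"
    and cr: "cross E \<phi> \<pi> 1 2 0" "cross E \<phi> \<pi> 2 3 0" "cross E \<phi> \<pi> 3 4 0"
      "cross E \<phi> \<pi> 1 3 \<alpha>" "cross E \<phi> \<pi> 1 4 \<beta>" "cross E \<phi> \<pi> 2 4 \<gamma>"
  shows "K4_model V E \<or> K3dd_model V E"
proof -
  have cr': "cross E \<phi> \<pi> 2 1 0" "cross E \<phi> \<pi> 3 2 0" "cross E \<phi> \<pi> 4 3 0"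
    "cross E \<phi> \<pi> 3 1 (- \<alpha>)" "cross E \<phi> \<pi> 4 1 (- \<beta>)" "cross E \<phi> \<pi> 4 2 (- \<gamma>)"
    using cr[THEN cross_sym[OF G]] by simp_all
  note merge = K3dd_of_merge[OF G cf]
  consider "\<alpha> = 0" "\<beta> = 0" "\<gamma> = 0" | "\<alpha> \<noteq> 0" "\<gamma> \<noteq> 0" | "\<alpha> \<noteq> 0" "\<beta> \<noteq> \<alpha>" "\<gamma> = 0"
    | "\<alpha> \<noteq> 0" "\<beta> = \<alpha>" "\<gamma> = 0" | "\<alpha> = 0" "\<gamma> \<noteq> 0" "\<beta> \<noteq> 0" | "\<alpha> = 0" "\<gamma> \<noteq> 0" "\<beta> = 0"
    | "\<alpha> = 0" "\<gamma> = 0" "\<beta> \<noteq> 0" by blast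
  then show ?thesis
  proof cases
    case 1
    then show ?thesis using K4_modelI[OF cf] cr by blast
  next
    case 2
    then show ?thesis using merge[of 2 3 1 4 0 0 "- \<alpha>" \<gamma> 0 \<beta>] cr cr' by simp
  next
    case 3
    then show ?thesis using merge[of 1 3 2 4 \<alpha> 0 0 \<beta> 0 \<gamma>] cr cr' by simp
  next
    case 4
    then show ?thesis using merge[of 1 2 3 4 0 \<alpha> 0 \<beta> \<gamma> 0] cr cr' by simp
  next
    case 5
    then show ?thesis using merge[of 3 4 1 2 0 "- \<alpha>" "- \<beta>" 0 "- \<gamma>" 0] cr cr' by simp
  next
    case 6
    then show ?thesis using merge[of 2 4 1 3 \<gamma> 0 "- \<beta>" 0 0 \<alpha>] cr cr' by simp
  next
    case 7
    then show ?thesis using merge[of 1 4 2 3 \<beta> 0 "- \<gamma>" \<alpha> 0 0] cr cr' by simp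
  qed
qed

section \<open>Longest paths and their rotations\<close>

definition is_path :: "'v set \<Rightarrow> ('v \<times> 'v \<times> int) set \<Rightarrow> nat \<Rightarrow> (nat \<Rightarrow> 'v) \<Rightarrow> bool" where
  "is_path V E n x \<longleftrightarrow> inj_on x {..n} \<and> x ` {..n} \<subseteq> V \<and> (\<forall>k<n. \<exists>g. (x k, x (Suc k), g) \<in> E)"

lemma path_potential:
  assumes "is_path V E n x"
  obtains \<pi> where "\<And>k. k < n \<Longrightarrow> (x k, x (Suc k), \<pi> (x (Suc k)) - \<pi> (x k)) \<in> E"
proof -
  obtain g where g: "\<And>k. k < n \<Longrightarrow> (x k, x (Suc k), g k) \<in> E"
    using assms unfolding is_path_def by metis
  define \<pi> where "\<pi> = (\<lambda>v. \<Sum>i<inv_into {..n} x v. g i)"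
  have "\<pi> (x k) = (\<Sum>i<k. g i)" if "k \<le> n" for k
    using that assms unfolding \<pi>_def is_path_def by simp
  then have "(x k, x (Suc k), \<pi> (x (Suc k)) - \<pi> (x k)) \<in> E" if "k < n" for k
    using that g by simp
  then show thesis using that by blast
qed

text \<open>A monotone f cuts the path into consecutive segments, each connected by tight path
  edges. Vertices off the path receive \<open>0\<close>, which is kept out of K.\<close>

lemma path_fibres:
  assumes G: "gain_graph V E" and p: "is_path V E n x"
    and \<pi>: "\<And>k. k < n \<Longrightarrow> (x k, x (Suc k), \<pi> (x (Suc k)) - \<pi> (x k)) \<in> E"
    and "mono f" "0 \<notin> K"
  obtains \<phi> where "\<And>k. k \<le> n \<Longrightarrow> \<phi> (x k) = f k" "connected_fibres V E \<phi> \<pi> K"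
proof -
  define \<phi> where "\<phi> = (\<lambda>v. if v \<in> x ` {..n} then f (inv_into {..n} x v) else 0)"
  have \<phi>: "\<phi> (x k) = f k" if "k \<le> n" for k
    using that p unfolding \<phi>_def is_path_def by simp
  have step: "tight E \<phi> \<pi> (x k) (x (Suc k))" "tight E \<phi> \<pi> (x (Suc k)) (x k)"
    if "k < n" "f k = f (Suc k)" for k
    using \<phi> \<pi>[OF that(1)] gain_graphD(4)[OF G \<pi>[OF that(1)]] that unfolding tight_def by auto
  have seg: "(tight E \<phi> \<pi>)\<^sup>*\<^sup>* (x i) (x j) \<and> (tight E \<phi> \<pi>)\<^sup>*\<^sup>* (x j) (x i)"
    if "i \<le> j" "j \<le> n" "f i = f j" for i j
    using that
  proof (induction j rule: dec_induct)
    case (step j)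
    have "f i = f j" "f j = f (Suc j)"
      using step.hyps step.prems \<open>mono f\<close>[THEN monoD, of i j] \<open>mono f\<close>[THEN monoD, of j "Suc j"] by auto
    then show ?case
      using step.IH step.prems \<open>\<And>k. k < n \<Longrightarrow> f k = f (Suc k) \<Longrightarrow> tight E \<phi> \<pi> (x k) (x (Suc k))\<close>[of j]
        \<open>\<And>k. k < n \<Longrightarrow> f k = f (Suc k) \<Longrightarrow> tight E \<phi> \<pi> (x (Suc k)) (x k)\<close>[of j]
      by (meson Suc_le_lessD converse_rtranclp_into_rtranclp less_imp_le rtranclp.rtrancl_into_rtrancl)
  qed simp
  have "connected_fibres V E \<phi> \<pi> K"
    unfolding connected_fibres_def
  proof (intro ballI impI)
    fix a b assume "a \<in> V" "b \<in> V" and ab: "\<phi> a = \<phi> b \<and> \<phi> a \<in> K"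
    then have "a \<in> x ` {..n}" "b \<in> x ` {..n}" using \<open>0 \<notin> K\<close> unfolding \<phi>_def by (metis)+
    then obtain i j where "a = x i" "b = x j" "i \<le> n" "j \<le> n" by auto
    then show "(tight E \<phi> \<pi>)\<^sup>*\<^sup>* a b" using seg[of i j] seg[of j i] ab \<phi> by (metis linear)
  qed
  then show thesis using that \<phi> by blast
qed

text \<open>A neighbour of the first vertex off the path would prolong it. The second conclusion
  holds for every path of the maximal length, so that it applies again after a rotation.\<close>

lemma longest_path:
  assumes G: "gain_graph V E" and "V \<noteq> {}"
  obtains n where "\<exists>x. is_path V E n x"
    "\<And>x j g. is_path V E n x \<Longrightarrow> (x 0, j, g) \<in> E \<Longrightarrow> \<exists>k\<in>{1..n}. j = x k"
proof -
  obtain r where "r \<in> V" using assms by blast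
  have "is_path V E 0 (\<lambda>_. r)" using \<open>r \<in> V\<close> unfolding is_path_def by simp
  moreover have "n \<le> card V" if "is_path V E n x" for n x
  proof -
    have "card (x ` {..n}) \<le> card V"
      using that G unfolding is_path_def gain_graph_def by (intro card_mono) auto
    then show ?thesis using that unfolding is_path_def by (simp add: card_image)
  qed
  ultimately have "0 \<in> {n. \<exists>x. is_path V E n x}" "{n. \<exists>x. is_path V E n x} \<subseteq> {..card V}" by auto
  then have "finite {n. \<exists>x. is_path V E n x}" "{n. \<exists>x. is_path V E n x} \<noteq> {}"
    by (auto intro: finite_subset)
  note Max_in[OF this] Max_ge[OF this(1)]
  then obtain n where n: "\<exists>x. is_path V E n x" "\<And>m x. is_path V E m x \<Longrightarrow> m \<le> n"
    by auto
  have "\<exists>k\<in>{1..n}. j = x k" if p: "is_path V E n x" and e: "(x 0, j, g) \<in> E" for x j g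
  proof (rule ccontr)
    assume con: "\<not> ?thesis"
    define y where "y = (\<lambda>k. case k of 0 \<Rightarrow> j | Suc k \<Rightarrow> x k)"
    have j: "j \<in> V" "j \<noteq> x 0" "(j, x 0, - g) \<in> E" using gain_graphD[OF G e] by auto
    have "j \<noteq> x k" if "k \<le> n" for k using con j(2) that by (cases k) auto
    then have "inj_on y {..Suc n}"
      using p unfolding is_path_def inj_on_def y_def by (auto split: nat.splits)
    moreover have "x k \<in> V" if "k \<le> n" for k using that p unfolding is_path_def by auto
    then have "y ` {..Suc n} \<subseteq> V" using j(1) unfolding y_def by (auto split: nat.splits)
    moreover have "\<exists>g. (y k, y (Suc k), g) \<in> E" if "k < Suc n" for k
      using that p j unfolding is_path_def y_def by (auto split: nat.splits)
    ultimately have "is_path V E (Suc n) y" unfolding is_path_def by blast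
    then show False using n(2) by fastforce
  qed
  then show thesis using that n(1) by blast
qed

text \<open>A rotation in the sense of Posa: the chord from \<open>x 0\<close> to \<open>x a\<close>
  replaces the path edge between \<open>x (a - 1)\<close> and \<open>x a\<close>, so
  \<open>x (a - 1)\<close> becomes the first vertex, and positions from a on are unchanged.\<close>

lemma path_rotate:
  assumes G: "gain_graph V E" and p: "is_path V E n x" and a: "1 \<le> a" "a \<le> n" "(x 0, x a, g) \<in> E"
  shows "is_path V E n (\<lambda>k. if k < a then x (a - 1 - k) else x k)"
proof -
  let ?y = "\<lambda>k. if k < a then x (a - 1 - k) else x k"
  define r where "r k = (if k < a then a - 1 - k else k)" for k
  have "inj_on r {..n}" unfolding inj_on_def r_def using a(1) by (auto split: if_splits)
  moreover have r: "r k \<le> n" if "k \<le> n" for k using that a(2) unfolding r_def by auto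
  then have "inj_on x (r ` {..n})"
    using p unfolding is_path_def by (auto intro: inj_on_subset)
  ultimately have "inj_on (x \<circ> r) {..n}" by (rule comp_inj_on)
  moreover have y: "x \<circ> r = ?y" unfolding r_def by auto
  ultimately have "inj_on ?y {..n}" by simp
  moreover have "(x \<circ> r) ` {..n} \<subseteq> V" using p r unfolding is_path_def by auto
  then have "?y ` {..n} \<subseteq> V" unfolding y .
  moreover have "\<exists>g. (?y k, ?y (Suc k), g) \<in> E" if "k < n" for k
  proof -
    consider "Suc k < a" | "Suc k = a" | "a \<le> k" by linarith
    then show ?thesis
    proof cases
      case 1
      obtain h where "(x (a - 1 - Suc k), x (Suc (a - 1 - Suc k)), h) \<in> E"
        using p 1 a(2) unfolding is_path_def by force
      moreover have "Suc (a - 1 - Suc k) = a - 1 - k" using 1 by simp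
      ultimately show ?thesis using gain_graphD(4)[OF G] 1 by fastforce
    next
      case 2
      then show ?thesis using a(3) by auto
    next
      case 3
      then show ?thesis using p that unfolding is_path_def by simp
    qed
  qed
  ultimately show ?thesis unfolding is_path_def by blast
qed

text \<open>Among all longest paths, a is the least position \<ge> 2 of a neighbour of the first
  vertex. A third neighbour of \<open>x 0\<close> then lies at a position b > a. Rotating at a,
  minimality applies to the new first vertex \<open>x (a - 1)\<close> as well and gives it a
  neighbour at a position c > a. So both chords end beyond \<open>x a\<close>.\<close>

lemma K4_or_K3dd_of_min_degree:
  assumes G: "gain_graph V E" and "V \<noteq> {}"
    and deg: "\<And>v s t. v \<in> V \<Longrightarrow> \<exists>j g. (v, j, g) \<in> E \<and> j \<notin> {s, t}"
  shows "K4_model V E \<or> K3dd_model V E"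
proof -
  obtain n where ex: "\<exists>x. is_path V E n x"
    and max: "\<And>x j g. is_path V E n x \<Longrightarrow> (x 0, j, g) \<in> E \<Longrightarrow> \<exists>k\<in>{1..n}. j = x k"
    using longest_path[OF assms(1,2)] by metis
  define P where "P a \<longleftrightarrow> (\<exists>x g. is_path V E n x \<and> 2 \<le> a \<and> a \<le> n \<and> (x 0, x a, g) \<in> E)" for a
  have nbr: "\<exists>k g. (x 0, x k, g) \<in> E \<and> 2 \<le> k \<and> k \<le> n \<and> k \<noteq> a" if "is_path V E n x" for x a
  proof -
    have "x 0 \<in> V" using that unfolding is_path_def by auto
    then obtain j g where j: "(x 0, j, g) \<in> E" "j \<notin> {x 1, x a}" using deg by blast
    then obtain k where "k \<in> {1..n}" "j = x k" using max[OF \<open>is_path V E n x\<close>] by blast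
    moreover have "k \<noteq> 1" "k \<noteq> a" using j(2) \<open>j = x k\<close> by auto
    ultimately show ?thesis using j(1) by (intro exI[of _ k] exI[of _ g]) auto
  qed
  obtain x0 where "is_path V E n x0" using ex by blast
  then have "\<exists>a. P a" using nbr[of x0] unfolding P_def by blast
  define a where "a = (LEAST a. P a)"
  have "P a" and least: "\<And>k. P k \<Longrightarrow> a \<le> k"
    unfolding a_def using \<open>\<exists>a. P a\<close> by (auto intro: LeastI_ex Least_le)
  then obtain x g where p: "is_path V E n x" and a: "2 \<le> a" "a \<le> n" "(x 0, x a, g) \<in> E"
    unfolding P_def by blast
  obtain b gb where b: "(x 0, x b, gb) \<in> E" "2 \<le> b" "b \<le> n" "b \<noteq> a" using nbr[OF p] by blast
  then have "a < b" using least[of b] p unfolding P_def by fastforce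
  let ?y = "\<lambda>k. if k < a then x (a - 1 - k) else x k"
  have q: "is_path V E n ?y" by (rule path_rotate[OF G p]) (use a in auto)
  obtain c gc where c: "(?y 0, ?y c, gc) \<in> E" "2 \<le> c" "c \<le> n" "c \<noteq> a" using nbr[OF q] by blast
  then have "a < c" using least[of c] q unfolding P_def by fastforce
  then have c': "(x (a - 1), x c, gc) \<in> E" using c(1) a(1) by simp
  obtain \<pi> where \<pi>: "\<And>k. k < n \<Longrightarrow> (x k, x (Suc k), \<pi> (x (Suc k)) - \<pi> (x k)) \<in> E"
    using path_potential[OF p] by blast
  \<comment> \<open>The branch sets are the segment before \<open>x (a - 1)\<close>, the vertex
    \<open>x (a - 1)\<close>, the vertex \<open>x a\<close>, and the rest of the path. Path edges
    join consecutive ones; the chords from \<open>x 0\<close> to \<open>x a\<close> and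
    \<open>x b\<close> and from \<open>x (a - 1)\<close> to \<open>x c\<close> supply the other
    three pairs.\<close>
  define f :: "nat \<Rightarrow> nat" where
    "f k = (if k < a - 1 then 1 else if k = a - 1 then 2 else if k = a then 3 else 4)" for k
  have "mono f" unfolding mono_def f_def by auto
  then obtain \<phi> where \<phi>: "\<And>k. k \<le> n \<Longrightarrow> \<phi> (x k) = f k" "connected_fibres V E \<phi> \<pi> {1, 2, 3, 4}"
    using path_fibres[OF G p \<pi>, of f "{1, 2, 3, 4}"] by auto
  have on_path: "cross E \<phi> \<pi> (f k) (f (Suc k)) 0" if "k < n" for k
    by (rule crossI[OF \<pi>[OF that]]) (use \<phi>(1) that in auto)
  have chord: "cross E \<phi> \<pi> (f i) (f j) (h + \<pi> (x i) - \<pi> (x j))" if "(x i, x j, h) \<in> E" "i \<le> n" "j \<le> n" for i j h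
    by (rule crossI[OF that(1)]) (use \<phi>(1) that in auto)
  have f: "f 0 = 1" "f (a - 2) = 1" "f (a - 1) = 2" "f a = 3" "f (Suc a) = 4" "f b = 4" "f c = 4"
    using a(1) \<open>a < b\<close> \<open>a < c\<close> unfolding f_def by auto
  have "Suc (a - 2) = a - 1" "Suc (a - 1) = a" "a - 2 < n" "a - 1 < n" "a < n"
    using a \<open>a < b\<close> b(3) by auto
  then have "cross E \<phi> \<pi> 1 2 0" "cross E \<phi> \<pi> 2 3 0" "cross E \<phi> \<pi> 3 4 0"
    using on_path[of "a - 2"] on_path[of "a - 1"] on_path[of a] by (simp_all only: f)
  moreover have "\<exists>\<alpha>. cross E \<phi> \<pi> 1 3 \<alpha>" "\<exists>\<beta>. cross E \<phi> \<pi> 1 4 \<beta>" "\<exists>\<gamma>. cross E \<phi> \<pi> 2 4 \<gamma>"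
    using chord[OF a(3) _ a(2)] chord[OF b(1) _ b(3)] chord[OF c' _ c(3)] \<open>a - 1 < n\<close>
    unfolding f by auto
  ultimately show ?thesis using K4_or_K3dd_of_gains[OF G \<phi>(2)] by blast
qed

text \<open>A second neighbour of the first vertex of a longest path closes a cycle, of gain
  \<alpha> after switching the path to \<open>0\<close>. A balanced cycle is cut into three branch
  sets; an unbalanced one has \<open>x 0\<close> against the rest, joined by edges of gain
  \<open>0\<close> and \<alpha>.\<close>

lemma K3_or_K2d_of_min_degree:
  assumes G: "gain_graph V E" and "V \<noteq> {}"
    and deg: "\<And>v s. v \<in> V \<Longrightarrow> \<exists>j g. (v, j, g) \<in> E \<and> j \<noteq> s"
  shows "K3_model V E \<or> K2d_model V E"
proof -
  obtain n where ex: "\<exists>x. is_path V E n x"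
    and max: "\<And>x j g. is_path V E n x \<Longrightarrow> (x 0, j, g) \<in> E \<Longrightarrow> \<exists>k\<in>{1..n}. j = x k"
    using longest_path[OF assms(1,2)] by metis
  obtain x where p: "is_path V E n x" using ex by blast
  then have "x 0 \<in> V" unfolding is_path_def by auto
  then obtain j g where j: "(x 0, j, g) \<in> E" "j \<noteq> x 1" using deg by blast
  then obtain a where a: "a \<in> {1..n}" "j = x a" using max[OF p] by blast
  then have "2 \<le> a" "a \<le> n" using j(2) by (cases "a = 1"; auto)+
  obtain \<pi> where \<pi>: "\<And>k. k < n \<Longrightarrow> (x k, x (Suc k), \<pi> (x (Suc k)) - \<pi> (x k)) \<in> E"
    using path_potential[OF p] by blast
  have on_path: "cross E \<phi> \<pi> (f k) (f (Suc k)) 0" if "k < n" "\<forall>k\<le>n. \<phi> (x k) = f k" for k \<phi> f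
    by (rule crossI[OF \<pi>[OF that(1)]]) (use that in auto)
  define \<alpha> where "\<alpha> = g + \<pi> (x 0) - \<pi> (x a)"
  have chord: "cross E \<phi> \<pi> (f 0) (f a) \<alpha>" if "\<forall>k\<le>n. \<phi> (x k) = f k" for \<phi> f
    unfolding \<alpha>_def by (rule crossI) (use that j(1) a \<open>a \<le> n\<close> in auto)
  show ?thesis
  proof (cases "\<alpha> = 0")
    case True
    define f :: "nat \<Rightarrow> nat" where "f k = (if k = 0 then 1 else if k < a then 2 else 3)" for k
    have "mono f" unfolding mono_def f_def by auto
    then obtain \<phi> where \<phi>: "\<And>k. k \<le> n \<Longrightarrow> \<phi> (x k) = f k" "connected_fibres V E \<phi> \<pi> {1, 2, 3}"
      using path_fibres[OF G p \<pi>, of f "{1, 2, 3}"] by auto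
    have "Suc (a - 1) = a" using \<open>2 \<le> a\<close> by simp
    then have "K3_model V E"
      using K3_modelI[OF \<phi>(2)] on_path[of 0 \<phi> f] on_path[of "a - 1" \<phi> f] chord[of \<phi> f] \<phi>(1)
        True \<open>2 \<le> a\<close> \<open>a \<le> n\<close> by (simp add: f_def)
    then show ?thesis by blast
  next
    case False
    define f :: "nat \<Rightarrow> nat" where "f k = (if k = 0 then 1 else 2)" for k
    have "mono f" unfolding mono_def f_def by auto
    then obtain \<phi> where \<phi>: "\<And>k. k \<le> n \<Longrightarrow> \<phi> (x k) = f k" "connected_fibres V E \<phi> \<pi> {1, 2}"
      using path_fibres[OF G p \<pi>, of f "{1, 2}"] by auto
    have "K2d_model V E"
      using K2d_modelI[OF \<phi>(2), of 0 \<alpha>] on_path[of 0 \<phi> f] chord[of \<phi> f] \<phi>(1) False \<open>2 \<le> a\<close> \<open>a \<le> n\<close>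
      by (simp add: f_def)
    then show ?thesis by blast
  qed
qed

section \<open>Realizing gain graphs in the plane and on the line\<close>

lemma L2_set_sq: "(L2_set f A)\<^sup>2 = (\<Sum>k\<in>A. (f k)\<^sup>2)"
  unfolding L2_set_def by (simp add: sum_nonneg)

lemma L2_set_comb_sq:
  "(L2_set (\<lambda>k. s * x k + t * l k) A)\<^sup>2 =
     s\<^sup>2 * (L2_set x A)\<^sup>2 + 2 * s * t * (\<Sum>k\<in>A. x k * l k) + t\<^sup>2 * (L2_set l A)\<^sup>2"
proof -
  have "(\<Sum>k\<in>A. (s * x k + t * l k)\<^sup>2) =
      (\<Sum>k\<in>A. s\<^sup>2 * (x k)\<^sup>2 + 2 * s * t * (x k * l k) + t\<^sup>2 * (l k)\<^sup>2)"
    by (rule sum.cong) (simp_all add: power2_eq_square algebra_simps)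
  then show ?thesis unfolding L2_set_sq by (simp add: sum.distrib sum_distrib_left)
qed

lemma Cauchy_Schwarz_L2_set: "(\<Sum>k\<in>A. x k * l k)\<^sup>2 \<le> (L2_set x A)\<^sup>2 * (L2_set l A)\<^sup>2"
proof -
  have "\<bar>\<Sum>k\<in>A. x k * l k\<bar> \<le> (\<Sum>k\<in>A. \<bar>x k\<bar> * \<bar>l k\<bar>)"
    using sum_abs[of "\<lambda>k. x k * l k" A] by (simp add: abs_mult)
  also have "\<dots> \<le> L2_set x A * L2_set l A" by (rule L2_set_mult_ineq)
  finally have "\<bar>\<Sum>k\<in>A. x k * l k\<bar>\<^sup>2 \<le> (L2_set x A * L2_set l A)\<^sup>2"
    by (intro power_mono) auto
  then show ?thesis by (simp add: power_mult_distrib)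
qed

text \<open>Two vectors with a given Gram matrix fit into the plane even when one of them is already
  placed as m. Writing y as (a + ih) m, the product with l determines a and the length of x
  determines the square of h, which is nonnegative by Cauchy-Schwarz. If m = 0, the product is 0 and
  only the length of y matters.\<close>

lemma complex_gram_extend:
  fixes x l :: "'k \<Rightarrow> real" and m :: complex
  assumes m: "cmod m = L2_set l A"
  obtains y where "\<And>s t :: real. cmod (of_real s * y + of_real t * m) = L2_set (\<lambda>k. s * x k + t * l k) A"
proof -
  define c where "c = (\<Sum>k\<in>A. x k * l k)"
  have cs: "c\<^sup>2 \<le> (L2_set x A)\<^sup>2 * (cmod m)\<^sup>2"
    unfolding c_def m by (rule Cauchy_Schwarz_L2_set)
  have "\<exists>y. (cmod y)\<^sup>2 = (L2_set x A)\<^sup>2 \<and> Re y * Re m + Im y * Im m = c"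
  proof (cases "m = 0")
    case True
    then have "c = 0" using cs by simp
    then show ?thesis using True by (intro exI[of _ "of_real (L2_set x A)"]) simp
  next
    case False
    define N where "N = (cmod m)\<^sup>2"
    have N: "N > 0" "N = (Re m)\<^sup>2 + (Im m)\<^sup>2"
      using False unfolding N_def by (simp, simp only: cmod_power2)
    define a where "a = c / N"
    define h where "h = sqrt ((L2_set x A)\<^sup>2 / N - a\<^sup>2)"
    have "a\<^sup>2 * N = c\<^sup>2 / N" using N(1) unfolding a_def by (simp add: power2_eq_square)
    also have "\<dots> \<le> (L2_set x A)\<^sup>2" using cs N(1) unfolding N_def[symmetric] by (simp add: pos_divide_le_eq)
    finally have "a\<^sup>2 \<le> (L2_set x A)\<^sup>2 / N" using N(1) by (simp add: pos_le_divide_eq)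
    then have h: "h\<^sup>2 = (L2_set x A)\<^sup>2 / N - a\<^sup>2" unfolding h_def by simp
    define y where "y = Complex a h * m"
    have "(cmod y)\<^sup>2 = (a\<^sup>2 + h\<^sup>2) * N"
      unfolding y_def norm_mult power_mult_distrib N_def by (simp add: cmod_power2)
    also have "\<dots> = (L2_set x A)\<^sup>2" using N(1) h by simp
    finally have "(cmod y)\<^sup>2 = (L2_set x A)\<^sup>2" .
    moreover have "Re y * Re m + Im y * Im m = a * N"
      unfolding y_def N(2) by (simp add: power2_eq_square algebra_simps)
    moreover have "a * N = c" using N(1) unfolding a_def by simp
    ultimately show ?thesis by auto
  qed
  then obtain y where y: "(cmod y)\<^sup>2 = (L2_set x A)\<^sup>2" "Re y * Re m + Im y * Im m = c" by blast
  have "cmod (of_real s * y + of_real t * m) = L2_set (\<lambda>k. s * x k + t * l k) A" for s t :: real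
  proof -
    have "(cmod (of_real s * y + of_real t * m))\<^sup>2 =
        s\<^sup>2 * (cmod y)\<^sup>2 + 2 * s * t * (Re y * Re m + Im y * Im m) + t\<^sup>2 * (cmod m)\<^sup>2"
      unfolding cmod_power2 by (simp add: power2_eq_square algebra_simps)
    then have "(cmod (of_real s * y + of_real t * m))\<^sup>2 = (L2_set (\<lambda>k. s * x k + t * l k) A)\<^sup>2"
      unfolding L2_set_comb_sq y m c_def by simp
    then show ?thesis by simp
  qed
  then show thesis using that by blast
qed

text \<open>The target is a real normed field so that the line and the plane are treated together;
  multiplication by unit complex numbers provides the rotations.\<close>

definition edge_preserved ::
    "nat \<Rightarrow> ('v \<Rightarrow> nat \<Rightarrow> real) \<Rightarrow> (nat \<Rightarrow> real) \<Rightarrow> ('v \<Rightarrow> 'b::real_normed_field) \<Rightarrow> 'b \<Rightarrow> 'v \<Rightarrow> 'v \<Rightarrow> int \<Rightarrow> bool" where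
  "edge_preserved c p l q m i j g \<longleftrightarrow>
     norm (q i - q j - of_int g * m) = L2_set (\<lambda>k. p i k - p j k - of_int g * l k) {..<c}"

lemma edge_preserved_sym: "edge_preserved c p l q m i j g \<Longrightarrow> edge_preserved c p l q m j i (- g)"
proof -
  have "norm (q j - q i - of_int (- g) * m) = norm (q i - q j - of_int g * m)"
    by (subst norm_minus_commute[symmetric]) (simp add: algebra_simps)
  moreover have "L2_set (\<lambda>k. p j k - p i k - of_int (- g) * l k) {..<c}
      = L2_set (\<lambda>k. p i k - p j k - of_int g * l k) {..<c}"
    unfolding L2_set_def by (intro arg_cong[of _ _ sqrt] sum.cong refl) (simp add: power2_eq_square algebra_simps)
  moreover assume "edge_preserved c p l q m i j g"
  ultimately show ?thesis unfolding edge_preserved_def by simp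
qed

lemma edges_preserved_extend:
  assumes G: "gain_graph V E"
    and old: "\<And>i j g. (i, j, g) \<in> E \<Longrightarrow> i \<noteq> v \<Longrightarrow> j \<noteq> v \<Longrightarrow> edge_preserved c p l q m i j g"
    and new: "\<And>j g. (v, j, g) \<in> E \<Longrightarrow> edge_preserved c p l q m v j g"
    and "(i, j, g) \<in> E"
  shows "edge_preserved c p l q m i j g"
proof (cases "j = v")
  case True
  then have "(v, i, - g) \<in> E" using gain_graphD(4)[OF G assms(4)] by simp
  then show ?thesis using edge_preserved_sym[OF new] True by force
qed (use assms in blast)

lemma gain_graph_add_edge:
  assumes G: "gain_graph V E" and "u \<in> V" "w \<in> V" "u \<noteq> w" "h = - g"
  shows "gain_graph V (E \<union> {(u, w, g), (w, u, h)})"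
  unfolding gain_graph_def
proof (intro conjI allI impI)
  show "finite V" using G unfolding gain_graph_def by simp
next
  fix i j k assume "(i, j, k) \<in> E \<union> {(u, w, g), (w, u, h)}"
  then consider "(i, j, k) \<in> E" | "i = u" "j = w" "k = g" | "i = w" "j = u" "k = h" by blast
  then show "i \<in> V" "j \<in> V" "i \<noteq> j" "(j, i, - k) \<in> E \<union> {(u, w, g), (w, u, h)}"
    using assms(2-) gain_graphD[OF G, of i j k] by (cases; simp)+
qed

text \<open>Some vertex v has at most one neighbour u, and two edges between them would give a
  \<open>K2d_model\<close>. So one length at most constrains v, and v is put at that distance from u
  + a m.\<close>

lemma line_realization:
  fixes p :: "'v \<Rightarrow> nat \<Rightarrow> real"
  assumes "gain_graph V E" "\<not> K3_model V E" "\<not> K2d_model V E"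
  shows "\<exists>(m::real) q. norm m = L2_set l {..<c} \<and> (\<forall>i j g. (i, j, g) \<in> E \<longrightarrow> edge_preserved c p l q m i j g)"
  using assms
proof (induction "card V" arbitrary: V E rule: less_induct)
  case less
  note G = less.prems(1)
  show ?case
  proof (cases "V = {}")
    case True
    then have "E = {}" using gain_graphD(1)[OF G] by auto
    then show ?thesis by (intro exI[of _ "L2_set l {..<c}"]) simp
  next
    case False
    then obtain v u where v: "v \<in> V" and nbr: "\<And>j g. (v, j, g) \<in> E \<Longrightarrow> j = u"
      using K3_or_K2d_of_min_degree[OF G] less.prems(2,3) by metis
    let ?F = "{(i, j, g) \<in> E. i \<in> V - {v} \<and> j \<in> V - {v}}"
    have F: "gain_graph (V - {v}) ?F" by (rule gain_graph_restrict[OF G]) auto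
    have sub: "V - {v} \<subseteq> V" "?F \<subseteq> E" by auto
    have "card (V - {v}) < card V" using v G unfolding gain_graph_def by (intro psubset_card_mono) auto
    then obtain m :: real and q where m: "norm m = L2_set l {..<c}"
      and q: "\<And>i j g. (i, j, g) \<in> ?F \<Longrightarrow> edge_preserved c p l q m i j g"
      using less.hyps[OF _ F] models_mono(3,4)[OF F G sub] less.prems(2,3) by blast
    have uniq: "g = h" if "(v, u, g) \<in> E" "(v, u, h) \<in> E" for g h
    proof (rule ccontr)
      assume "g \<noteq> h"
      have uv: "u \<in> V" "u \<noteq> v" using gain_graphD[OF G that(1)] by auto
      define \<phi> :: "'v \<Rightarrow> nat" where "\<phi> = (\<lambda>_. 0)(v := 1, u := 2)"
      have "{x \<in> V. \<phi> x = 1} = {v}" "{x \<in> V. \<phi> x = 2} = {u}" using uv v unfolding \<phi>_def by auto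
      then have "connected_fibres V E \<phi> (\<lambda>_. 0) {1, 2}" by (intro connected_fibresI) auto
      moreover have "cross E \<phi> (\<lambda>_. 0) 1 2 k" if "(v, u, k) \<in> E" for k
        by (rule crossI[OF that]) (use uv in \<open>auto simp: \<phi>_def\<close>)
      ultimately have "K2d_model V E" using K2d_modelI that \<open>g \<noteq> h\<close> by blast
      then show False using less.prems(3) by simp
    qed
    obtain a where a: "g = a" if "(v, u, g) \<in> E" for g using uniq by metis
    define r where "r = q(v := q u + of_int a * m + L2_set (\<lambda>k. p v k - p u k - of_int a * l k) {..<c})"
    have "edge_preserved c p l r m i j g" if "(i, j, g) \<in> E" for i j g
      using G _ _ that
    proof (rule edges_preserved_extend[where v = v])
      fix i j g assume e: "(i, j, g) \<in> E" "i \<noteq> v" "j \<noteq> v"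
      then have "edge_preserved c p l q m i j g" using q gain_graphD[OF G e(1)] by blast
      then show "edge_preserved c p l r m i j g" using e unfolding edge_preserved_def r_def by simp
    next
      fix j g assume e: "(v, j, g) \<in> E"
      then have "j = u" "g = a" "u \<noteq> v" using nbr a gain_graphD(3)[OF G e] by blast+
      then show "edge_preserved c p l r m v j g" unfolding edge_preserved_def r_def by simp
    qed
    then show ?thesis using m by blast
  qed
qed

text \<open>The two lattice vectors have equal length, so a rotation by \<omega> carries m' to m; a
  translation then makes the two placements agree at x. Both motions preserve the lengths on
  B.\<close>

lemma glue_realizations:
  fixes p :: "'v \<Rightarrow> nat \<Rightarrow> real" and m m' :: complex
  assumes "A \<inter> B \<subseteq> {x}" and m: "cmod m = L2_set l {..<c}" "cmod m' = L2_set l {..<c}"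
    and E: "\<And>i j g. (i, j, g) \<in> E \<Longrightarrow> i \<in> A \<and> j \<in> A \<or> i \<in> B \<and> j \<in> B"
    and q: "\<And>i j g. (i, j, g) \<in> E \<Longrightarrow> i \<in> A \<Longrightarrow> j \<in> A \<Longrightarrow> edge_preserved c p l q m i j g"
    and q': "\<And>i j g. (i, j, g) \<in> E \<Longrightarrow> i \<in> B \<Longrightarrow> j \<in> B \<Longrightarrow> edge_preserved c p l q' m' i j g"
  shows "\<exists>r. \<forall>i j g. (i, j, g) \<in> E \<longrightarrow> edge_preserved c p l r m i j g"
proof -
  obtain \<omega> where \<omega>: "cmod \<omega> = 1" "m = \<omega> * m'"
  proof (cases "m' = 0")
    case True
    then have "m = 0" using m by simp
    then show ?thesis using True that[of 1] by simp
  next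
    case False
    moreover from this have "L2_set l {..<c} \<noteq> 0" using m(2) by auto
    ultimately show ?thesis using that[of "m / m'"] m by (simp add: norm_divide)
  qed
  define s where "s = (\<lambda>i. \<omega> * (q' i - q' x) + q x)"
  define r where "r = (\<lambda>i. if i \<in> A then q i else s i)"
  have rB: "r i = s i" if "i \<in> B" for i using that assms(1) unfolding r_def s_def by auto
  have "edge_preserved c p l r m i j g" if e: "(i, j, g) \<in> E" for i j g
  proof (cases "i \<in> A \<and> j \<in> A")
    case True
    then show ?thesis using q[OF e] unfolding edge_preserved_def r_def by simp
  next
    case False
    then have B: "i \<in> B" "j \<in> B" using E[OF e] by auto
    have "r i - r j - of_int g * m = \<omega> * (q' i - q' j - of_int g * m')"
      unfolding rB[OF B(1)] rB[OF B(2)] s_def \<omega>(2) by (simp add: algebra_simps)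
    then have "norm (r i - r j - of_int g * m) = norm (q' i - q' j - of_int g * m')"
      using \<omega>(1) by (simp add: norm_mult)
    then show ?thesis using q'[OF e B] unfolding edge_preserved_def by simp
  qed
  then show ?thesis by blast
qed

text \<open>The induction hypothesis is also used for the degenerate lattice vector \<open>0\<close>: if the graph
  without \<open>v\<close> is balanced, it is first realized without lattice vector, and the lattice vector is
  chosen afterwards to fit the edges at \<open>v\<close>.\<close>

lemma plane_realization:
  fixes p :: "'v \<Rightarrow> nat \<Rightarrow> real"
  assumes "gain_graph V E" "\<not> K4_model V E" "\<not> K3dd_model V E"
  shows "\<exists>(m::complex) q. cmod m = L2_set l {..<c} \<and> (\<forall>i j g. (i, j, g) \<in> E \<longrightarrow> edge_preserved c p l q m i j g)"
  using assms
proof (induction "card V" arbitrary: V E p l rule: less_induct)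
  case less
  note G = less.prems(1)
  have finV: "finite V" using G unfolding gain_graph_def by simp
  \<comment> \<open>The induction hypothesis for induced proper subgraphs, for arbitrary placements
    and lattice vectors.\<close>
  have sub: "\<exists>(m::complex) q. cmod m = L2_set l' {..<c} \<and>
      (\<forall>i j g. (i, j, g) \<in> E \<longrightarrow> i \<in> U \<longrightarrow> j \<in> U \<longrightarrow> edge_preserved c p' l' q m i j g)"
    if U: "U \<subseteq> V" "U \<noteq> V" for U p' l'
  proof -
    let ?F = "{(i, j, g) \<in> E. i \<in> U \<and> j \<in> U}"
    have F: "gain_graph U ?F" by (rule gain_graph_restrict[OF G U(1)])
    have "?F \<subseteq> E" by auto
    then have "\<not> K4_model U ?F" "\<not> K3dd_model U ?F"
      using models_mono(1,2)[OF F G U(1)] less.prems(2,3) by blast+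
    moreover have "card U < card V" using U finV by (intro psubset_card_mono) auto
    ultimately obtain m :: complex and q where "cmod m = L2_set l' {..<c}"
      "\<forall>i j g. (i, j, g) \<in> ?F \<longrightarrow> edge_preserved c p' l' q m i j g"
      using less.hyps[OF _ F, of l' p'] by auto
    then show ?thesis by blast
  qed
  \<comment> \<open>The induction hypothesis for V - {v} with an extra edge uw of gain b - a, as
    left by contracting vu. Its purpose is to fix the length of the third side of the triangle into
    which v is reinserted.\<close>
  have contract: "\<exists>(m::complex) q. cmod m = L2_set l' {..<c} \<and>
      (\<forall>i j g. (i, j, g) \<in> E \<longrightarrow> i \<noteq> v \<longrightarrow> j \<noteq> v \<longrightarrow> edge_preserved c p' l' q m i j g) \<and>
      edge_preserved c p' l' q m u w (b - a)"
    if vE: "(v, u, a) \<in> E" "(v, w, b) \<in> E" "u \<noteq> w" for v u w a b p' l'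
  proof -
    define F where "F = {(i, j, g) \<in> E. i \<in> V - {v} \<and> j \<in> V - {v}} \<union> {(u, w, b - a), (w, u, a - b)}"
    have uw: "v \<in> V" "u \<in> V" "w \<in> V" "u \<noteq> v" "w \<noteq> v" using gain_graphD[OF G] vE by blast+
    then have GF: "gain_graph (V - {v}) F"
      unfolding F_def using vE(3) by (intro gain_graph_add_edge gain_graph_restrict[OF G]) auto
    have "F \<subseteq> E \<union> {(u, w, b - a), (w, u, a - b)}" unfolding F_def by auto
    then have "\<not> K4_model (V - {v}) F" "\<not> K3dd_model (V - {v}) F"
      using has_model_contract[OF _ GF G _ vE(1,2)] less.prems(2,3)
      unfolding K4_model_def K3dd_model_def by blast+
    moreover have "card (V - {v}) < card V" using uw(1) finV by (intro psubset_card_mono) auto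
    ultimately obtain m :: complex and q where "cmod m = L2_set l' {..<c}"
      "\<forall>i j g. (i, j, g) \<in> F \<longrightarrow> edge_preserved c p' l' q m i j g"
      using less.hyps[OF _ GF, of l' p'] by auto
    moreover have "(i, j, g) \<in> F" if "(i, j, g) \<in> E" "i \<noteq> v" "j \<noteq> v" for i j g
      using that gain_graphD(1,2)[OF G that(1)] unfolding F_def by auto
    moreover have "(u, w, b - a) \<in> F" unfolding F_def by simp
    ultimately show ?thesis by blast
  qed
  show ?case
  proof (cases "V = {}")
    case True
    then have "E = {}" using gain_graphD(1)[OF G] by auto
    then show ?thesis by (intro exI[of _ "of_real (L2_set l {..<c})"]) simp
  next
    case False
    then obtain v s t where v: "v \<in> V" and nbr: "\<And>j g. (v, j, g) \<in> E \<Longrightarrow> j \<in> {s, t}"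
      using K4_or_K3dd_of_min_degree[OF G] less.prems(2,3) by metis
    consider (one) u where "\<And>j g. (v, j, g) \<in> E \<Longrightarrow> j = u"
      | (single) u w a b where "u \<noteq> w" "(v, u, a) \<in> E" "(v, w, b) \<in> E"
          "\<And>j g. (v, j, g) \<in> E \<Longrightarrow> j = u \<and> g = a \<or> j = w \<and> g = b"
      | (double) u w a a' b where "u \<noteq> w" "(v, u, a) \<in> E" "(v, u, a') \<in> E" "a \<noteq> a'" "(v, w, b) \<in> E"
          "\<And>j g. (v, j, g) \<in> E \<Longrightarrow> j \<in> {u, w}"
    proof (cases "\<exists>u. \<forall>j g. (v, j, g) \<in> E \<longrightarrow> j = u")
      case True
      then show ?thesis using one by blast
    next
      case False
      then obtain a b where ab: "s \<noteq> t" "(v, s, a) \<in> E" "(v, t, b) \<in> E" using nbr by blast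
      show ?thesis
      proof (cases "\<forall>j g. (v, j, g) \<in> E \<longrightarrow> j = s \<and> g = a \<or> j = t \<and> g = b")
        case True
        then show ?thesis using single[OF ab] by blast
      next
        case False
        then obtain j g where jg: "(v, j, g) \<in> E" "\<not> (j = s \<and> g = a)" "\<not> (j = t \<and> g = b)" by blast
        then consider "j = s" "g \<noteq> a" | "j = t" "g \<noteq> b" using nbr by blast
        then show ?thesis
        proof cases
          case 1
          then show ?thesis using double[of s t a g b] ab jg(1) nbr by blast
        next
          case 2
          then show ?thesis using double[of t s b g a] ab jg(1) nbr by blast
        qed
      qed
    qed
    then show ?thesis
    proof cases
      case one
      obtain m :: complex and q where m: "cmod m = L2_set l {..<c}"
        and q: "\<And>i j g. (i, j, g) \<in> E \<Longrightarrow> i \<noteq> v \<Longrightarrow> j \<noteq> v \<Longrightarrow> edge_preserved c p l q m i j g"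
        using sub[of "V - {v}" l p] v gain_graphD(1,2)[OF G] by blast
      \<comment> \<open>All edges at v lead to u, and their lengths, for any number of gains, depend
        only on the Gram matrix of \<open>p v - p u\<close> and l.\<close>
      obtain y where y: "\<And>s t :: real. cmod (of_real s * y + of_real t * m)
          = L2_set (\<lambda>k. s * (p v k - p u k) + t * l k) {..<c}"
        using complex_gram_extend[OF m, of "\<lambda>k. p v k - p u k"] by blast
      define r where "r = q(v := q u + y)"
      have "edge_preserved c p l r m i j g" if "(i, j, g) \<in> E" for i j g
        using G _ _ that
      proof (rule edges_preserved_extend[where v = v])
        fix i j g assume e: "(i, j, g) \<in> E" "i \<noteq> v" "j \<noteq> v"
        then show "edge_preserved c p l r m i j g" using q[OF e] unfolding edge_preserved_def r_def by simp
      next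
        fix j g assume e: "(v, j, g) \<in> E"
        then have "j = u" "u \<noteq> v" using one gain_graphD(3)[OF G e] by blast+
        then show "edge_preserved c p l r m v j g"
          using y[of 1 "- of_int g"] unfolding edge_preserved_def r_def by simp
      qed
      then show ?thesis using m by blast
    next
      case single
      obtain m :: complex and q where m: "cmod m = L2_set l {..<c}"
        and q: "\<And>i j g. (i, j, g) \<in> E \<Longrightarrow> i \<noteq> v \<Longrightarrow> j \<noteq> v \<Longrightarrow> edge_preserved c p l q m i j g"
        and uw: "edge_preserved c p l q m u w (b - a)"
        using contract[OF single(2,3,1), of l p] by blast
      have uv: "u \<noteq> v" "w \<noteq> v" using gain_graphD(3)[OF G] single(2,3) by blast+
      \<comment> \<open>Seen from u + a m, the translate of w joined to v lies at x'. The extra edge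
        makes x' as long as x, so v can be added as the apex of a triangle.\<close>
      define x' where "x' = q w - q u - of_int (a - b) * m"
      define x where "x = (\<lambda>k. p w k - p u k - of_int (a - b) * l k)"
      have "cmod x' = L2_set x {..<c}"
        using edge_preserved_sym[OF uw] unfolding edge_preserved_def x_def x'_def by simp
      then obtain y where y: "\<And>s t :: real. cmod (of_real s * y + of_real t * x')
          = L2_set (\<lambda>k. s * (p v k - p u k - of_int a * l k) + t * x k) {..<c}"
        using complex_gram_extend[where x = "\<lambda>k. p v k - p u k - of_int a * l k"] by blast
      define r where "r = q(v := q u + of_int a * m + y)"
      have "edge_preserved c p l r m i j g" if "(i, j, g) \<in> E" for i j g
        using G _ _ that
      proof (rule edges_preserved_extend[where v = v])
        fix i j g assume e: "(i, j, g) \<in> E" "i \<noteq> v" "j \<noteq> v"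
        then show "edge_preserved c p l r m i j g" using q[OF e] unfolding edge_preserved_def r_def by simp
      next
        fix j g assume e: "(v, j, g) \<in> E"
        then consider "j = u" "g = a" | "j = w" "g = b" using single(4) by blast
        then show "edge_preserved c p l r m v j g"
        proof cases
          case 1
          then show ?thesis using y[of 1 0] uv unfolding edge_preserved_def r_def by simp
        next
          case 2
          have "r v - r w - of_int b * m = y - x'"
            using uv unfolding r_def x'_def by (simp add: algebra_simps)
          moreover have "(\<lambda>k. p v k - p w k - of_int b * l k) = (\<lambda>k. 1 * (p v k - p u k - of_int a * l k) + (- 1) * x k)"
            unfolding x_def by (simp add: algebra_simps)
          ultimately show ?thesis using y[of 1 "- 1"] 2 unfolding edge_preserved_def by simp
        qed
      qed
      then show ?thesis using m by blast
    next
      case double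
      show ?thesis
      proof (cases "separable V E")
        case True
        then obtain A B x where AB: "A \<union> B = V" "A \<noteq> V" "B \<noteq> V" "A \<inter> B \<subseteq> {x}"
          "\<And>i j g. (i, j, g) \<in> E \<Longrightarrow> i \<in> A \<and> j \<in> A \<or> i \<in> B \<and> j \<in> B"
          unfolding separable_def by blast
        have "A \<subseteq> V" "B \<subseteq> V" using AB(1) by auto
        then obtain m m' :: complex and q q' where mq: "cmod m = L2_set l {..<c}" "cmod m' = L2_set l {..<c}"
          "\<And>i j g. (i, j, g) \<in> E \<Longrightarrow> i \<in> A \<Longrightarrow> j \<in> A \<Longrightarrow> edge_preserved c p l q m i j g"
          "\<And>i j g. (i, j, g) \<in> E \<Longrightarrow> i \<in> B \<Longrightarrow> j \<in> B \<Longrightarrow> edge_preserved c p l q' m' i j g"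
          using sub[of A l p] sub[of B l p] AB(2,3) by metis
        have "\<exists>r. \<forall>i j g. (i, j, g) \<in> E \<longrightarrow> edge_preserved c p l r m i j g"
          by (rule glue_realizations[OF AB(4) mq(1,2)]) (use AB(5) mq(3,4) in blast)+
        then show ?thesis using mq(1) by blast
      next
        case False
        have nb: "\<forall>j g. (v, j, g) \<in> E \<longrightarrow> j \<in> {u, w}" using double(6) by blast
        have b: "g = b" if "(v, w, g) \<in> E" for g
          using K3dd_of_two_double[OF G False v double(1) nb double(2-5) that] less.prems(3) by blast
        obtain \<rho> where \<rho>: "balanced E (V - {v}) \<rho>"
          using balanced_or_K3dd[OF G False v double(1) nb double(2-5)] less.prems(3) by blast
        \<comment> \<open>After switching by \<pi>, all edges avoiding v and the single edge vw have
          gain \<open>0\<close>; only the edges vu still involve l. P is the placement switched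
          accordingly.\<close>
        define \<pi> where "\<pi> = \<rho>(v := \<rho> w - b)"
        define P where "P = (\<lambda>i k. p i k + of_int (\<pi> i) * l k)"
        have uv: "u \<noteq> v" "w \<noteq> v" using gain_graphD(3)[OF G] double(2,5) by blast+
        \<comment> \<open>Over the lattice vector \<open>0\<close> the gains have no effect, so q
          copies the distances of P, among them the distance from u to w added by the contraction.
          The triangle u, w, v then determines the position u + y of v.\<close>
        obtain m0 :: complex and q where m0: "cmod m0 = L2_set (\<lambda>_. 0) {..<c}"
          and q: "\<And>i j g. (i, j, g) \<in> E \<Longrightarrow> i \<noteq> v \<Longrightarrow> j \<noteq> v \<Longrightarrow> edge_preserved c P (\<lambda>_. 0) q m0 i j g"
          and uw: "edge_preserved c P (\<lambda>_. 0) q m0 u w (b - a)"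
          using contract[OF double(2,5,1), of "\<lambda>_. 0" P] by blast
        have "m0 = 0" using m0 by (simp add: L2_set_0')
        have "cmod (q w - q u) = L2_set (\<lambda>k. P w k - P u k) {..<c}"
          using edge_preserved_sym[OF uw] \<open>m0 = 0\<close> unfolding edge_preserved_def by simp
        then obtain y where y: "\<And>s t :: real. cmod (of_real s * y + of_real t * (q w - q u))
            = L2_set (\<lambda>k. s * (P v k - P u k) + t * (P w k - P u k)) {..<c}"
          using complex_gram_extend[where x = "\<lambda>k. P v k - P u k"] by blast
        have "cmod y = L2_set (\<lambda>k. P v k - P u k) {..<c}" using y[of 1 0] by simp
        \<comment> \<open>The roles are exchanged: y is already placed and the lattice vector m is
          fitted to it, which settles the edges vu of every gain.\<close>
        then obtain m where m: "\<And>s t :: real. cmod (of_real s * m + of_real t * y)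
            = L2_set (\<lambda>k. s * l k + t * (P v k - P u k)) {..<c}"
          using complex_gram_extend[where x = l] by blast
        define q1 where "q1 = q(v := q u + y)"
        \<comment> \<open>The switching is undone, now with the lattice vector found.\<close>
        define r where "r = (\<lambda>i. q1 i - of_int (\<pi> i) * m)"
        have r: "edge_preserved c p l r m i j g \<longleftrightarrow>
            cmod (q1 i - q1 j - of_int (g + \<pi> i - \<pi> j) * m)
              = L2_set (\<lambda>k. P i k - P j k - of_int (g + \<pi> i - \<pi> j) * l k) {..<c}" for i j g
          unfolding edge_preserved_def r_def P_def by (simp add: algebra_simps)
        have "edge_preserved c p l r m i j g" if "(i, j, g) \<in> E" for i j g
          using G _ _ that
        proof (rule edges_preserved_extend[where v = v])
          fix i j g assume e: "(i, j, g) \<in> E" "i \<noteq> v" "j \<noteq> v"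
          have "g = \<rho> j - \<rho> i" using \<rho> e gain_graphD(1,2)[OF G e(1)] unfolding balanced_def by blast
          then have "g + \<pi> i - \<pi> j = 0" using e(2,3) unfolding \<pi>_def by simp
          then show "edge_preserved c p l r m i j g"
            using q[OF e] e \<open>m0 = 0\<close> unfolding r unfolding edge_preserved_def q1_def by simp
        next
          fix j g assume e: "(v, j, g) \<in> E"
          then consider "j = u" | "j = w" "g = b" using double(6) b by blast
          then show "edge_preserved c p l r m v j g"
          proof cases
            case 1
            have "q1 v - q1 u = y" using uv unfolding q1_def by simp
            then show ?thesis
              using m[of "- of_int (g + \<pi> v - \<pi> u)" 1] 1 unfolding r by (simp add: algebra_simps)
          next
            case 2
            have "g + \<pi> v - \<pi> w = 0" using uv 2 unfolding \<pi>_def by simp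
            moreover have "q1 v - q1 w = y - (q w - q u)" using uv unfolding q1_def by simp
            moreover have "cmod (y - (q w - q u)) = L2_set (\<lambda>k. P v k - P w k) {..<c}"
              using y[of 1 "- 1"] by (simp add: add_diff_eq diff_diff_eq2)
            ultimately show ?thesis using 2 unfolding r by simp
          qed
        qed
        moreover have "cmod m = L2_set l {..<c}" using m[of 1 0] by simp
        ultimately show ?thesis by blast
      qed
    qed
  qed
qed

section \<open>Realizability of labelled graphs\<close>

text \<open>A periodic framework restricted to orbit representatives: an arc stands for its whole
  edge orbit, all of whose edges have the same length. That m is nonzero follows from its having the
  length of l.\<close>

definition lab_realizable :: "nat \<Rightarrow> ('a, 'b) labelled_graph \<Rightarrow> bool" where
  "lab_realizable d Q \<longleftrightarrow> (case Q of (D, z) \<Rightarrow>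
     \<forall>(c::nat) l p. (\<exists>k<c. l k \<noteq> (0::real)) \<longrightarrow>
       (\<exists>m q. L2_set l {..<c} = L2_set m {..<d} \<and>
          (\<forall>e\<in>arcs D. L2_set (\<lambda>k. p (tail D e) k - p (head D e) k - of_int (z e) * l k) {..<c}
             = L2_set (\<lambda>k. q (tail D e) k - q (head D e) k - of_int (z e) * m k) {..<d})))"

lemma lab_realizableI:
  assumes "\<And>c (l :: nat \<Rightarrow> real) p. \<exists>k<c. l k \<noteq> 0 \<Longrightarrow>
    \<exists>m q. L2_set l {..<c} = L2_set m {..<d} \<and>
      (\<forall>e\<in>arcs D. L2_set (\<lambda>k. p (tail D e) k - p (head D e) k - of_int (z e) * l k) {..<c}
         = L2_set (\<lambda>k. q (tail D e) k - q (head D e) k - of_int (z e) * m k) {..<d})"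
  shows "lab_realizable d (D, z)"
  using assms unfolding lab_realizable_def by simp

lemma lab_realizableD:
  fixes l :: "nat \<Rightarrow> real"
  assumes "lab_realizable d (D, z)" "\<exists>k<c. l k \<noteq> 0"
  shows "\<exists>m q. L2_set l {..<c} = L2_set m {..<d} \<and>
      (\<forall>e\<in>arcs D. L2_set (\<lambda>k. p (tail D e) k - p (head D e) k - of_int (z e) * l k) {..<c}
         = L2_set (\<lambda>k. q (tail D e) k - q (head D e) k - of_int (z e) * m k) {..<d})"
  using assms(1)[unfolded lab_realizable_def prod.case, THEN spec[of _ c], THEN spec[of _ l], THEN spec[of _ p]]
    assms(2) by (rule mp)

lemma L2_set_edge_inversion:
  "L2_set (\<lambda>k. y k - x k - of_int (- g) * l k) A = L2_set (\<lambda>k. x k - y k - of_int g * l k) A"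
  unfolding L2_set_def by (intro arg_cong[of _ _ sqrt] sum.cong refl) (simp add: power2_eq_square algebra_simps)

text \<open>Inversion only negates difference vectors. Switching at i by \<gamma> amounts to
  choosing another point of the orbit of i, so the placement of i is translated by a multiple of the
  lattice vector before realizing and back afterwards.\<close>

lemma lab_realizable_relabel_step:
  assumes "relabel_step P Q" "lab_realizable d P"
  shows "lab_realizable d Q"
  using assms
proof (induction rule: relabel_step.induct)
  case (edge_inversion e D z)
  show ?case
  proof (rule lab_realizableI)
    fix c :: nat and l :: "nat \<Rightarrow> real" and p :: "'a \<Rightarrow> nat \<Rightarrow> real" assume l: "\<exists>k<c. l k \<noteq> 0"
    obtain m q where "L2_set l {..<c} = L2_set m {..<d}"
      "\<And>e. e \<in> arcs D \<Longrightarrow> L2_set (\<lambda>k. p (tail D e) k - p (head D e) k - of_int (z e) * l k) {..<c}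
         = L2_set (\<lambda>k. q (tail D e) k - q (head D e) k - of_int (z e) * m k) {..<d}"
      using lab_realizableD[OF edge_inversion(2) l, of p] by blast
    then show "\<exists>m q. L2_set l {..<c} = L2_set m {..<d} \<and>
      (\<forall>f\<in>arcs (D\<lparr>tail := (tail D)(e := head D e), head := (head D)(e := tail D e)\<rparr>).
        L2_set (\<lambda>k. p (tail (D\<lparr>tail := (tail D)(e := head D e), head := (head D)(e := tail D e)\<rparr>) f) k
          - p (head (D\<lparr>tail := (tail D)(e := head D e), head := (head D)(e := tail D e)\<rparr>) f) k
          - of_int ((z(e := - z e)) f) * l k) {..<c}
        = L2_set (\<lambda>k. q (tail (D\<lparr>tail := (tail D)(e := head D e), head := (head D)(e := tail D e)\<rparr>) f) k
          - q (head (D\<lparr>tail := (tail D)(e := head D e), head := (head D)(e := tail D e)\<rparr>) f) k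
          - of_int ((z(e := - z e)) f) * m k) {..<d})"
      by (intro exI[of _ m] exI[of _ q]) (auto simp del: of_int_minus simp: L2_set_edge_inversion)
  qed
next
  case (switching i D z g)
  show ?case
  proof (rule lab_realizableI)
    fix c :: nat and l :: "nat \<Rightarrow> real" and p :: "'a \<Rightarrow> nat \<Rightarrow> real" assume l: "\<exists>k<c. l k \<noteq> 0"
    define s where "s v = (if v = i then of_int g else (0::real))" for v
    define r where "r v k = p v k - s v * l k" for v k
    obtain m q where m: "L2_set l {..<c} = L2_set m {..<d}"
      and q: "\<And>e. e \<in> arcs D \<Longrightarrow> L2_set (\<lambda>k. r (tail D e) k - r (head D e) k - of_int (z e) * l k) {..<c}
         = L2_set (\<lambda>k. q (tail D e) k - q (head D e) k - of_int (z e) * m k) {..<d}"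
      using lab_realizableD[OF switching(2) l, of r] by blast
    define q' where "q' v k = q v k + s v * m k" for v k
    have "p (tail D e) k - p (head D e) k - of_int (switch_label D i g z e) * l k
        = r (tail D e) k - r (head D e) k - of_int (z e) * l k"
      "q' (tail D e) k - q' (head D e) k - of_int (switch_label D i g z e) * m k
        = q (tail D e) k - q (head D e) k - of_int (z e) * m k" for e k
      unfolding switch_label_def r_def s_def q'_def by (auto simp: algebra_simps)
    then show "\<exists>m q. L2_set l {..<c} = L2_set m {..<d} \<and>
      (\<forall>e\<in>arcs D. L2_set (\<lambda>k. p (tail D e) k - p (head D e) k - of_int (switch_label D i g z e) * l k) {..<c}
        = L2_set (\<lambda>k. q (tail D e) k - q (head D e) k - of_int (switch_label D i g z e) * m k) {..<d})"
      using m q by (intro exI[of _ m] exI[of _ q']) simp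
  qed
qed

lemma lab_realizable_exact_iso:
  assumes "exact_iso P Q" "wf_digraph (fst P)" "lab_realizable d P"
  shows "lab_realizable d Q"
proof -
  obtain D z D' z' where PQ: "P = (D, z)" "Q = (D', z')" by (cases P, cases Q)
  obtain f g where f: "bij_betw f (verts D) (verts D')" and g: "bij_betw g (arcs D) (arcs D')"
    and fg: "\<And>e. e \<in> arcs D \<Longrightarrow> tail D' (g e) = f (tail D e) \<and> head D' (g e) = f (head D e) \<and> z' (g e) = z e"
    using assms(1) unfolding PQ exact_iso_def by auto
  show ?thesis unfolding PQ(2)
  proof (rule lab_realizableI)
    fix c :: nat and l :: "nat \<Rightarrow> real" and p :: "'c \<Rightarrow> nat \<Rightarrow> real" assume l: "\<exists>k<c. l k \<noteq> 0"
    obtain m q where m: "L2_set l {..<c} = L2_set m {..<d}"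
      and q: "\<And>e. e \<in> arcs D \<Longrightarrow> L2_set (\<lambda>k. p (f (tail D e)) k - p (f (head D e)) k - of_int (z e) * l k) {..<c}
         = L2_set (\<lambda>k. q (tail D e) k - q (head D e) k - of_int (z e) * m k) {..<d}"
      using lab_realizableD[OF assms(3)[unfolded PQ(1)] l, of "\<lambda>v. p (f v)"] by blast
    define r where "r = (\<lambda>v. q (inv_into (verts D) f v))"
    have r: "r (f v) = q v" if "v \<in> verts D" for v
      using that bij_betw_imp_inj_on[OF f] unfolding r_def by simp
    have "L2_set (\<lambda>k. p (tail D' e) k - p (head D' e) k - of_int (z' e) * l k) {..<c}
         = L2_set (\<lambda>k. r (tail D' e) k - r (head D' e) k - of_int (z' e) * m k) {..<d}" if "e \<in> arcs D'" for e
    proof -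
      obtain e' where e': "e' \<in> arcs D" "e = g e'" using g \<open>e \<in> arcs D'\<close> unfolding bij_betw_def by blast
      have "tail D e' \<in> verts D" "head D e' \<in> verts D"
        using assms(2) e'(1) unfolding PQ by (auto simp: wf_digraph_def)
      then show ?thesis using q[OF e'(1)] fg[OF e'(1)] r unfolding e'(2) by simp
    qed
    then show "\<exists>m q. L2_set l {..<c} = L2_set m {..<d} \<and>
      (\<forall>e\<in>arcs D'. L2_set (\<lambda>k. p (tail D' e) k - p (head D' e) k - of_int (z' e) * l k) {..<c}
         = L2_set (\<lambda>k. q (tail D' e) k - q (head D' e) k - of_int (z' e) * m k) {..<d})"
      using m by blast
  qed
qed

lemma relabel_step_wf:
  assumes "relabel_step P Q" "wf_digraph (fst P)"
  shows "wf_digraph (fst Q)"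
  using assms by (induction rule: relabel_step.induct) (auto simp: wf_digraph_def)

lemma minor_step_wf:
  assumes "minor_step P Q" "wf_digraph (fst P)"
  shows "wf_digraph (fst Q)"
  using assms
proof (induction rule: minor_step.induct)
  case (edge_contraction e D z S)
  then show ?case
    by (auto simp: wf_digraph_def identify_ends_def Let_def simplified_arcs_def)
qed (auto simp: wf_digraph_def pre_digraph.del_arc_def pre_digraph.del_vert_def)

lemma lab_realizable_arcs_subset:
  assumes "lab_realizable d (D, z)" "arcs D' \<subseteq> arcs D" "tail D' = tail D" "head D' = head D"
  shows "lab_realizable d (D', z)"
proof (rule lab_realizableI)
  fix c :: nat and l :: "nat \<Rightarrow> real" and p :: "'a \<Rightarrow> nat \<Rightarrow> real" assume l: "\<exists>k<c. l k \<noteq> 0"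
  show "\<exists>m q. L2_set l {..<c} = L2_set m {..<d} \<and>
      (\<forall>e\<in>arcs D'. L2_set (\<lambda>k. p (tail D' e) k - p (head D' e) k - of_int (z e) * l k) {..<c}
         = L2_set (\<lambda>k. q (tail D' e) k - q (head D' e) k - of_int (z e) * m k) {..<d})"
    unfolding assms(3,4) using lab_realizableD[OF assms(1) l, of p] assms(2) by blast
qed

text \<open>For a contraction, a placement of the contracted graph is pulled back along the
  identification \<mu>. The contracted arc has label \<open>0\<close> and thus length 0, so any
  equivalent placement q again gives both ends the same point and descends.\<close>

lemma lab_realizable_minor_step:
  assumes "minor_step P Q" "lab_realizable d P"
  shows "lab_realizable d Q"
  using assms
proof (induction rule: minor_step.induct)
  case (edge_deletion e D z)
  show ?case
    by (rule lab_realizable_arcs_subset[OF edge_deletion(2)]) (auto simp: pre_digraph.del_arc_def)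
next
  case (vertex_deletion v D z)
  show ?case
    by (rule lab_realizable_arcs_subset[OF vertex_deletion(2)]) (auto simp: pre_digraph.del_vert_def)
next
  case (edge_contraction e D z S)
  define \<mu> where "\<mu> = (\<lambda>v. if v = head D e then tail D e else v)"
  have S: "S \<subseteq> arcs D" "tail (identify_ends D e) = \<mu> \<circ> tail D" "head (identify_ends D e) = \<mu> \<circ> head D"
    using edge_contraction(4) unfolding simplified_arcs_def identify_ends_def Let_def \<mu>_def by auto
  show ?case
  proof (rule lab_realizableI)
    fix c :: nat and l :: "nat \<Rightarrow> real" and p :: "'a \<Rightarrow> nat \<Rightarrow> real" assume l: "\<exists>k<c. l k \<noteq> 0"
    obtain m q where m: "L2_set l {..<c} = L2_set m {..<d}"
      and q: "\<And>e. e \<in> arcs D \<Longrightarrow> L2_set (\<lambda>k. p (\<mu> (tail D e)) k - p (\<mu> (head D e)) k - of_int (z e) * l k) {..<c}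
         = L2_set (\<lambda>k. q (tail D e) k - q (head D e) k - of_int (z e) * m k) {..<d}"
      using lab_realizableD[OF edge_contraction(5) l, of "\<lambda>v. p (\<mu> v)"] by blast
    have "\<mu> (tail D e) = tail D e" "\<mu> (head D e) = tail D e" unfolding \<mu>_def by auto
    then have "L2_set (\<lambda>k. q (tail D e) k - q (head D e) k) {..<d} = 0"
      using q[OF edge_contraction(1)] edge_contraction(3) by (simp add: L2_set_0')
    then have "q (head D e) k = q (tail D e) k" if "k < d" for k
      using that by (simp add: L2_set_eq_0_iff)
    then have \<mu>: "q (\<mu> v) k = q v k" if "k < d" for v k using that unfolding \<mu>_def by simp
    have "L2_set (\<lambda>k. q (tail D f) k - q (head D f) k - of_int (z f) * m k) {..<d}
        = L2_set (\<lambda>k. q (\<mu> (tail D f)) k - q (\<mu> (head D f)) k - of_int (z f) * m k) {..<d}" for f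
      by (rule L2_set_cong) (simp_all add: \<mu>)
    then have "L2_set (\<lambda>k. p (\<mu> (tail D f)) k - p (\<mu> (head D f)) k - of_int (z f) * l k) {..<c}
         = L2_set (\<lambda>k. q (\<mu> (tail D f)) k - q (\<mu> (head D f)) k - of_int (z f) * m k) {..<d}" if "f \<in> S" for f
      using q[of f] that S(1) by auto
    then show "\<exists>m q. L2_set l {..<c} = L2_set m {..<d} \<and>
      (\<forall>f\<in>arcs (identify_ends D e\<lparr>arcs := S\<rparr>).
        L2_set (\<lambda>k. p (tail (identify_ends D e\<lparr>arcs := S\<rparr>) f) k - p (head (identify_ends D e\<lparr>arcs := S\<rparr>) f) k - of_int (z f) * l k) {..<c}
         = L2_set (\<lambda>k. q (tail (identify_ends D e\<lparr>arcs := S\<rparr>) f) k - q (head (identify_ends D e\<lparr>arcs := S\<rparr>) f) k - of_int (z f) * m k) {..<d})"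
      using m by (intro exI[of _ m] exI[of _ q]) (simp add: S(2,3))
  qed
qed

lemma lab_realizable_labelled_minor:
  assumes "labelled_minor P Q" "wf_digraph (fst Q)" "lab_realizable d Q"
  shows "lab_realizable d P"
proof -
  obtain Q' Q'' where Q: "minor_step\<^sup>*\<^sup>* Q Q'" "relabel_step\<^sup>*\<^sup>* Q' Q''" "exact_iso Q'' P"
    using assms(1) unfolding labelled_minor_def labelled_iso_def by blast
  have "wf_digraph (fst Q') \<and> lab_realizable d Q'"
    using Q(1) by (induction rule: rtranclp_induct)
      (use assms(2,3) minor_step_wf lab_realizable_minor_step in blast)+
  with Q(2) have "wf_digraph (fst Q'') \<and> lab_realizable d Q''"
    by (induction rule: rtranclp_induct)
      (use relabel_step_wf lab_realizable_relabel_step in blast)+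
  then show ?thesis using lab_realizable_exact_iso[OF Q(3)] by blast
qed

section \<open>Quotients and lifts\<close>

lemma L2_set_nonzero: "(\<exists>k<c. l k \<noteq> 0) \<longleftrightarrow> L2_set l {..<c :: nat} \<noteq> 0"
  by (auto simp: L2_set_eq_0_iff)

context Z_symmetric_graph
begin

lemma framework_shift:
  assumes "periodic_framework G d l p" "v \<in> zverts G" "k < d"
  shows "p (shift G \<gamma> v) k = p v k + of_int \<gamma> * l k"
proof (induction \<gamma> rule: int_induct[where k = 0])
  case base
  then show ?case using shift_zero[OF assms(2)] by simp
next
  case (step1 i)
  have "shift G (i + 1) v = shift G 1 (shift G i v)"
    using shift_add[OF assms(2), of 1 i] by (simp add: add.commute)
  then show ?case
    using assms(1,3) shift_closed[OF assms(2), of i] step1 unfolding periodic_framework_def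
    by (simp add: algebra_simps)
next
  case (step2 i)
  have "shift G i v = shift G 1 (shift G (i - 1) v)"
    using shift_add[OF assms(2), of 1 "i - 1"] by simp
  moreover have "p (shift G 1 (shift G (i - 1) v)) k - p (shift G (i - 1) v) k = l k"
    using assms(1,3) shift_closed[OF assms(2), of "i - 1"] unfolding periodic_framework_def by blast
  ultimately show ?case using step2 by (simp add: algebra_simps)
qed

text \<open>\<rho> picks the representative and \<delta> the translation leading from it to v;
  freeness of the action makes the translation unique.\<close>

lemma orbit_coordinates:
  assumes "orbit_representatives G R"
  obtains \<rho> \<delta> where "\<And>i \<gamma>. i \<in> R \<Longrightarrow> \<rho> (shift G \<gamma> i) = i \<and> \<delta> (shift G \<gamma> i) = \<gamma>"
    "\<And>v. v \<in> zverts G \<Longrightarrow> \<rho> v \<in> R \<and> shift G (\<delta> v) (\<rho> v) = v"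
proof -
  have R: "R \<subseteq> zverts G" and ex1: "\<And>v. v \<in> zverts G \<Longrightarrow> \<exists>!i. i \<in> R \<and> i \<in> vertex_orbit G v"
    using assms unfolding orbit_representatives_def vertex_orbits_def by auto
  have "\<exists>i \<gamma>. i \<in> R \<and> shift G \<gamma> i = v" if "v \<in> zverts G" for v
  proof -
    obtain i \<gamma> where i: "i \<in> R" "i = shift G \<gamma> v"
      using ex1[OF \<open>v \<in> zverts G\<close>] unfolding vertex_orbit_def by blast
    then have "shift G (- \<gamma>) i = v"
      using shift_add[OF that, of "- \<gamma>" \<gamma>] shift_zero[OF that] by simp
    then show ?thesis using i(1) by blast
  qed
  then obtain \<rho> \<delta> where rd: "\<And>v. v \<in> zverts G \<Longrightarrow> \<rho> v \<in> R \<and> shift G (\<delta> v) (\<rho> v) = v" by metis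
  have uniq: "i = j \<and> \<gamma> = \<beta>" if ij: "i \<in> R" "j \<in> R" "shift G \<gamma> i = shift G \<beta> j" for i j \<gamma> \<beta>
  proof -
    have v: "i \<in> zverts G" "j \<in> zverts G" using ij R by auto
    have "shift G (- \<gamma>) (shift G \<gamma> i) = i" using shift_add[OF v(1), of "- \<gamma>" \<gamma>] shift_zero[OF v(1)] by simp
    then have i: "i = shift G (\<beta> - \<gamma>) j" using ij(3) shift_add[OF v(2), of "- \<gamma>" \<beta>] by simp
    have "j = shift G 0 j" using shift_zero[OF v(2)] by simp
    then have "i \<in> vertex_orbit G j" "j \<in> vertex_orbit G j" using i unfolding vertex_orbit_def by blast+
    then have "i = j" using ex1[OF v(2)] ij(1,2) by blast
    then show ?thesis using i shift_free[OF v(2), of "\<beta> - \<gamma>"] by simp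
  qed
  have "\<rho> (shift G \<gamma> i) = i \<and> \<delta> (shift G \<gamma> i) = \<gamma>" if "i \<in> R" for i \<gamma>
    using rd[of "shift G \<gamma> i"] uniq that R shift_closed by (meson subsetD)
  then show thesis using that rd by blast
qed

lemma quotient_edge_orbit:
  assumes "quotient_wrt G R (D, z)" "X \<in> arcs D"
  shows "tail D X \<in> R" "head D X \<in> R" "X = {{shift G \<beta> (tail D X), shift G (\<beta> + z X) (head D X)} | \<beta>. True}"
    "X \<subseteq> zedges G"
proof -
  show "tail D X \<in> R" "head D X \<in> R" "X = {{shift G \<beta> (tail D X), shift G (\<beta> + z X) (head D X)} | \<beta>. True}"
    using assms unfolding quotient_wrt_def by simp_all
  show "X \<subseteq> zedges G"
    using assms shift_edge unfolding quotient_wrt_def edge_orbits_def edge_orbit_def by auto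
qed

lemma quotient_edge:
  assumes "quotient_wrt G R (D, z)" "{u, v} \<in> zedges G"
  obtains X \<beta> where "X \<in> arcs D" "{u, v} = {shift G \<beta> (tail D X), shift G (\<beta> + z X) (head D X)}"
proof -
  have "edge_orbit G {u, v} \<in> arcs D" using assms unfolding quotient_wrt_def edge_orbits_def by auto
  moreover have "{u, v} \<subseteq> zverts G" using edges_simple[OF assms(2)] by blast
  then have "shift G 0 ` {u, v} = {u, v}" using shift_zero by simp
  then have "{u, v} \<in> edge_orbit G {u, v}" unfolding edge_orbit_def by (metis (mono_tags, lifting) CollectI)
  ultimately show thesis using quotient_edge_orbit(3)[OF assms(1)] that by blast
qed

text \<open>A placement of the representatives extends periodically by adding \<delta> v times the
  lattice vector, and every periodic framework arises in this way by
  \<open>framework_shift\<close>.\<close>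

lemma realizable_iff_quotient:
  assumes Q: "quotient_wrt G R (D, z)"
  shows "realizable d G \<longleftrightarrow> lab_realizable d (D, z)"
proof -
  have rep: "orbit_representatives G R" using Q unfolding quotient_wrt_def by simp
  then have R: "R \<subseteq> zverts G" unfolding orbit_representatives_def by simp
  obtain \<rho> \<delta> where rd: "\<And>i \<gamma>. i \<in> R \<Longrightarrow> \<rho> (shift G \<gamma> i) = i \<and> \<delta> (shift G \<gamma> i) = \<gamma>"
    "\<And>v. v \<in> zverts G \<Longrightarrow> \<rho> v \<in> R \<and> shift G (\<delta> v) (\<rho> v) = v"
    using orbit_coordinates[OF rep] by metis
  have rd1: "\<rho> (shift G 1 v) = \<rho> v" "\<delta> (shift G 1 v) = \<delta> v + 1" if "v \<in> zverts G" for v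
  proof -
    have "shift G 1 v = shift G (\<delta> v + 1) (\<rho> v)"
      using shift_add[of "\<rho> v" 1 "\<delta> v"] rd(2)[OF that] R by (simp add: add.commute subset_iff)
    then show "\<rho> (shift G 1 v) = \<rho> v" "\<delta> (shift G 1 v) = \<delta> v + 1" using rd that by auto
  qed
  have periodic: "periodic_framework G c l (\<lambda>v k. p (\<rho> v) k + of_int (\<delta> v) * l k)"
    if "\<exists>k<c. l k \<noteq> 0" for c and l :: "nat \<Rightarrow> real" and p
    using that rd1 unfolding periodic_framework_def by (simp add: algebra_simps)
  show ?thesis
  proof
    assume real: "realizable d G"
    show "lab_realizable d (D, z)"
    proof (rule lab_realizableI)
      fix c :: nat and l :: "nat \<Rightarrow> real" and p :: "'a \<Rightarrow> nat \<Rightarrow> real" assume l: "\<exists>k<c. l k \<noteq> 0"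
      let ?P = "\<lambda>v k. p (\<rho> v) k + of_int (\<delta> v) * l k"
      obtain m q where q: "periodic_framework G d m q" "equivalent_frameworks G c l ?P d m q"
        using real periodic[OF l, of p] unfolding realizable_def by blast
      have "L2_set (\<lambda>k. p (tail D X) k - p (head D X) k - of_int (z X) * l k) {..<c}
         = L2_set (\<lambda>k. q (tail D X) k - q (head D X) k - of_int (z X) * m k) {..<d}" if X: "X \<in> arcs D" for X
      proof -
        note X' = quotient_edge_orbit[OF Q X]
        have "{shift G 0 (tail D X), shift G (0 + z X) (head D X)} \<in> X" by (subst X'(3)) blast
        then have e: "{shift G 0 (tail D X), shift G (z X) (head D X)} \<in> zedges G" using X'(4) by auto
        have q0: "q (shift G g i) k = q i k + of_int g * m k" if "i \<in> R" "k < d" for i g k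
          using framework_shift[OF q(1) _ that(2)] that(1) R by blast
        have "L2_set (\<lambda>k. ?P (shift G 0 (tail D X)) k - ?P (shift G (z X) (head D X)) k) {..<c}
          = L2_set (\<lambda>k. q (shift G 0 (tail D X)) k - q (shift G (z X) (head D X)) k) {..<d}"
          using q(2) e unfolding equivalent_frameworks_def by blast
        moreover have "L2_set (\<lambda>k. ?P (shift G 0 (tail D X)) k - ?P (shift G (z X) (head D X)) k) {..<c}
          = L2_set (\<lambda>k. p (tail D X) k - p (head D X) k - of_int (z X) * l k) {..<c}"
          using rd(1) X'(1,2) by (intro L2_set_cong) (auto simp: algebra_simps)
        moreover have "L2_set (\<lambda>k. q (shift G 0 (tail D X)) k - q (shift G (z X) (head D X)) k) {..<d}
          = L2_set (\<lambda>k. q (tail D X) k - q (head D X) k - of_int (z X) * m k) {..<d}"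
          using q0 X'(1,2) by (intro L2_set_cong) (auto simp: algebra_simps)
        ultimately show ?thesis by simp
      qed
      moreover have "L2_set l {..<c} = L2_set m {..<d}" using q(2) unfolding equivalent_frameworks_def by simp
      ultimately show "\<exists>m q. L2_set l {..<c} = L2_set m {..<d} \<and>
        (\<forall>e\<in>arcs D. L2_set (\<lambda>k. p (tail D e) k - p (head D e) k - of_int (z e) * l k) {..<c}
         = L2_set (\<lambda>k. q (tail D e) k - q (head D e) k - of_int (z e) * m k) {..<d})" by blast
    qed
  next
    assume real: "lab_realizable d (D, z)"
    show "realizable d G" unfolding realizable_def
    proof (intro allI impI)
      fix c l p assume p: "periodic_framework G c l p"
      then have l: "\<exists>k<c. l k \<noteq> 0" unfolding periodic_framework_def by simp
      obtain m q where m: "L2_set l {..<c} = L2_set m {..<d}"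
        and q: "\<And>e. e \<in> arcs D \<Longrightarrow> L2_set (\<lambda>k. p (tail D e) k - p (head D e) k - of_int (z e) * l k) {..<c}
         = L2_set (\<lambda>k. q (tail D e) k - q (head D e) k - of_int (z e) * m k) {..<d}"
        using lab_realizableD[OF real l, of p] by blast
      let ?Q = "\<lambda>v k. q (\<rho> v) k + of_int (\<delta> v) * m k"
      have "\<exists>k<d. m k \<noteq> 0" using l m unfolding L2_set_nonzero by simp
      then have "periodic_framework G d m ?Q" by (rule periodic)
      moreover have "L2_set (\<lambda>k. p u k - p v k) {..<c} = L2_set (\<lambda>k. ?Q u k - ?Q v k) {..<d}"
        if uv: "{u, v} \<in> zedges G" for u v
      proof -
        obtain X \<beta> where X: "X \<in> arcs D" "{u, v} = {shift G \<beta> (tail D X), shift G (\<beta> + z X) (head D X)}"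
          using quotient_edge[OF Q uv] .
        let ?s = "shift G \<beta> (tail D X)" and ?t = "shift G (\<beta> + z X) (head D X)"
        note X' = quotient_edge_orbit[OF Q X(1)]
        have p0: "p (shift G g i) k = p i k + of_int g * l k" if "i \<in> R" "k < c" for i g k
          using framework_shift[OF p _ that(2)] that(1) R by blast
        have "L2_set (\<lambda>k. p ?s k - p ?t k) {..<c}
            = L2_set (\<lambda>k. p (tail D X) k - p (head D X) k - of_int (z X) * l k) {..<c}"
          using p0 X'(1,2) by (intro L2_set_cong) (auto simp: algebra_simps)
        also have "\<dots> = L2_set (\<lambda>k. q (tail D X) k - q (head D X) k - of_int (z X) * m k) {..<d}"
          by (rule q[OF X(1)])
        also have "\<dots> = L2_set (\<lambda>k. ?Q ?s k - ?Q ?t k) {..<d}"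
          using rd(1) X'(1,2) by (intro L2_set_cong) (auto simp: algebra_simps)
        finally have st: "L2_set (\<lambda>k. p ?s k - p ?t k) {..<c} = L2_set (\<lambda>k. ?Q ?s k - ?Q ?t k) {..<d}" .
        then have "L2_set (\<lambda>k. p ?t k - p ?s k) {..<c} = L2_set (\<lambda>k. ?Q ?t k - ?Q ?s k) {..<d}"
          unfolding L2_set_def by (simp add: power2_commute)
        then show ?thesis using st X(2) unfolding doubleton_eq_iff by blast
      qed
      ultimately show "\<exists>m q. periodic_framework G d m q \<and> equivalent_frameworks G c l p d m q"
        using m unfolding equivalent_frameworks_def by blast
    qed
  qed
qed

lemma quotient_wf: "quotient_wrt G R Q \<Longrightarrow> wf_digraph (fst Q)"
  unfolding quotient_wrt_def wf_digraph_def by auto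

lemma realizable_iso:
  assumes "Z_graph_iso G H" "\<And>e. e \<in> zedges H \<Longrightarrow> e \<subseteq> zverts H" "realizable d G"
  shows "realizable d H"
  unfolding realizable_def
proof (intro allI impI)
  fix c l p assume p: "periodic_framework H c l p"
  obtain f where f: "bij_betw f (zverts G) (zverts H)"
    and fe: "\<And>u v. u \<in> zverts G \<Longrightarrow> v \<in> zverts G \<Longrightarrow> {u, v} \<in> zedges G \<longleftrightarrow> {f u, f v} \<in> zedges H"
    and fs: "\<And>v g. v \<in> zverts G \<Longrightarrow> f (shift G g v) = shift H g (f v)"
    using assms(1) unfolding Z_graph_iso_def by blast
  define h where "h = inv_into (zverts G) f"
  have h: "h v \<in> zverts G" "f (h v) = v" if "v \<in> zverts H" for v
    using that f unfolding h_def bij_betw_def by (auto simp: inv_into_into f_inv_into_f)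
  have hf: "h (f v) = v" if "v \<in> zverts G" for v
    using that f unfolding h_def bij_betw_def by simp
  have "f v \<in> zverts H" if "v \<in> zverts G" for v using that f unfolding bij_betw_def by auto
  then have "periodic_framework G c l (\<lambda>v. p (f v))"
    using p fs unfolding periodic_framework_def by simp
  then obtain m q where q: "periodic_framework G d m q" "equivalent_frameworks G c l (\<lambda>v. p (f v)) d m q"
    using assms(3) unfolding realizable_def by blast
  have "h (shift H 1 v) = shift G 1 (h v)" if "v \<in> zverts H" for v
    using fs[OF h(1)[OF that], of 1] hf[OF shift_closed[OF h(1)[OF that], of 1]] h(2)[OF that] by simp
  then have "periodic_framework H d m (\<lambda>v. q (h v))"
    using q(1) h(1) unfolding periodic_framework_def by simp
  moreover have "equivalent_frameworks H c l p d m (\<lambda>v. q (h v))"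
    unfolding equivalent_frameworks_def
  proof (intro conjI allI impI)
    show "L2_set l {..<c} = L2_set m {..<d}" using q(2) unfolding equivalent_frameworks_def by simp
  next
    fix u v assume e: "{u, v} \<in> zedges H"
    then have uv: "u \<in> zverts H" "v \<in> zverts H" using assms(2) by blast+
    then have "{h u, h v} \<in> zedges G" using fe[of "h u" "h v"] h e by simp
    then have "L2_set (\<lambda>k. p (f (h u)) k - p (f (h v)) k) {..<c} = L2_set (\<lambda>k. q (h u) k - q (h v) k) {..<d}"
      using q(2) unfolding equivalent_frameworks_def by blast
    then show "L2_set (\<lambda>k. p u k - p v k) {..<c} = L2_set (\<lambda>k. q (h u) k - q (h v) k) {..<d}"
      using h uv by simp
  qed
  ultimately show "\<exists>m q. periodic_framework H d m q \<and> equivalent_frameworks H c l p d m q" by blast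
qed

end

section \<open>Lift graphs and their quotients at level zero\<close>

definition lift_orbit :: "('a, 'b) pre_digraph \<Rightarrow> ('b \<Rightarrow> int) \<Rightarrow> 'b \<Rightarrow> ('a \<times> int) set set" where
  "lift_orbit D z e = {{(tail D e, \<beta>), (head D e, \<beta> + z e)} | \<beta>. True}"

lemma lift_graph_simps [simp]:
  "zverts (lift_graph D z) = verts D \<times> UNIV"
  "zedges (lift_graph D z) = {{(tail D e, \<gamma>), (head D e, \<gamma> + z e)} | e \<gamma>. e \<in> arcs D}"
  "shift (lift_graph D z) \<gamma> (v, \<beta>) = (v, \<beta> + \<gamma>)"
  unfolding lift_graph_def by auto

lemma edge_orbit_lift:
  "edge_orbit (lift_graph D z) {(tail D e, \<gamma>), (head D e, \<gamma> + z e)} = lift_orbit D z e"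
proof -
  have "{(tail D e, \<beta>), (head D e, \<beta> + z e)} = shift (lift_graph D z) (\<beta> - \<gamma>) ` {(tail D e, \<gamma>), (head D e, \<gamma> + z e)}" for \<beta>
    by (simp add: algebra_simps)
  moreover have "shift (lift_graph D z) \<delta> ` {(tail D e, \<gamma>), (head D e, \<gamma> + z e)}
      = {(tail D e, \<gamma> + \<delta>), (head D e, (\<gamma> + \<delta>) + z e)}" for \<delta>
    by (simp add: algebra_simps)
  ultimately show ?thesis unfolding edge_orbit_def lift_orbit_def by blast
qed

lemma edge_orbits_lift: "edge_orbits (lift_graph D z) = lift_orbit D z ` arcs D"
proof -
  have "edge_orbits (lift_graph D z) =
      {edge_orbit (lift_graph D z) {(tail D e, \<gamma>), (head D e, \<gamma> + z e)} | e \<gamma>. e \<in> arcs D}"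
    unfolding edge_orbits_def by auto
  then show ?thesis unfolding edge_orbit_lift by blast
qed

lemma vertex_orbit_lift: "vertex_orbit (lift_graph D z) (v, \<beta>) = {v} \<times> UNIV"
proof -
  have "\<exists>\<delta>. \<gamma> = \<beta> + \<delta>" for \<gamma> :: int by (rule exI[of _ "\<gamma> - \<beta>"]) simp
  then show ?thesis unfolding vertex_orbit_def by auto
qed

lemma vertex_orbits_lift: "vertex_orbits (lift_graph D z) = (\<lambda>v. {v} \<times> UNIV) ` verts D"
  unfolding vertex_orbits_def using vertex_orbit_lift[of D z] by (auto simp: image_iff)

text \<open>Two arcs with the same lifted orbit agree up to inversion, which is what
  \<open>coincide\<close> expresses and simplicity forbids.\<close>

lemma lift_orbit_inj:
  assumes "simple_labelling D z"
  shows "inj_on (lift_orbit D z) (arcs D)"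
proof (rule inj_onI)
  fix e f assume ef: "e \<in> arcs D" "f \<in> arcs D" "lift_orbit D z e = lift_orbit D z f"
  have "{(tail D e, 0), (head D e, 0 + z e)} \<in> lift_orbit D z e" unfolding lift_orbit_def by blast
  then obtain \<beta> where "{(tail D e, 0), (head D e, z e)} = {(tail D f, \<beta>), (head D f, \<beta> + z f)}"
    unfolding ef(3) unfolding lift_orbit_def by auto
  then have "coincide D z e f" unfolding coincide_def doubleton_eq_iff by auto
  then show "e = f" using assms ef(1,2) unfolding simple_labelling_def by blast
qed

lemma lift_Z_symmetric:
  assumes "wf_digraph D" "finite (verts D)" "finite (arcs D)" "simple_labelling D z"
  shows "Z_symmetric_graph (lift_graph D z)"
proof
  fix e assume "e \<in> zedges (lift_graph D z)"
  then obtain a \<gamma> where a: "a \<in> arcs D" "e = {(tail D a, \<gamma>), (head D a, \<gamma> + z a)}" by auto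
  moreover have "tail D a \<in> verts D" "head D a \<in> verts D"
    using assms(1) a(1) unfolding wf_digraph_def by auto
  moreover have "(tail D a, \<gamma>) \<noteq> (head D a, \<gamma> + z a)"
    using assms(4) a(1) unfolding simple_labelling_def by auto
  ultimately show "e \<subseteq> zverts (lift_graph D z) \<and> card e = 2" by simp
next
  fix e \<delta> assume "e \<in> zedges (lift_graph D z)"
  then obtain a \<gamma> where a: "a \<in> arcs D" "e = {(tail D a, \<gamma>), (head D a, \<gamma> + z a)}" by auto
  then have "shift (lift_graph D z) \<delta> ` e = {(tail D a, \<gamma> + \<delta>), (head D a, (\<gamma> + \<delta>) + z a)}"
    by (simp add: algebra_simps)
  then show "shift (lift_graph D z) \<delta> ` e \<in> zedges (lift_graph D z)" using a(1) by auto
next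
  show "finite (vertex_orbits (lift_graph D z))" "finite (edge_orbits (lift_graph D z))"
    using assms(2,3) unfolding vertex_orbits_lift edge_orbits_lift by auto
qed (auto simp: algebra_simps)

text \<open>The representatives are the vertices at level 0, and the arcs of D are renamed to their
  edge orbits. The isomorphism is recorded in both directions: one transfers realizability to D, the
  other completes the construction of a minor.\<close>

lemma lift_quotient:
  assumes "wf_digraph D" "simple_labelling D z"
  obtains R P where "quotient_wrt (lift_graph D z) R P" "exact_iso (D, z) P" "exact_iso P (D, z)" "wf_digraph (fst P)"
proof -
  define L where "L = lift_graph D z"
  define h where "h = inv_into (arcs D) (lift_orbit D z)"
  have h: "h X \<in> arcs D" "lift_orbit D z (h X) = X" if "X \<in> edge_orbits L" for X
    using that unfolding L_def edge_orbits_lift h_def by (rule inv_into_into, rule f_inv_into_f)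
  have hl: "h (lift_orbit D z e) = e" if "e \<in> arcs D" for e
    using that lift_orbit_inj[OF assms(2)] unfolding h_def by simp
  define D' where "D' = \<lparr>verts = verts D \<times> {0::int}, arcs = edge_orbits L,
    tail = \<lambda>X. (tail D (h X), 0), head = \<lambda>X. (head D (h X), 0)\<rparr>"
  have wf: "tail D e \<in> verts D" "head D e \<in> verts D" if "e \<in> arcs D" for e
    using assms(1) that unfolding wf_digraph_def by auto
  have "orbit_representatives L (verts D \<times> {0})"
    unfolding orbit_representatives_def L_def vertex_orbits_lift by auto
  moreover have "X = {{shift L \<beta> (tail D' X), shift L (\<beta> + z (h X)) (head D' X)} | \<beta>. True}"
    if "X \<in> edge_orbits L" for X
    using h(2)[OF that] unfolding lift_orbit_def D'_def L_def by simp
  ultimately have "quotient_wrt L (verts D \<times> {0}) (D', z \<circ> h)"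
    using h(1) wf unfolding quotient_wrt_def by (auto simp: D'_def)
  moreover have "exact_iso (D, z) (D', z \<circ> h)"
    unfolding exact_iso_def prod.case
  proof (intro exI conjI)
    show "bij_betw (\<lambda>v. (v, 0)) (verts D) (verts D')" unfolding D'_def bij_betw_def by (auto simp: inj_on_def)
    show "bij_betw (lift_orbit D z) (arcs D) (arcs D')"
      using lift_orbit_inj[OF assms(2)] unfolding D'_def bij_betw_def L_def edge_orbits_lift by simp
  qed (auto simp: D'_def hl)
  moreover have "exact_iso (D', z \<circ> h) (D, z)"
    unfolding exact_iso_def prod.case
  proof (intro exI conjI)
    show "bij_betw fst (verts D') (verts D)" unfolding D'_def bij_betw_def by (auto simp: inj_on_def)
    show "bij_betw h (arcs D') (arcs D)"
      unfolding h_def D'_def L_def edge_orbits_lift using lift_orbit_inj[OF assms(2)]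
      by (simp add: bij_betw_inv_into bij_betw_imageI)
  qed (auto simp: D'_def)
  moreover have "wf_digraph D'" using h(1) wf unfolding wf_digraph_def D'_def by auto
  ultimately show thesis using that unfolding L_def by (metis fst_conv)
qed

text \<open>Realizability travels from G to its quotient, along the minor operations to the quotient
  of H, up to H, across the isomorphism to the lift, and down to D.\<close>

lemma lab_realizable_of_minor:
  fixes D :: "('v, 'e) pre_digraph"
  assumes "Z_symmetric_graph G" "realizable d G" "has_minor_isomorphic_to G (lift_graph D z)"
    and D: "wf_digraph D" "finite (verts D)" "finite (arcs D)" "simple_labelling D z"
  shows "lab_realizable d (D, z)"
proof -
  obtain H :: "('v \<times> int) zgraph" and R P S Q where H: "Z_symmetric_graph H" "quotient_wrt H R P" "quotient_wrt G S Q"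
    "labelled_minor P Q" "Z_graph_iso H (lift_graph D z)"
    using assms(3) unfolding has_minor_isomorphic_to_def Z_minor_def by blast
  have L: "Z_symmetric_graph (lift_graph D z)" using lift_Z_symmetric[OF D] .
  have "lab_realizable d Q"
    using Z_symmetric_graph.realizable_iff_quotient[OF assms(1)] H(3) assms(2) by (metis surj_pair)
  then have "lab_realizable d P"
    using lab_realizable_labelled_minor[OF H(4)] Z_symmetric_graph.quotient_wf[OF assms(1) H(3)] by blast
  then have "realizable d H"
    using Z_symmetric_graph.realizable_iff_quotient[OF H(1)] H(2) by (metis surj_pair)
  then have rL: "realizable d (lift_graph D z)"
    using Z_symmetric_graph.realizable_iso[OF H(1,5)] Z_symmetric_graph.edges_simple[OF L] by blast
  obtain R' P' where P': "quotient_wrt (lift_graph D z) R' P'" "exact_iso P' (D, z)" "wf_digraph (fst P')"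
    using lift_quotient[OF D(1,4)] by metis
  have "lab_realizable d P'"
    using Z_symmetric_graph.realizable_iff_quotient[OF L] P'(1) rL by (metis surj_pair)
  then show ?thesis using lab_realizable_exact_iso[OF P'(2,3)] by blast
qed

section \<open>The forbidden minors are not realizable\<close>

lemma lab_realizable_sq:
  fixes l :: "nat \<Rightarrow> real"
  assumes "lab_realizable d (D, z)" "\<exists>k<c. l k \<noteq> 0"
  shows "\<exists>(m :: nat \<Rightarrow> real) q. (\<Sum>k<d. (m k)\<^sup>2) = (\<Sum>k<c. (l k)\<^sup>2) \<and>
    (\<forall>e\<in>arcs D. (\<Sum>k<d. (q (tail D e) k - q (head D e) k - of_int (z e) * m k)\<^sup>2)
       = (\<Sum>k<c. (p (tail D e) k - p (head D e) k - of_int (z e) * l k)\<^sup>2))"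
proof -
  obtain m q where "L2_set l {..<c} = L2_set m {..<d}"
    "\<forall>e\<in>arcs D. L2_set (\<lambda>k. p (tail D e) k - p (head D e) k - of_int (z e) * l k) {..<c}
       = L2_set (\<lambda>k. q (tail D e) k - q (head D e) k - of_int (z e) * m k) {..<d}"
    using lab_realizableD[OF assms, of p] by blast
  then show ?thesis unfolding L2_set_def by (intro exI[of _ m] exI[of _ q]) simp
qed

text \<open>The identity says that the Gram determinant of three plane vectors vanishes; for
  orthonormal vectors it would be 1.\<close>

lemma no_three_orthonormal:
  fixes a0 a1 b0 b1 c0 c1 :: real
  assumes "a0\<^sup>2 + a1\<^sup>2 = 1" "b0\<^sup>2 + b1\<^sup>2 = 1" "c0\<^sup>2 + c1\<^sup>2 = 1"
    "a0 * b0 + a1 * b1 = 0" "a0 * c0 + a1 * c1 = 0" "b0 * c0 + b1 * c1 = 0"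
  shows False
proof -
  have "(a0\<^sup>2 + a1\<^sup>2) * (b0\<^sup>2 + b1\<^sup>2) * (c0\<^sup>2 + c1\<^sup>2)
      + 2 * (a0 * b0 + a1 * b1) * (b0 * c0 + b1 * c1) * (a0 * c0 + a1 * c1)
      - (a0\<^sup>2 + a1\<^sup>2) * (b0 * c0 + b1 * c1)\<^sup>2 - (b0\<^sup>2 + b1\<^sup>2) * (a0 * c0 + a1 * c1)\<^sup>2
      - (c0\<^sup>2 + c1\<^sup>2) * (a0 * b0 + a1 * b1)\<^sup>2 = 0"
    by algebra
  then show False unfolding assms by simp
qed

text \<open>Here A stands for the squared length of a difference vector and B for its product with
  the unit lattice vector. Two parallel edges with different labels give two independent linear
  equations for them.\<close>

lemma two_labels:
  fixes A B g h :: real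
  assumes "A - 2 * g * B = 1" "A - 2 * h * B = 1" "g \<noteq> h"
  shows "A = 1" "B = 0"
proof -
  have "(g - h) * B = 0" using assms(1,2) by (simp add: algebra_simps)
  then show "B = 0" using assms(3) by simp
  then show "A = 1" using assms(1) by simp
qed

text \<open>The framework puts vertex 1 at the origin and the others at the unit vectors. The
  lengths force two differences at vertex 1 to be orthonormal, which a line does not allow. The
  labels are \<open>0\<close>, so l may be any nonzero vector.\<close>

lemma K3_not_realizable: "\<not> lab_realizable 1 (complete_digraph 3, \<lambda>_. 0)"
proof
  assume real: "lab_realizable 1 (complete_digraph 3, \<lambda>_. 0)"
  define p :: "nat \<Rightarrow> nat \<Rightarrow> real" where "p v k = (if v = k + 2 then 1 else 0)" for v k
  define l :: "nat \<Rightarrow> real" where "l k = 1" for k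
  have ex: "\<exists>k<2. l k \<noteq> 0" by (intro exI[of _ 0]) (simp add: l_def)
  obtain m :: "nat \<Rightarrow> real" and q :: "nat \<Rightarrow> nat \<Rightarrow> real" where "\<And>e. e \<in> arcs (complete_digraph 3) \<Longrightarrow>
      (\<Sum>k<1. (q (tail (complete_digraph 3) e) k - q (head (complete_digraph 3) e) k - of_int 0 * m k)\<^sup>2)
       = (\<Sum>k<2. (p (tail (complete_digraph 3) e) k - p (head (complete_digraph 3) e) k - of_int 0 * l k)\<^sup>2)"
    using lab_realizable_sq[OF real ex, of p] by blast
  from this[of "(1, 2)"] this[of "(1, 3)"] this[of "(2, 3)"]
  have "(q 1 0 - q 2 0)\<^sup>2 = 1" "(q 1 0 - q 3 0)\<^sup>2 = 1" "(q 2 0 - q 3 0)\<^sup>2 = 2"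
    by (simp_all add: complete_digraph_3 complete_digraph_ends p_def numeral_2_eq_2)
  then have "(q 1 0 - q 2 0)\<^sup>2 * (q 1 0 - q 3 0)\<^sup>2 = 1" "(q 1 0 - q 2 0) * (q 1 0 - q 3 0) = 0"
    by (auto simp: power2_eq_square algebra_simps)
  then show False by auto
qed

lemma K4_not_realizable: "\<not> lab_realizable 2 (complete_digraph 4, \<lambda>_. 0)"
proof
  assume real: "lab_realizable 2 (complete_digraph 4, \<lambda>_. 0)"
  define p :: "nat \<Rightarrow> nat \<Rightarrow> real" where "p v k = (if v = k + 2 then 1 else 0)" for v k
  define l :: "nat \<Rightarrow> real" where "l k = 1" for k
  have ex: "\<exists>k<3. l k \<noteq> 0" by (intro exI[of _ 0]) (simp add: l_def)
  obtain m :: "nat \<Rightarrow> real" and q :: "nat \<Rightarrow> nat \<Rightarrow> real" where "\<And>e. e \<in> arcs (complete_digraph 4) \<Longrightarrow>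
      (\<Sum>k<2. (q (tail (complete_digraph 4) e) k - q (head (complete_digraph 4) e) k - of_int 0 * m k)\<^sup>2)
       = (\<Sum>k<3. (p (tail (complete_digraph 4) e) k - p (head (complete_digraph 4) e) k - of_int 0 * l k)\<^sup>2)"
    using lab_realizable_sq[OF real ex, of p] by blast
  from this[of "(1, 2)"] this[of "(1, 3)"] this[of "(1, 4)"] this[of "(2, 3)"] this[of "(2, 4)"] this[of "(3, 4)"]
  have e: "(q 1 0 - q 2 0)\<^sup>2 + (q 1 1 - q 2 1)\<^sup>2 = 1" "(q 1 0 - q 3 0)\<^sup>2 + (q 1 1 - q 3 1)\<^sup>2 = 1"
      "(q 1 0 - q 4 0)\<^sup>2 + (q 1 1 - q 4 1)\<^sup>2 = 1" "(q 2 0 - q 3 0)\<^sup>2 + (q 2 1 - q 3 1)\<^sup>2 = 2"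
      "(q 2 0 - q 4 0)\<^sup>2 + (q 2 1 - q 4 1)\<^sup>2 = 2" "(q 3 0 - q 4 0)\<^sup>2 + (q 3 1 - q 4 1)\<^sup>2 = 2"
    by (simp_all add: complete_digraph_4 complete_digraph_ends p_def numeral_2_eq_2 numeral_3_eq_3)
  show False
    by (rule no_three_orthonormal[OF e(1-3)]) (use e in \<open>auto simp: power2_eq_square algebra_simps\<close>)
qed

text \<open>With the difference of the two points and l orthonormal, the two edge lengths together
  with the length of l force orthonormality of their counterparts on the line.\<close>

lemma K2_dot_not_realizable:
  assumes "simple_labelling K2_dot z"
  shows "\<not> lab_realizable 1 (K2_dot, z)"
proof
  assume real: "lab_realizable 1 (K2_dot, z)"
  define p :: "nat \<Rightarrow> nat \<Rightarrow> real" where "p v k = (if v = 1 \<and> k = 0 then 1 else 0)" for v k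
  define l :: "nat \<Rightarrow> real" where "l k = (if k = 1 then 1 else 0)" for k
  have ex: "\<exists>k<2. l k \<noteq> 0" by (intro exI[of _ 1]) (simp add: l_def)
  obtain m :: "nat \<Rightarrow> real" and q :: "nat \<Rightarrow> nat \<Rightarrow> real" where m: "(\<Sum>k<1. (m k)\<^sup>2) = (\<Sum>k<2. (l k)\<^sup>2)"
    and q: "\<And>e. e \<in> arcs K2_dot \<Longrightarrow>
      (\<Sum>k<1. (q (tail K2_dot e) k - q (head K2_dot e) k - of_int (z e) * m k)\<^sup>2)
       = (\<Sum>k<2. (p (tail K2_dot e) k - p (head K2_dot e) k - of_int (z e) * l k)\<^sup>2)"
    using lab_realizable_sq[OF real ex, of p] by blast
  define g where "g n = real_of_int (z (1, 2, n))" for n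
  define a where "a = q 1 0 - q 2 0"
  have m1: "(m 0)\<^sup>2 = 1" using m by (simp add: l_def numeral_2_eq_2)
  have "(a - g n * m 0)\<^sup>2 = 1 + (g n)\<^sup>2" if "n < 2" for n
    using q[of "(1, 2, n)"] that
    by (auto simp: K2_dot_def p_def l_def numeral_2_eq_2 g_def a_def less_Suc_eq)
  then have "a\<^sup>2 - 2 * g n * (a * m 0) + (g n)\<^sup>2 * (m 0)\<^sup>2 = 1 + (g n)\<^sup>2" if "n < 2" for n
    using that by (simp add: power2_eq_square algebra_simps)
  then have "a\<^sup>2 - 2 * g n * (a * m 0) = 1" if "n < 2" for n using that unfolding m1 by simp
  moreover have "g 0 \<noteq> g 1"
    using assms unfolding simple_labelling_def coincide_def g_def by (auto simp: K2_dot_def)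
  ultimately have "a\<^sup>2 = 1" "a * m 0 = 0" using two_labels[of "a\<^sup>2" "g 0" "a * m 0" "g 1"] by auto
  then show False using m1 by auto
qed

text \<open>The double edges at vertex 3 make each of the two differences a unit vector orthogonal
  to m; the remaining edge makes them orthogonal to each other, whatever its label h. The plane
  would contain three orthonormal vectors.\<close>

lemma K3_dot_dot_not_realizable:
  assumes "simple_labelling K3_dot_dot z"
  shows "\<not> lab_realizable 2 (K3_dot_dot, z)"
proof
  assume real: "lab_realizable 2 (K3_dot_dot, z)"
  \<comment> \<open>Vertices 1 and 2 sit at the first two unit vectors; the bound on k keeps vertex
    3 at the origin, and l is the third unit vector.\<close>
  define p :: "nat \<Rightarrow> nat \<Rightarrow> real" where "p v k = (if v = k + 1 \<and> k < 2 then 1 else 0)" for v k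
  define l :: "nat \<Rightarrow> real" where "l k = (if k = 2 then 1 else 0)" for k
  have ex: "\<exists>k<3. l k \<noteq> 0" by (intro exI[of _ 2]) (simp add: l_def)
  obtain m :: "nat \<Rightarrow> real" and q :: "nat \<Rightarrow> nat \<Rightarrow> real" where m: "(\<Sum>k<2. (m k)\<^sup>2) = (\<Sum>k<3. (l k)\<^sup>2)"
    and q: "\<And>e. e \<in> arcs K3_dot_dot \<Longrightarrow>
      (\<Sum>k<2. (q (tail K3_dot_dot e) k - q (head K3_dot_dot e) k - of_int (z e) * m k)\<^sup>2)
       = (\<Sum>k<3. (p (tail K3_dot_dot e) k - p (head K3_dot_dot e) k - of_int (z e) * l k)\<^sup>2)"
    using lab_realizable_sq[OF real ex, of p] by blast
  define g where "g i n = real_of_int (z (i, 3, n))" for i n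
  define h where "h = real_of_int (z (1, 2, 0))"
  define a where "a i k = q i k - q 3 k" for i k
  have m1: "(m 0)\<^sup>2 + (m 1)\<^sup>2 = 1" using m by (simp add: l_def numeral_2_eq_2 numeral_3_eq_3)
  have orth: "(a i 0)\<^sup>2 + (a i 1)\<^sup>2 = 1" "a i 0 * m 0 + a i 1 * m 1 = 0" if i: "i \<in> {1, 2}" for i
  proof -
    have "(a i 0 - g i n * m 0)\<^sup>2 + (a i 1 - g i n * m 1)\<^sup>2 = 1 + (g i n)\<^sup>2" if "n < 2" for n
      using q[of "(i, 3, n)"] that i
      by (auto simp: K3_dot_dot_def p_def l_def numeral_2_eq_2 numeral_3_eq_3 g_def a_def less_Suc_eq)
    then have "((a i 0)\<^sup>2 + (a i 1)\<^sup>2) - 2 * g i n * (a i 0 * m 0 + a i 1 * m 1)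
        + (g i n)\<^sup>2 * ((m 0)\<^sup>2 + (m 1)\<^sup>2) = 1 + (g i n)\<^sup>2" if "n < 2" for n
      using that by (simp add: power2_eq_square algebra_simps)
    then have "((a i 0)\<^sup>2 + (a i 1)\<^sup>2) - 2 * g i n * (a i 0 * m 0 + a i 1 * m 1) = 1" if "n < 2" for n
      using that unfolding m1 by simp
    moreover have "g i 0 \<noteq> g i 1"
      using assms i unfolding simple_labelling_def coincide_def g_def by (auto simp: K3_dot_dot_def)
    ultimately show "(a i 0)\<^sup>2 + (a i 1)\<^sup>2 = 1" "a i 0 * m 0 + a i 1 * m 1 = 0"
      using two_labels[of "(a i 0)\<^sup>2 + (a i 1)\<^sup>2" "g i 0" "a i 0 * m 0 + a i 1 * m 1" "g i 1"] by auto
  qed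
  have "(a 1 0 - a 2 0 - h * m 0)\<^sup>2 + (a 1 1 - a 2 1 - h * m 1)\<^sup>2 = 2 + h\<^sup>2"
    using q[of "(1, 2, 0)"]
    by (simp add: K3_dot_dot_def p_def l_def numeral_2_eq_2 numeral_3_eq_3 h_def a_def)
  moreover have "(a 1 0 - a 2 0 - h * m 0)\<^sup>2 + (a 1 1 - a 2 1 - h * m 1)\<^sup>2 =
      ((a 1 0)\<^sup>2 + (a 1 1)\<^sup>2) + ((a 2 0)\<^sup>2 + (a 2 1)\<^sup>2) + h\<^sup>2 * ((m 0)\<^sup>2 + (m 1)\<^sup>2)
      - 2 * h * (a 1 0 * m 0 + a 1 1 * m 1) + 2 * h * (a 2 0 * m 0 + a 2 1 * m 1)
      - 2 * (a 1 0 * a 2 0 + a 1 1 * a 2 1)"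
    by (simp add: power2_eq_square algebra_simps)
  moreover have o1: "(a 1 0)\<^sup>2 + (a 1 1)\<^sup>2 = 1" "a 1 0 * m 0 + a 1 1 * m 1 = 0"
    and o2: "(a 2 0)\<^sup>2 + (a 2 1)\<^sup>2 = 1" "a 2 0 * m 0 + a 2 1 * m 1 = 0"
    by (rule orth; simp)+
  ultimately have "2 + h\<^sup>2 = 1 + 1 + h\<^sup>2 * 1 - 2 * h * 0 + 2 * h * 0 - 2 * (a 1 0 * a 2 0 + a 1 1 * a 2 1)"
    unfolding m1 by metis
  moreover have "w = 0" if "2 + x = 1 + 1 + x * 1 - 2 * y * 0 + 2 * y * 0 - 2 * w" for x y w :: real
    using that by simp
  ultimately have "a 1 0 * a 2 0 + a 1 1 * a 2 1 = 0" by blast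
  then show False by (rule no_three_orthonormal[OF o1(1) o2(1) m1 _ o1(2) o2(2)])
qed

section \<open>Models yield minors\<close>

text \<open>A contraction leaves open which of several coinciding arcs survive. Choosing a maximal
  simple set above T keeps all of T: an arc outside it is a loop labelled \<open>0\<close> or
  coincides with a member, since otherwise it could be added.\<close>

lemma simplified_arcs_extend:
  assumes "finite (arcs D)" "T \<subseteq> arcs D" "simple_labelling (D\<lparr>arcs := T\<rparr>) z"
  obtains S where "T \<subseteq> S" "simplified_arcs D z S"
proof -
  define \<S> where "\<S> = {S. T \<subseteq> S \<and> S \<subseteq> arcs D \<and> simple_labelling (D\<lparr>arcs := S\<rparr>) z}"
  have "finite \<S>" "T \<in> \<S>" using assms unfolding \<S>_def by auto
  then obtain S where S: "S \<in> \<S>" "\<And>B. B \<in> \<S> \<Longrightarrow> S \<subseteq> B \<Longrightarrow> S = B"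
    using finite_has_maximal[of \<S>] by blast
  have "tail D f = head D f \<and> z f = 0 \<or> (\<exists>f'\<in>S. coincide D z f f')" if f: "f \<in> arcs D - S" for f
  proof (rule ccontr)
    assume con: "\<not> ?thesis"
    have S': "T \<subseteq> S" "S \<subseteq> arcs D" "simple_labelling (D\<lparr>arcs := S\<rparr>) z" using S(1) unfolding \<S>_def by auto
    have "simple_labelling (D\<lparr>arcs := insert f S\<rparr>) z"
      using S'(3) con unfolding simple_labelling_def coincide_def by auto
    then have "insert f S \<in> \<S>" using S' f unfolding \<S>_def by auto
    then show False using S(2)[of "insert f S"] f by blast
  qed
  then have "simplified_arcs D z S" using S(1) unfolding simplified_arcs_def \<S>_def by auto
  then show thesis using that S(1) unfolding \<S>_def by blast
qed

lemma delete_arcs: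
  assumes "finite B" "B \<subseteq> arcs D"
  shows "minor_step\<^sup>*\<^sup>* (D, z) (D\<lparr>arcs := arcs D - B\<rparr>, z)"
  using assms
proof (induction B rule: finite_induct)
  case (insert e B)
  let ?D = "D\<lparr>arcs := arcs D - B\<rparr>"
  have "minor_step (?D, z) (pre_digraph.del_arc ?D e, z)" by (rule edge_deletion) (use insert in auto)
  moreover have "pre_digraph.del_arc ?D e = D\<lparr>arcs := arcs D - insert e B\<rparr>"
    unfolding pre_digraph.del_arc_def by (intro pre_digraph.equality) auto
  ultimately show ?case using insert by (auto intro: rtranclp.rtrancl_into_rtrancl)
qed simp

lemma delete_verts:
  assumes "finite W" "W \<subseteq> verts D"
  shows "minor_step\<^sup>*\<^sup>* (D, z)
    (D\<lparr>verts := verts D - W, arcs := {e \<in> arcs D. tail D e \<notin> W \<and> head D e \<notin> W}\<rparr>, z)"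
  using assms
proof (induction W rule: finite_induct)
  case (insert v W)
  let ?D = "D\<lparr>verts := verts D - W, arcs := {e \<in> arcs D. tail D e \<notin> W \<and> head D e \<notin> W}\<rparr>"
  have "minor_step (?D, z) (pre_digraph.del_vert ?D v, z)" by (rule vertex_deletion) (use insert in auto)
  moreover have "pre_digraph.del_vert ?D v =
      D\<lparr>verts := verts D - insert v W, arcs := {e \<in> arcs D. tail D e \<notin> insert v W \<and> head D e \<notin> insert v W}\<rparr>"
    unfolding pre_digraph.del_vert_def by (intro pre_digraph.equality) auto
  ultimately show ?case using insert by (auto intro: rtranclp.rtrancl_into_rtrancl)
qed simp

definition inner_adj :: "('a, 'b) pre_digraph \<Rightarrow> 'b set \<Rightarrow> 'a \<Rightarrow> 'a \<Rightarrow> bool" where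
  "inner_adj D T u v \<longleftrightarrow> (\<exists>e\<in>arcs D - T. {tail D e, head D e} = {u, v})"

text \<open>The arcs outside \<open>T\<close> connect the fibres of \<open>f\<close> and are contracted one after the other.\<close>

lemma contract_fibres:
  fixes D :: "('a, 'b) pre_digraph" and K :: "('c, 'd) pre_digraph"
  assumes "wf_digraph D" "finite (verts D)" "finite (arcs D)"
    and K: "simple_labelling K zK"
    and f: "f ` verts D = verts K"
    and h: "bij_betw h (arcs K) T" "T \<subseteq> arcs D"
    and hK: "\<And>a. a \<in> arcs K \<Longrightarrow> f (tail D (h a)) = tail K a \<and> f (head D (h a)) = head K a \<and> z (h a) = zK a"
    and inner: "\<And>e. e \<in> arcs D - T \<Longrightarrow> f (tail D e) = f (head D e) \<and> z e = 0"
    and conn: "\<And>u v. u \<in> verts D \<Longrightarrow> v \<in> verts D \<Longrightarrow> f u = f v \<Longrightarrow> (inner_adj D T)\<^sup>*\<^sup>* u v"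
  shows "\<exists>Q. minor_step\<^sup>*\<^sup>* (D, z) Q \<and> exact_iso Q (K, zK)"
  using assms(1-3) f h(2) hK inner conn
proof (induction "card (verts D)" arbitrary: D rule: less_induct)
  case less
  note wf = less.prems(1) and fin = less.prems(2,3) and f = less.prems(4) and T = less.prems(5)
    and hK = less.prems(6) and inner = less.prems(7) and conn = less.prems(8)
  have ends: "tail D e \<in> verts D" "head D e \<in> verts D" if "e \<in> arcs D" for e
    using wf that unfolding wf_digraph_def by auto
  show ?case
  proof (cases "inj_on f (verts D)")
    case True
    let ?D = "D\<lparr>arcs := arcs D - (arcs D - T)\<rparr>"
    have "minor_step\<^sup>*\<^sup>* (D, z) (?D, z)" using fin(2) by (intro delete_arcs) auto
    moreover have "exact_iso (?D, z) (K, zK)"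
      unfolding exact_iso_def prod.case
    proof (intro exI conjI)
      show "bij_betw f (verts ?D) (verts K)" using True f unfolding bij_betw_def by simp
      have "arcs D - (arcs D - T) = T" using T by auto
      then show "bij_betw (inv_into (arcs K) h) (arcs ?D) (arcs K)" using bij_betw_inv_into[OF h(1)] by simp
      show "\<forall>e\<in>arcs ?D. tail K (inv_into (arcs K) h e) = f (tail ?D e) \<and>
          head K (inv_into (arcs K) h e) = f (head ?D e) \<and> zK (inv_into (arcs K) h e) = z e"
      proof
        fix e assume "e \<in> arcs ?D"
        then have e: "e \<in> h ` arcs K" using h(1) unfolding bij_betw_def by auto
        then show "tail K (inv_into (arcs K) h e) = f (tail ?D e) \<and>
          head K (inv_into (arcs K) h e) = f (head ?D e) \<and> zK (inv_into (arcs K) h e) = z e"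
          using hK[OF inv_into_into[OF e]] f_inv_into_f[OF e] by simp
      qed
    qed
    ultimately show ?thesis by blast
  next
    case False
    then obtain u v where uv: "u \<in> verts D" "v \<in> verts D" "f u = f v" "u \<noteq> v"
      unfolding inj_on_def by blast
    have "\<exists>e\<in>arcs D - T. tail D e \<noteq> head D e"
    proof (rule ccontr)
      assume "\<not> ?thesis"
      then have loop: "a = b" if "inner_adj D T a b" for a b using that unfolding inner_adj_def by force
      have "u = v" using conn[OF uv(1-3)] by (induction rule: rtranclp_induct) (auto dest: loop)
      then show False using uv(4) by blast
    qed
    then obtain e where e: "e \<in> arcs D - T" "tail D e \<noteq> head D e" by blast
    define \<mu> where "\<mu> v = (if v = head D e then tail D e else v)" for v
    define D1 where "D1 = identify_ends D e"
    have D1: "verts D1 = \<mu> ` verts D" "arcs D1 = arcs D - {e}" "tail D1 a = \<mu> (tail D a)" "head D1 a = \<mu> (head D a)" for a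
      unfolding D1_def identify_ends_def Let_def \<mu>_def by auto
    have f\<mu>: "f (\<mu> x) = f x" for x using inner[OF e(1)] unfolding \<mu>_def by simp
    have T1: "T \<subseteq> arcs D1" using T e(1) unfolding D1 by auto
    have hT: "\<exists>a\<in>arcs K. t = h a" if "t \<in> T" for t using that h(1) unfolding bij_betw_def by auto
    have loopK: "zK a \<noteq> 0" if "a \<in> arcs K" "tail K a = head K a" for a
      using K that unfolding simple_labelling_def by blast
    \<comment> \<open>An arc of T inside a fibre corresponds to a loop of K, whose label is nonzero.
      This distinguishes the arcs of T from the contractible ones at every stage.\<close>
    have no_inner: "z t \<noteq> 0" if "t \<in> T" "f (tail D t) = f (head D t)" for t
    proof -
      obtain a where "a \<in> arcs K" "t = h a" using hT[OF \<open>t \<in> T\<close>] by blast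
      then show ?thesis using hK[of a] loopK[of a] that(2) by auto
    qed
    have "simple_labelling (D1\<lparr>arcs := T\<rparr>) z"
      unfolding simple_labelling_def
    proof (intro conjI ballI impI notI)
      fix t assume t: "t \<in> arcs (D1\<lparr>arcs := T\<rparr>)" "tail (D1\<lparr>arcs := T\<rparr>) t = head (D1\<lparr>arcs := T\<rparr>) t" "z t = 0"
      then have "\<mu> (tail D t) = \<mu> (head D t)" by (simp add: D1)
      then have "f (tail D t) = f (head D t)" using f\<mu> by metis
      then show False using no_inner[of t] t by simp
    next
      fix s t assume st: "s \<in> arcs (D1\<lparr>arcs := T\<rparr>)" "t \<in> arcs (D1\<lparr>arcs := T\<rparr>)" "s \<noteq> t"
        "coincide (D1\<lparr>arcs := T\<rparr>) z s t"
      obtain a b where ab: "a \<in> arcs K" "s = h a" "b \<in> arcs K" "t = h b" using hT[of s] hT[of t] st(1,2) by auto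
      have "coincide K zK a b"
        using st(4) hK[OF ab(1)] hK[OF ab(3)] f\<mu> unfolding coincide_def ab(2,4)
        by (simp add: D1) metis
      moreover have "a \<noteq> b" using ab st(3) by blast
      ultimately show False using K ab unfolding simple_labelling_def by blast
    qed
    \<comment> \<open>The simplification after contracting e is chosen so that every arc
      representing an arc of K remains.\<close>
    then obtain S where S: "T \<subseteq> S" "simplified_arcs D1 z S"
      using simplified_arcs_extend[of D1 T z] fin(2) T1 D1(2) by auto
    have SD: "S \<subseteq> arcs D - {e}" using S(2) unfolding simplified_arcs_def D1 by simp
    define D2 where "D2 = D1\<lparr>arcs := S\<rparr>"
    have D2: "verts D2 = \<mu> ` verts D" "arcs D2 = S" "tail D2 a = \<mu> (tail D a)" "head D2 a = \<mu> (head D a)" for a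
      unfolding D2_def by (simp_all add: D1)
    have ze: "z e = 0" using inner[OF e(1)] by simp
    have step: "minor_step (D, z) (D2, z)"
      unfolding D2_def D1_def
      by (rule edge_contraction) (use e ze S(2) in \<open>auto simp: D1_def\<close>)
    have e_arc: "e \<in> arcs D" using e(1) by simp
    have \<mu>V: "\<mu> x \<in> verts D" if "x \<in> verts D" for x using that ends(1)[OF e_arc] unfolding \<mu>_def by auto
    have sub: "verts D2 \<subseteq> verts D" using \<mu>V unfolding D2 by auto
    have "head D e \<notin> verts D2" using e(2) unfolding D2 \<mu>_def by auto
    then have card: "card (verts D2) < card (verts D)"
      using sub ends(2)[OF e_arc] fin(1) by (intro psubset_card_mono) auto
    have adj: "(inner_adj D2 T)\<^sup>*\<^sup>* (\<mu> a) (\<mu> b)" if "inner_adj D T a b" for a b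
    proof -
      obtain g where g: "g \<in> arcs D - T" "{tail D g, head D g} = {a, b}"
        using \<open>inner_adj D T a b\<close> unfolding inner_adj_def by blast
      then have ab: "{\<mu> a, \<mu> b} = {\<mu> (tail D g), \<mu> (head D g)}" by (metis image_empty image_insert)
      show ?thesis
      proof (cases "\<mu> a = \<mu> b")
        case False
        have "g \<noteq> e" using False ab unfolding \<mu>_def by (auto simp: doubleton_eq_iff)
        \<comment> \<open>Simplifying may remove g, but then a coinciding arc of S joins the same
          vertices with label \<open>0\<close>; it cannot lie in T by \<open>no_inner\<close>. So
          the fibres stay connected by arcs outside T.\<close>
        have "\<exists>g'\<in>S - T. {\<mu> (tail D g'), \<mu> (head D g')} = {\<mu> a, \<mu> b}"
        proof (cases "g \<in> S")
          case True
          then show ?thesis using g(1) ab by auto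
        next
          case nS: False
          have "\<mu> (tail D g) \<noteq> \<mu> (head D g)" using False ab by (auto simp: doubleton_eq_iff)
          then obtain g' where g': "g' \<in> S" "coincide D1 z g g'"
            using S(2) nS g(1) \<open>g \<noteq> e\<close> unfolding simplified_arcs_def by (auto simp: D1)
          then have zg: "z g' = 0" and e': "{\<mu> (tail D g'), \<mu> (head D g')} = {\<mu> (tail D g), \<mu> (head D g)}"
            using inner[OF g(1)] unfolding coincide_def by (auto simp: D1)
          have "f (\<mu> (tail D g)) = f (\<mu> (head D g))" using inner[OF g(1)] f\<mu> by simp
          then have "f (\<mu> (tail D g')) = f (\<mu> (head D g'))" using e' by (auto simp: doubleton_eq_iff)
          then have "g' \<notin> T" using no_inner[of g'] zg f\<mu> by auto
          then show ?thesis using g'(1) e' ab by auto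
        qed
        then have "inner_adj D2 T (\<mu> a) (\<mu> b)" unfolding inner_adj_def D2 by auto
        then show ?thesis by blast
      qed simp
    qed
    have conn2: "(inner_adj D2 T)\<^sup>*\<^sup>* (\<mu> a) (\<mu> b)" if "(inner_adj D T)\<^sup>*\<^sup>* a b" for a b
      using that
    proof (induction rule: rtranclp_induct)
      case (step y w)
      then show ?case using adj by (meson rtranclp_trans)
    qed simp
    have "\<exists>Q. minor_step\<^sup>*\<^sup>* (D2, z) Q \<and> exact_iso Q (K, zK)"
    proof (rule less.hyps[OF card])
      show "wf_digraph D2"
        using ends SD unfolding wf_digraph_def D2 by auto
      show "finite (verts D2)" "finite (arcs D2)" "T \<subseteq> arcs D2"
        using fin SD S(1) by (auto simp: D2 intro: finite_subset)
      have "f ` \<mu> ` verts D = f ` verts D" using f\<mu> by (simp add: image_image)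
      then show "f ` verts D2 = verts K" using f by (simp add: D2)
      show "f (tail D2 (h a)) = tail K a \<and> f (head D2 (h a)) = head K a \<and> z (h a) = zK a" if "a \<in> arcs K" for a
        using hK[OF that] by (simp add: D2 f\<mu>)
      show "f (tail D2 a) = f (head D2 a) \<and> z a = 0" if "a \<in> arcs D2 - T" for a
        using inner[of a] that SD by (auto simp: D2 f\<mu>)
      show "(inner_adj D2 T)\<^sup>*\<^sup>* a b" if "a \<in> verts D2" "b \<in> verts D2" "f a = f b" for a b
      proof -
        have "\<mu> a = a" "\<mu> b = b" using that(1,2) e(2) unfolding D2 \<mu>_def by auto
        then show ?thesis using conn2[OF conn[of a b]] that sub by auto
      qed
    qed
    then show ?thesis using step by (meson converse_rtranclp_into_rtranclp)
  qed
qed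

lemma exact_iso_trans:
  assumes "exact_iso P Q" "exact_iso Q W"
  shows "exact_iso P W"
proof -
  obtain D1 z1 D2 z2 D3 z3 where PQW: "P = (D1, z1)" "Q = (D2, z2)" "W = (D3, z3)"
    by (cases P, cases Q, cases W)
  obtain f g where fg: "bij_betw f (verts D1) (verts D2)" "bij_betw g (arcs D1) (arcs D2)"
    "\<forall>e\<in>arcs D1. tail D2 (g e) = f (tail D1 e) \<and> head D2 (g e) = f (head D1 e) \<and> z2 (g e) = z1 e"
    using assms(1) unfolding PQW exact_iso_def by auto
  obtain f' g' where fg': "bij_betw f' (verts D2) (verts D3)" "bij_betw g' (arcs D2) (arcs D3)"
    "\<forall>e\<in>arcs D2. tail D3 (g' e) = f' (tail D2 e) \<and> head D3 (g' e) = f' (head D2 e) \<and> z3 (g' e) = z2 e"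
    using assms(2) unfolding PQW exact_iso_def by auto
  have "g e \<in> arcs D2" if "e \<in> arcs D1" for e using fg(2) that unfolding bij_betw_def by auto
  then show ?thesis
    unfolding PQW exact_iso_def prod.case
    using bij_betw_trans[OF fg(1) fg'(1)] bij_betw_trans[OF fg(2) fg'(2)] fg(3) fg'(3)
    by (intro exI[of _ "f' \<circ> f"] exI[of _ "g' \<circ> g"]) auto
qed

text \<open>Each arc is listed in both directions, which absorbs edge inversion. Loops are left out:
  a loop labelled g has length |g| times that of the lattice vector and imposes no condition on the
  placement.\<close>

definition gain_edges :: "('a, 'b) labelled_graph \<Rightarrow> ('a \<times> 'a \<times> int) set" where
  "gain_edges Q = (case Q of (D, z) \<Rightarrow>
     {(i, j, g). i \<noteq> j \<and> (\<exists>e\<in>arcs D. i = tail D e \<and> j = head D e \<and> g = z e \<or>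
        i = head D e \<and> j = tail D e \<and> g = - z e)})"

section \<open>Switched quotients and the passage from models to minors\<close>

context Z_symmetric_graph
begin

lemma finite_representatives:
  assumes rep: "orbit_representatives G R"
  shows "finite R"
proof -
  have R: "R \<subseteq> zverts G" using rep unfolding orbit_representatives_def by simp
  obtain \<rho> \<delta> where rd: "\<And>i \<gamma>. i \<in> R \<Longrightarrow> \<rho> (shift G \<gamma> i) = i \<and> \<delta> (shift G \<gamma> i) = \<gamma>"
    using orbit_coordinates[OF rep] by metis
  have "inj_on (vertex_orbit G) R"
  proof (rule inj_onI)
    fix i j assume ij: "i \<in> R" "j \<in> R" "vertex_orbit G i = vertex_orbit G j"
    have "shift G 0 i \<in> vertex_orbit G i" unfolding vertex_orbit_def by blast
    then obtain \<gamma> where "shift G 0 i = shift G \<gamma> j" unfolding ij(3) unfolding vertex_orbit_def by blast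
    then show "i = j" using rd[OF ij(1), of 0] rd[OF ij(2), of \<gamma>] by metis
  qed
  moreover have "vertex_orbit G ` R \<subseteq> vertex_orbits G" using R unfolding vertex_orbits_def by auto
  ultimately show ?thesis using finite_vertex_orbits by (meson finite_imageD finite_subset)
qed

text \<open>Replacing each representative i by its translate by \<pi> i is simultaneous switching by
  \<pi>, and the arcs in I are recorded in the opposite direction. All relabelling is thus absorbed
  into the choice of quotient.\<close>

lemma quotient_switch:
  assumes Q: "quotient_wrt G R (D, z)"
  shows "quotient_wrt G ((\<lambda>i. shift G (\<pi> i) i) ` R)
    (\<lparr>verts = (\<lambda>i. shift G (\<pi> i) i) ` R, arcs = arcs D,
      tail = \<lambda>X. let i = if X \<in> I then head D X else tail D X in shift G (\<pi> i) i,
      head = \<lambda>X. let i = if X \<in> I then tail D X else head D X in shift G (\<pi> i) i\<rparr>,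
     \<lambda>X. (if X \<in> I then - 1 else 1) * (z X + \<pi> (tail D X) - \<pi> (head D X)))"
    (is "quotient_wrt G ?R (?D, ?z)")
proof -
  let ?s = "\<lambda>i. shift G (\<pi> i) i"
  have rep: "orbit_representatives G R" using Q unfolding quotient_wrt_def by simp
  then have R: "R \<subseteq> zverts G" unfolding orbit_representatives_def by simp
  obtain \<rho> \<delta> where rd: "\<And>i \<gamma>. i \<in> R \<Longrightarrow> \<rho> (shift G \<gamma> i) = i \<and> \<delta> (shift G \<gamma> i) = \<gamma>"
    "\<And>v. v \<in> zverts G \<Longrightarrow> \<rho> v \<in> R \<and> shift G (\<delta> v) (\<rho> v) = v"
    using orbit_coordinates[OF rep] by metis
  have add: "shift G \<beta> (shift G \<gamma> i) = shift G (\<beta> + \<gamma>) i" if "i \<in> R" for i \<beta> \<gamma>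
    using shift_add[of i \<beta> \<gamma>] that R by auto
  have "orbit_representatives G ?R"
    unfolding orbit_representatives_def
  proof (intro conjI ballI)
    show "?R \<subseteq> zverts G" using R shift_closed by auto
  next
    fix X assume "X \<in> vertex_orbits G"
    then obtain v where v: "v \<in> zverts G" "X = vertex_orbit G v" unfolding vertex_orbits_def by blast
    define i where "i = \<rho> v"
    have i: "i \<in> R" "v = shift G (\<delta> v) i" using rd(2)[OF v(1)] unfolding i_def by auto
    then have X: "X = {shift G (\<gamma> + \<delta> v) i | \<gamma>. True}"
      unfolding v(2) vertex_orbit_def using add[OF i(1), of _ "\<delta> v"] by metis
    show "\<exists>!j. j \<in> ?R \<and> j \<in> X"
    proof (rule ex1I[of _ "?s i"])
      have "?s i = shift G ((\<pi> i - \<delta> v) + \<delta> v) i" by simp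
      then have "?s i \<in> X" unfolding X by blast
      then show "?s i \<in> ?R \<and> ?s i \<in> X" using i(1) by blast
    next
      fix j assume "j \<in> ?R \<and> j \<in> X"
      then obtain k \<gamma> where "k \<in> R" "j = ?s k" "j = shift G \<gamma> i" unfolding X by blast
      then show "j = ?s i" using rd(1)[of k "\<pi> k"] rd(1)[OF i(1), of \<gamma>] by metis
    qed
  qed
  moreover have "tail ?D X \<in> ?R \<and> head ?D X \<in> ?R \<and>
      X = {{shift G \<beta> (tail ?D X), shift G (\<beta> + ?z X) (head ?D X)} | \<beta>. True}" if X: "X \<in> arcs D" for X
  proof -
    note X' = quotient_edge_orbit[OF Q X]
    let ?t = "tail D X" and ?h = "head D X"
    have mem: "?R \<supseteq> {?s ?t, ?s ?h}" using X'(1,2) by auto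
    have eq: "X = {{shift G \<beta> (tail ?D X), shift G (\<beta> + ?z X) (head ?D X)} | \<beta>. True}"
    proof (cases "X \<in> I")
      case False
      have "{shift G \<beta> (tail ?D X), shift G (\<beta> + ?z X) (head ?D X)} =
          {shift G (\<beta> + \<pi> ?t) ?t, shift G ((\<beta> + \<pi> ?t) + z X) ?h}" for \<beta>
        using False add[OF X'(1)] add[OF X'(2)] by (simp add: Let_def algebra_simps)
      moreover have "{{shift G \<beta> ?t, shift G (\<beta> + z X) ?h} | \<beta>. True} =
          {{shift G (\<beta> + \<pi> ?t) ?t, shift G ((\<beta> + \<pi> ?t) + z X) ?h} | \<beta>. True}"
        by (smt (verit) Collect_cong diff_add_cancel)
      ultimately show ?thesis using X'(3) by simp
    next
      case True
      have "{shift G \<beta> (tail ?D X), shift G (\<beta> + ?z X) (head ?D X)} =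
          {shift G (\<beta> + (\<pi> ?h - z X)) ?t, shift G ((\<beta> + (\<pi> ?h - z X)) + z X) ?h}" for \<beta>
        using True add[OF X'(1)] add[OF X'(2)] by (simp add: Let_def algebra_simps insert_commute)
      moreover have "{{shift G \<beta> ?t, shift G (\<beta> + z X) ?h} | \<beta>. True} =
          {{shift G (\<beta> + (\<pi> ?h - z X)) ?t, shift G ((\<beta> + (\<pi> ?h - z X)) + z X) ?h} | \<beta>. True}"
        by (smt (verit) Collect_cong diff_add_cancel)
      ultimately show ?thesis using X'(3) by simp
    qed
    have "tail ?D X \<in> ?R" "head ?D X \<in> ?R" using mem by (auto simp: Let_def)
    then show ?thesis using eq by blast
  qed
  moreover have "arcs D = edge_orbits G" using Q unfolding quotient_wrt_def by simp
  ultimately show ?thesis unfolding quotient_wrt_def by simp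
qed

text \<open>The quotient of G is chosen already switched by \<pi> and with the chosen arcs directed
  as in K. Then deletions and contractions of arcs labelled \<open>0\<close> lead to K exactly, with
  no relabelling at the end. By \<open>cover\<close> and the crossing arcs every branch set is
  nonempty.\<close>

lemma minor_of_model:
  fixes K :: "(nat, 'b) pre_digraph"
  assumes Q: "quotient_wrt G R (D, z)" and model: "has_model R (gain_edges (D, z)) K zK"
    and K: "wf_digraph K" "finite (verts K)" "finite (arcs K)" "simple_labelling K zK"
    and cover: "\<And>k. k \<in> verts K \<Longrightarrow> \<exists>a\<in>arcs K. k = tail K a \<or> k = head K a"
  shows "has_minor_isomorphic_to G (lift_graph K zK)"
proof -
  let ?E = "gain_edges (D, z)"
  obtain \<phi> \<pi> where cf: "connected_fibres R ?E \<phi> \<pi> (verts K)"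
    and cr: "\<And>a. a \<in> arcs K \<Longrightarrow> cross ?E \<phi> \<pi> (tail K a) (head K a) (zK a)"
    using model unfolding has_model_def by blast
  have rep: "orbit_representatives G R" using Q unfolding quotient_wrt_def by simp
  then have R: "R \<subseteq> zverts G" unfolding orbit_representatives_def by simp
  obtain \<rho> \<delta> where rd: "\<And>i \<gamma>. i \<in> R \<Longrightarrow> \<rho> (shift G \<gamma> i) = i \<and> \<delta> (shift G \<gamma> i) = \<gamma>"
    "\<And>v. v \<in> zverts G \<Longrightarrow> \<rho> v \<in> R \<and> shift G (\<delta> v) (\<rho> v) = v"
    using orbit_coordinates[OF rep] by metis
  have DR: "tail D X \<in> R" "head D X \<in> R" if "X \<in> arcs D" for X
    using quotient_edge_orbit[OF Q that] by auto
  have arcsD: "arcs D = edge_orbits G" and vD: "verts D = R" using Q unfolding quotient_wrt_def by auto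
  define rel where "rel X = z X + \<pi> (tail D X) - \<pi> (head D X)" for X
  have "\<exists>X flip. X \<in> arcs D \<and>
      \<phi> (if flip then head D X else tail D X) = tail K a \<and>
      \<phi> (if flip then tail D X else head D X) = head K a \<and>
      (if flip then - 1 else 1) * rel X = zK a" if a: "a \<in> arcs K" for a
  proof -
    obtain i j where ij: "(i, j, zK a - \<pi> i + \<pi> j) \<in> ?E" "\<phi> i = tail K a" "\<phi> j = head K a"
      using cr[OF a] unfolding cross_def by blast
    then obtain X where X: "X \<in> arcs D"
      "i = tail D X \<and> j = head D X \<and> zK a - \<pi> i + \<pi> j = z X \<or>
       i = head D X \<and> j = tail D X \<and> zK a - \<pi> i + \<pi> j = - z X"
      unfolding gain_edges_def by auto
    from X(2) show ?thesis
    proof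
      assume "i = tail D X \<and> j = head D X \<and> zK a - \<pi> i + \<pi> j = z X"
      then show ?thesis using X(1) ij(2,3) by (intro exI[of _ X] exI[of _ False]) (auto simp: rel_def)
    next
      assume "i = head D X \<and> j = tail D X \<and> zK a - \<pi> i + \<pi> j = - z X"
      then show ?thesis using X(1) ij(2,3) by (intro exI[of _ X] exI[of _ True]) (auto simp: rel_def)
    qed
  qed
  then obtain h flip where hf: "\<And>a. a \<in> arcs K \<Longrightarrow> h a \<in> arcs D \<and>
      \<phi> (if flip a then head D (h a) else tail D (h a)) = tail K a \<and>
      \<phi> (if flip a then tail D (h a) else head D (h a)) = head K a \<and>
      (if flip a then - 1 else 1) * rel (h a) = zK a" by metis
  have hinj: "inj_on h (arcs K)"
  proof (rule inj_onI)
    fix a b assume ab: "a \<in> arcs K" "b \<in> arcs K" "h a = h b"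
    have "coincide K zK a b"
      using hf[OF ab(1)] hf[OF ab(2)] unfolding coincide_def ab(3) by (auto split: if_splits)
    then show "a = b" using K(4) ab(1,2) unfolding simple_labelling_def by blast
  qed
  \<comment> \<open>Since h is injective, an arc of G serves only one arc of K, so its direction can
    be set without conflict.\<close>
  define I where "I = h ` {a \<in> arcs K. flip a}"
  have hI: "h a \<in> I \<longleftrightarrow> flip a" if "a \<in> arcs K" for a
    using that hinj unfolding I_def inj_on_def by blast
  define s where "s i = shift G (\<pi> i) i" for i
  define D1 where "D1 = \<lparr>verts = s ` R, arcs = arcs D,
      tail = \<lambda>X. s (if X \<in> I then head D X else tail D X),
      head = \<lambda>X. s (if X \<in> I then tail D X else head D X)\<rparr>"
  define z1 where "z1 X = (if X \<in> I then - 1 else 1) * rel X" for X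
  have Q1: "quotient_wrt G (s ` R) (D1, z1)"
    using quotient_switch[OF Q, of \<pi> I] unfolding D1_def z1_def s_def rel_def Let_def .
  define f where "f v = \<phi> (\<rho> v)" for v
  have fs: "f (s i) = \<phi> i" if "i \<in> R" for i using rd(1)[OF that, of "\<pi> i"] unfolding f_def s_def by simp
  have finR: "finite R" by (rule finite_representatives[OF rep])
  have finA: "finite (arcs D)" using arcsD finite_edge_orbits by simp
  define T where "T = h ` arcs K"
  define W where "W = {v \<in> s ` R. f v \<notin> verts K}"
  define D2 where "D2 = D1\<lparr>verts := verts D1 - W, arcs := {e \<in> arcs D1. tail D1 e \<notin> W \<and> head D1 e \<notin> W}\<rparr>"
  \<comment> \<open>What remains is T, one arc for each arc of K, together with the arcs labelled
    \<open>0\<close> inside branch sets: the situation of \<open>contract_fibres\<close>.\<close>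
  define B where "B = {X \<in> arcs D2 - T. \<not> (f (tail D1 X) = f (head D1 X) \<and> z1 X = 0)}"
  define D3 where "D3 = D2\<lparr>arcs := arcs D2 - B\<rparr>"
  have "minor_step\<^sup>*\<^sup>* (D1, z1) (D2, z1)"
    unfolding D2_def by (rule delete_verts) (use finR in \<open>auto simp: W_def D1_def\<close>)
  moreover have "minor_step\<^sup>*\<^sup>* (D2, z1) (D3, z1)"
    unfolding D3_def by (rule delete_arcs) (use finA in \<open>auto simp: B_def D2_def D1_def\<close>)
  ultimately have steps: "minor_step\<^sup>*\<^sup>* (D1, z1) (D3, z1)" by (rule rtranclp_trans)
  have V3: "verts D3 = {v \<in> s ` R. f v \<in> verts K}"
    unfolding D3_def D2_def D1_def W_def by auto
  have th3: "tail D3 X = s (if X \<in> I then head D X else tail D X)"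
    "head D3 X = s (if X \<in> I then tail D X else head D X)" for X
    unfolding D3_def D2_def D1_def by auto
  have ends1: "tail D3 X \<in> s ` R" "head D3 X \<in> s ` R" if "X \<in> arcs D" for X
    using DR[OF that] unfolding th3 by auto
  have A3: "arcs D3 = {X \<in> arcs D. tail D3 X \<in> verts D3 \<and> head D3 X \<in> verts D3 \<and>
      (X \<in> T \<or> f (tail D3 X) = f (head D3 X) \<and> z1 X = 0)}"
  proof -
    have "tail D1 = tail D3" "head D1 = head D3" "arcs D1 = arcs D" unfolding D3_def D2_def D1_def by auto
    then show ?thesis using ends1 unfolding V3 unfolding D3_def D2_def B_def W_def by auto
  qed
  have fth: "f (tail D3 X) = \<phi> (if X \<in> I then head D X else tail D X)"
    "f (head D3 X) = \<phi> (if X \<in> I then tail D X else head D X)" if "X \<in> arcs D" for X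
    using DR[OF that] fs unfolding th3 by auto
  have hK: "f (tail D3 (h a)) = tail K a \<and> f (head D3 (h a)) = head K a \<and> z1 (h a) = zK a" if a: "a \<in> arcs K" for a
    using hf[OF a] hI[OF a] fth[of "h a"] unfolding z1_def by auto
  have wfK: "tail K a \<in> verts K" "head K a \<in> verts K" if "a \<in> arcs K" for a
    using K(1) that unfolding wf_digraph_def by auto
  have T3: "T \<subseteq> arcs D3"
  proof
    fix X assume "X \<in> T"
    then obtain a where a: "a \<in> arcs K" "X = h a" unfolding T_def by blast
    then have "X \<in> arcs D" using hf by blast
    then show "X \<in> arcs D3"
      unfolding A3 using ends1[of X] hK[OF a(1)] wfK[OF a(1)] \<open>X \<in> T\<close> unfolding V3 a(2) by auto
  qed
  have img: "f ` verts D3 = verts K"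
  proof
    show "f ` verts D3 \<subseteq> verts K" unfolding V3 by auto
    show "verts K \<subseteq> f ` verts D3"
    proof
      fix k assume "k \<in> verts K"
      then obtain a where a: "a \<in> arcs K" "k = tail K a \<or> k = head K a" using cover by blast
      have "h a \<in> arcs D3" using T3 a(1) unfolding T_def by auto
      then have "tail D3 (h a) \<in> verts D3" "head D3 (h a) \<in> verts D3" unfolding A3 by auto
      then show "k \<in> f ` verts D3" using a(2) hK[OF a(1)] by (metis imageI)
    qed
  qed
  have adj: "inner_adj D3 T (s i) (s j)" if t: "tight ?E \<phi> \<pi> i j" "\<phi> i \<in> verts K" for i j
  proof -
    have ij: "(i, j, \<pi> j - \<pi> i) \<in> ?E" "\<phi> i = \<phi> j" using t unfolding tight_def by auto
    then obtain X where X: "X \<in> arcs D"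
      "i = tail D X \<and> j = head D X \<and> \<pi> j - \<pi> i = z X \<or> i = head D X \<and> j = tail D X \<and> \<pi> j - \<pi> i = - z X"
      unfolding gain_edges_def by auto
    have zX: "z1 X = 0" using X(2) unfolding z1_def rel_def by auto
    have en: "{tail D3 X, head D3 X} = {s i, s j}" using X(2) unfolding th3 by auto
    have fX: "f (tail D3 X) = \<phi> i" "f (head D3 X) = \<phi> i" using fth[OF X(1)] X(2) ij(2) by auto
    have "X \<notin> T"
    proof
      assume "X \<in> T"
      then obtain a where "a \<in> arcs K" "X = h a" unfolding T_def by blast
      then have "tail K a = head K a" "zK a = 0" "a \<in> arcs K" using hK[of a] fX zX by auto
      then show False using K(4) unfolding simple_labelling_def by blast
    qed
    moreover have "X \<in> arcs D3" unfolding A3 V3 using ends1[OF X(1)] X(1) fX zX t(2) by auto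
    ultimately show ?thesis unfolding inner_adj_def using en by blast
  qed
  have conn: "(inner_adj D3 T)\<^sup>*\<^sup>* (s i) (s j)" if "(tight ?E \<phi> \<pi>)\<^sup>*\<^sup>* i j" "\<phi> i \<in> verts K" for i j
  proof -
    have "\<phi> j = \<phi> i \<and> (inner_adj D3 T)\<^sup>*\<^sup>* (s i) (s j)"
      using that(1)
    proof (induction rule: rtranclp_induct)
      case (step y w)
      have "\<phi> w = \<phi> y" using step.hyps(2) unfolding tight_def by simp
      moreover have "inner_adj D3 T (s y) (s w)" using adj[OF step.hyps(2)] step.IH that(2) by simp
      ultimately show ?case using step.IH by (metis rtranclp.rtrancl_into_rtrancl)
    qed simp
    then show ?thesis by simp
  qed
  have "\<exists>Q. minor_step\<^sup>*\<^sup>* (D3, z1) Q \<and> exact_iso Q (K, zK)"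
  proof (rule contract_fibres[where f = f and h = h and T = T])
    show "wf_digraph D3" unfolding wf_digraph_def A3 by auto
    show "finite (verts D3)" unfolding V3 using finR by auto
    show "finite (arcs D3)" unfolding A3 using finA by auto
    show "bij_betw h (arcs K) T" using hinj unfolding T_def bij_betw_def by simp
    show "f (tail D3 e) = f (head D3 e) \<and> z1 e = 0" if "e \<in> arcs D3 - T" for e
      using that unfolding A3 by auto
    show "(inner_adj D3 T)\<^sup>*\<^sup>* u v" if uv: "u \<in> verts D3" "v \<in> verts D3" "f u = f v" for u v
    proof -
      obtain i j where ij: "i \<in> R" "u = s i" "j \<in> R" "v = s j" using uv(1,2) unfolding V3 by auto
      then have "\<phi> i = \<phi> j" "\<phi> i \<in> verts K" using uv fs unfolding V3 by auto
      then have "(tight ?E \<phi> \<pi>)\<^sup>*\<^sup>* i j" using cf ij unfolding connected_fibres_def by blast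
      then show ?thesis using conn \<open>\<phi> i \<in> verts K\<close> ij by blast
    qed
  qed (use K img T3 hK in auto)
  then obtain Q' where Q': "minor_step\<^sup>*\<^sup>* (D3, z1) Q'" "exact_iso Q' (K, zK)" by blast
  have L: "Z_symmetric_graph (lift_graph K zK)" using lift_Z_symmetric[OF K] .
  obtain R' P where P: "quotient_wrt (lift_graph K zK) R' P" "exact_iso (K, zK) P"
    using lift_quotient[OF K(1,4)] by metis
  have "labelled_minor P (D1, z1)"
    unfolding labelled_minor_def labelled_iso_def
    using rtranclp_trans[OF steps Q'(1)] exact_iso_trans[OF Q'(2) P(2)] by blast
  then have "Z_minor (lift_graph K zK) G" unfolding Z_minor_def using P(1) Q1 by blast
  moreover have "Z_graph_iso (lift_graph K zK) (lift_graph K zK)"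
    unfolding Z_graph_iso_def by (intro exI[of _ id]) auto
  ultimately show ?thesis using L unfolding has_minor_isomorphic_to_def by blast
qed

end

section \<open>Realizable dimension at most one and two\<close>

lemma L2_set_loop: "L2_set (\<lambda>k. x k - x k - of_int g * l k) A = \<bar>of_int g\<bar> * L2_set l A"
proof -
  have "L2_set (\<lambda>k. x k - x k - of_int g * l k) A = L2_set (\<lambda>k. \<bar>of_int g\<bar> * l k) A"
    unfolding L2_set_def by (simp add: power_mult_distrib)
  then show ?thesis by (simp add: L2_set_right_distrib)
qed

text \<open>The map \<iota> reads off coordinates, so realizations by real or complex numbers become
  realizations in d coordinates. Loops, absent from \<open>gain_edges\<close>, have the right length
  because m does.\<close>

lemma lab_realizable_of_embedding:
  fixes \<iota> :: "'n::real_normed_field \<Rightarrow> nat \<Rightarrow> real"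
  assumes norm: "\<And>x. L2_set (\<iota> x) {..<d} = norm x"
    and lin: "\<And>x y g m. \<iota> (x - y - of_int g * m) = (\<lambda>k. \<iota> x k - \<iota> y k - of_int g * \<iota> m k)"
    and ex: "\<And>c l p. \<exists>(m :: 'n) q. norm m = L2_set l {..<c} \<and>
      (\<forall>i j g. (i, j, g) \<in> gain_edges (D, z) \<longrightarrow> edge_preserved c p l q m i j g)"
  shows "lab_realizable d (D, z)"
proof (rule lab_realizableI)
  fix c l p
  obtain m :: 'n and q where m: "norm m = L2_set l {..<c}"
    and q: "\<And>i j g. (i, j, g) \<in> gain_edges (D, z) \<Longrightarrow> edge_preserved c p l q m i j g"
    using ex[of l c p] by blast
  have "L2_set (\<lambda>k. p (tail D e) k - p (head D e) k - of_int (z e) * l k) {..<c} =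
      L2_set (\<lambda>k. \<iota> (q (tail D e)) k - \<iota> (q (head D e)) k - of_int (z e) * \<iota> m k) {..<d}"
    if e: "e \<in> arcs D" for e
  proof (cases "tail D e = head D e")
    case True
    show ?thesis unfolding True L2_set_loop norm m ..
  next
    case False
    then have "(tail D e, head D e, z e) \<in> gain_edges (D, z)" using e unfolding gain_edges_def by auto
    then show ?thesis using q unfolding edge_preserved_def lin[symmetric] norm by simp
  qed
  then show "\<exists>m q. L2_set l {..<c} = L2_set m {..<d} \<and>
      (\<forall>e\<in>arcs D. L2_set (\<lambda>k. p (tail D e) k - p (head D e) k - of_int (z e) * l k) {..<c}
         = L2_set (\<lambda>k. q (tail D e) k - q (head D e) k - of_int (z e) * m k) {..<d})"
    using m norm by (intro exI[of _ "\<iota> m"] exI[of _ "\<lambda>v. \<iota> (q v)"]) simp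
qed

lemma lab_realizable_line:
  assumes "gain_graph V (gain_edges (D, z))"
    "\<not> K3_model V (gain_edges (D, z))" "\<not> K2d_model V (gain_edges (D, z))"
  shows "lab_realizable 1 (D, z)"
proof (rule lab_realizable_of_embedding[where \<iota> = "\<lambda>x _. x"])
  fix c l p
  show "\<exists>(m :: real) q. norm m = L2_set l {..<c} \<and>
      (\<forall>i j g. (i, j, g) \<in> gain_edges (D, z) \<longrightarrow> edge_preserved c p l q m i j g)"
    by (rule line_realization[OF assms])
qed (simp_all add: L2_set_def)

lemma lab_realizable_plane:
  assumes "gain_graph V (gain_edges (D, z))"
    "\<not> K4_model V (gain_edges (D, z))" "\<not> K3dd_model V (gain_edges (D, z))"
  shows "lab_realizable 2 (D, z)"
proof (rule lab_realizable_of_embedding[where \<iota> = "\<lambda>x k. if k = 0 then Re x else Im x"])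
  fix c l p
  show "\<exists>(m :: complex) q. norm m = L2_set l {..<c} \<and>
      (\<forall>i j g. (i, j, g) \<in> gain_edges (D, z) \<longrightarrow> edge_preserved c p l q m i j g)"
    by (rule plane_realization[OF assms])
qed (auto simp: L2_set_def numeral_2_eq_2 cmod_def)

section \<open>Realizability in higher dimensions and the values of rd\<close>

lemma realizable_Suc:
  assumes "realizable d G"
  shows "realizable (Suc d) G"
  unfolding realizable_def
proof (intro allI impI)
  fix c l p assume "periodic_framework G c l p"
  then obtain m q where q: "periodic_framework G d m q" "equivalent_frameworks G c l p d m q"
    using assms unfolding realizable_def by blast
  define ext where "ext x k = (if k < d then x k else (0::real))" for x k
  have L2: "L2_set (\<lambda>k. ext x k - ext y k) {..<Suc d} = L2_set (\<lambda>k. x k - y k) {..<d}"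
    "L2_set (ext x) {..<Suc d} = L2_set x {..<d}" for x y
    unfolding L2_set_def ext_def by simp_all
  have "\<exists>k<d. m k \<noteq> 0" using q(1) unfolding periodic_framework_def by simp
  then have "\<exists>k<Suc d. ext m k \<noteq> 0" unfolding ext_def using less_Suc_eq by auto
  then have "periodic_framework G (Suc d) (ext m) (\<lambda>v. ext (q v))"
    using q(1) unfolding periodic_framework_def ext_def by auto
  moreover have "equivalent_frameworks G c l p (Suc d) (ext m) (\<lambda>v. ext (q v))"
    using q(2) unfolding equivalent_frameworks_def L2 .
  ultimately show "\<exists>m q. periodic_framework G (Suc d) m q \<and> equivalent_frameworks G c l p (Suc d) m q"
    by blast
qed

text \<open>The infimum of a nonempty set of extended naturals is attained, and the infimum of the
  empty set is infinite.\<close>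

lemma rd_le_iff: "rd G \<le> enat n \<longleftrightarrow> (\<exists>d\<le>n. realizable d G)"
proof
  assume le: "rd G \<le> enat n"
  let ?A = "{enat d | d. realizable d G}"
  have "?A \<noteq> {}"
  proof
    assume "?A = {}"
    then show False using le unfolding rd_def by (simp add: top_enat_def)
  qed
  then have "Inf ?A \<in> ?A" by (metis (no_types, lifting) wellorder_InfI equals0I)
  then show "\<exists>d\<le>n. realizable d G" using le unfolding rd_def by auto
next
  assume "\<exists>d\<le>n. realizable d G"
  then obtain d where d: "d \<le> n" "realizable d G" by blast
  then have "rd G \<le> enat d" unfolding rd_def by (intro Inf_lower) blast
  also have "\<dots> \<le> enat n" using d(1) by simp
  finally show "rd G \<le> enat n" .
qed

context Z_symmetric_graph
begin

lemma gain_graph_quotient: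
  assumes Q: "quotient_wrt G R (D, z)"
  shows "gain_graph R (gain_edges (D, z))"
proof -
  have "finite R" using finite_representatives Q unfolding quotient_wrt_def by simp
  moreover have "tail D X \<in> R" "head D X \<in> R" if "X \<in> arcs D" for X
    using quotient_edge_orbit[OF Q that] by auto
  ultimately show ?thesis unfolding gain_graph_def gain_edges_def by auto
qed

lemma ex_quotient: "\<exists>R D z. quotient_wrt G R (D, z)"
proof -
  define pick where "pick X = (SOME v. v \<in> X)" for X :: "'a set"
  define R where "R = pick ` vertex_orbits G"
  have self: "v \<in> vertex_orbit G v" if "v \<in> zverts G" for v
    using shift_zero[OF that] unfolding vertex_orbit_def by (metis (mono_tags, lifting) CollectI)
  have orb: "w \<in> zverts G" "vertex_orbit G w = vertex_orbit G v"
    if v: "v \<in> zverts G" "w \<in> vertex_orbit G v" for v w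
  proof -
    obtain \<gamma> where w: "w = shift G \<gamma> v" using v(2) unfolding vertex_orbit_def by blast
    show "w \<in> zverts G" using w shift_closed[OF v(1)] by simp
    have "shift G \<beta> w = shift G (\<beta> + \<gamma>) v" for \<beta> unfolding w using shift_add[OF v(1)] by simp
    moreover have "shift G \<beta> v = shift G (\<beta> - \<gamma>) w" for \<beta>
      unfolding w using shift_add[OF v(1), of "\<beta> - \<gamma>" \<gamma>] by simp
    ultimately show "vertex_orbit G w = vertex_orbit G v" unfolding vertex_orbit_def by blast
  qed
  have pick: "pick X \<in> X" if "X \<in> vertex_orbits G" for X
    using that self someI[of "\<lambda>v. v \<in> X"] unfolding pick_def vertex_orbits_def by blast
  have rep: "orbit_representatives G R"
    unfolding orbit_representatives_def
  proof (intro conjI ballI)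
    show "R \<subseteq> zverts G" using pick orb(1) unfolding R_def vertex_orbits_def by blast
  next
    fix X assume X: "X \<in> vertex_orbits G"
    show "\<exists>!i. i \<in> R \<and> i \<in> X"
    proof (rule ex1I[of _ "pick X"])
      show "pick X \<in> R \<and> pick X \<in> X" using X pick unfolding R_def by blast
    next
      fix i assume i: "i \<in> R \<and> i \<in> X"
      then obtain Y where Y: "Y \<in> vertex_orbits G" "i = pick Y" unfolding R_def by blast
      obtain v w where vw: "v \<in> zverts G" "X = vertex_orbit G v" "w \<in> zverts G" "Y = vertex_orbit G w"
        using X Y(1) unfolding vertex_orbits_def by blast
      have "vertex_orbit G i = X" using orb(2)[OF vw(1), of i] i vw(2) by simp
      moreover have "vertex_orbit G i = Y" using orb(2)[OF vw(3), of i] pick[OF Y(1)] Y(2) vw(4) by simp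
      ultimately show "i = pick X" using Y(2) by simp
    qed
  qed
  then have R: "R \<subseteq> zverts G" unfolding orbit_representatives_def by simp
  obtain \<rho> \<delta> where rd: "\<And>v. v \<in> zverts G \<Longrightarrow> \<rho> v \<in> R \<and> shift G (\<delta> v) (\<rho> v) = v"
    using orbit_coordinates[OF rep] by metis
  define P where "P X i j g \<longleftrightarrow> i \<in> R \<and> j \<in> R \<and> X = {{shift G \<beta> i, shift G (\<beta> + g) j} | \<beta>. True}"
    for X i j g
  have "\<exists>i j g. P X i j g" if "X \<in> edge_orbits G" for X
  proof -
    obtain e where e: "e \<in> zedges G" "X = edge_orbit G e"
      using \<open>X \<in> edge_orbits G\<close> unfolding edge_orbits_def by blast
    obtain u v where uv: "e = {u, v}" using edges_simple[OF e(1)] by (auto simp: card_2_iff)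
    have V: "u \<in> zverts G" "v \<in> zverts G" using edges_simple[OF e(1)] unfolding uv by auto
    define i a j b where ij: "i = \<rho> u" "a = \<delta> u" "j = \<rho> v" "b = \<delta> v"
    have i: "i \<in> R" "u = shift G a i" and j: "j \<in> R" "v = shift G b j"
      using rd[OF V(1)] rd[OF V(2)] unfolding ij by auto
    have im: "shift G \<gamma> ` e = {shift G (\<gamma> + a) i, shift G ((\<gamma> + a) + (b - a)) j}" for \<gamma>
      using shift_add[of i \<gamma> a] shift_add[of j \<gamma> b] i j R unfolding uv by auto
    have "X = {{shift G \<beta> i, shift G (\<beta> + (b - a)) j} | \<beta>. True}"
    proof (intro set_eqI iffI)
      fix y assume "y \<in> X"
      then show "y \<in> {{shift G \<beta> i, shift G (\<beta> + (b - a)) j} | \<beta>. True}"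
        unfolding e(2) edge_orbit_def im by blast
    next
      fix y assume "y \<in> {{shift G \<beta> i, shift G (\<beta> + (b - a)) j} | \<beta>. True}"
      then obtain \<beta> where "y = {shift G \<beta> i, shift G (\<beta> + (b - a)) j}" by blast
      then have "y = shift G (\<beta> - a) ` e" unfolding im by simp
      then show "y \<in> X" unfolding e(2) edge_orbit_def by blast
    qed
    then have "P X i j (b - a)" using i(1) j(1) unfolding P_def by blast
    then show ?thesis by blast
  qed
  then obtain t h g where "\<And>X. X \<in> edge_orbits G \<Longrightarrow> P X (t X) (h X) (g X)" by metis
  then have "quotient_wrt G R (\<lparr>verts = R, arcs = edge_orbits G, tail = t, head = h\<rparr>, g)"
    using rep unfolding quotient_wrt_def P_def by simp
  then show ?thesis by blast
qed

text \<open>Dimension 0 has no lattice vector of length 1, whereas dimension 1 provides a framework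
  with one. This removes the case d = 0 from the characterizations of rd that follow.\<close>

lemma not_realizable_0: "\<not> realizable 0 G"
proof
  assume real: "realizable 0 G"
  obtain R D z where Q: "quotient_wrt G R (D, z)" using ex_quotient by blast
  have "lab_realizable 0 (D, z)" using realizable_iff_quotient[OF Q] real by simp
  from lab_realizableD[OF this, of 1 "\<lambda>_. 1"] show False by (auto simp: L2_set_def)
qed

lemma rd_le_1_iff: "rd G \<le> 1 \<longleftrightarrow> realizable 1 G"
  using rd_le_iff[of G 1] not_realizable_0 unfolding one_enat_def by (auto simp: le_Suc_eq)

lemma rd_le_2_iff: "rd G \<le> 2 \<longleftrightarrow> realizable 2 G"
  using rd_le_iff[of G 2] not_realizable_0 realizable_Suc[of 1 G]
  unfolding numeral_eq_enat by (auto simp: le_Suc_eq numeral_2_eq_2)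

end

lemma target_facts:
  "wf_digraph (complete_digraph k)" "finite (verts (complete_digraph k))" "finite (arcs (complete_digraph k))"
  "simple_labelling (complete_digraph k) (\<lambda>_. 0)"
  "wf_digraph K2_dot" "finite (verts K2_dot)" "finite (arcs K2_dot)"
  "wf_digraph K3_dot_dot" "finite (verts K3_dot_dot)" "finite (arcs K3_dot_dot)"
proof -
  have "arcs (complete_digraph k) \<subseteq> {1..k} \<times> {1..k}" unfolding complete_digraph_def by auto
  then show "finite (arcs (complete_digraph k))" by (rule finite_subset) simp
  show "wf_digraph (complete_digraph k)" "finite (verts (complete_digraph k))"
    "simple_labelling (complete_digraph k) (\<lambda>_. 0)"
    unfolding complete_digraph_def wf_digraph_def simple_labelling_def coincide_def by auto
  show "wf_digraph K2_dot" "finite (verts K2_dot)" "finite (arcs K2_dot)"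
    "wf_digraph K3_dot_dot" "finite (verts K3_dot_dot)" "finite (arcs K3_dot_dot)"
    unfolding K2_dot_def K3_dot_dot_def wf_digraph_def by auto
qed

theorem theorem3p2:
  fixes G :: "'a zgraph"
  assumes "Z_symmetric_graph G"
  shows "(rd G \<le> 1 \<longleftrightarrow>
            \<not> has_minor_isomorphic_to G (lift_graph (complete_digraph 3) (\<lambda>_. 0)) \<and>
            (\<forall>z. simple_labelling K2_dot z \<longrightarrow> \<not> has_minor_isomorphic_to G (lift_graph K2_dot z)))
       \<and> (rd G \<le> 2 \<longleftrightarrow>
            \<not> has_minor_isomorphic_to G (lift_graph (complete_digraph 4) (\<lambda>_. 0)) \<and>
            (\<forall>z. simple_labelling K3_dot_dot z \<longrightarrow> \<not> has_minor_isomorphic_to G (lift_graph K3_dot_dot z)))"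
proof -
  interpret Z_symmetric_graph G by (rule assms)
  obtain R D z where Q: "quotient_wrt G R (D, z)" using ex_quotient by blast
  let ?E = "gain_edges (D, z)"
  have GG: "gain_graph R ?E" by (rule gain_graph_quotient[OF Q])
  have K3: "\<not> K3_model R ?E" if "\<not> has_minor_isomorphic_to G (lift_graph (complete_digraph 3) (\<lambda>_. 0))"
  proof
    assume "K3_model R ?E"
    then have "has_minor_isomorphic_to G (lift_graph (complete_digraph 3) (\<lambda>_. 0))"
      unfolding K3_model_def
      by (rule minor_of_model[OF Q _ target_facts(1-4)])
        (auto simp: complete_digraph_3 complete_digraph_ends)
    then show False using that by simp
  qed
  have K4: "\<not> K4_model R ?E" if "\<not> has_minor_isomorphic_to G (lift_graph (complete_digraph 4) (\<lambda>_. 0))"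
  proof
    assume "K4_model R ?E"
    then have "has_minor_isomorphic_to G (lift_graph (complete_digraph 4) (\<lambda>_. 0))"
      unfolding K4_model_def
      by (rule minor_of_model[OF Q _ target_facts(1-4)])
        (auto simp: complete_digraph_4 complete_digraph_ends)
    then show False using that by simp
  qed
  have K2d: "\<not> K2d_model R ?E"
    if "\<forall>z. simple_labelling K2_dot z \<longrightarrow> \<not> has_minor_isomorphic_to G (lift_graph K2_dot z)"
  proof
    assume "K2d_model R ?E"
    then obtain y where y: "simple_labelling K2_dot y" "has_model R ?E K2_dot y"
      unfolding K2d_model_def by blast
    have "has_minor_isomorphic_to G (lift_graph K2_dot y)"
      by (rule minor_of_model[OF Q y(2) target_facts(5-7) y(1)]) (auto simp: K2_dot_def)
    then show False using that y(1) by blast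
  qed
  have K3dd: "\<not> K3dd_model R ?E"
    if "\<forall>z. simple_labelling K3_dot_dot z \<longrightarrow> \<not> has_minor_isomorphic_to G (lift_graph K3_dot_dot z)"
  proof
    assume "K3dd_model R ?E"
    then obtain y where y: "simple_labelling K3_dot_dot y" "has_model R ?E K3_dot_dot y"
      unfolding K3dd_model_def by blast
    have "has_minor_isomorphic_to G (lift_graph K3_dot_dot y)"
      by (rule minor_of_model[OF Q y(2) target_facts(8-10) y(1)]) (auto simp: K3_dot_dot_def)
    then show False using that y(1) by blast
  qed
  note of_minor = lab_realizable_of_minor[OF assms]
  show ?thesis
  proof (intro conjI iffI)
    assume "rd G \<le> 1"
    then have r: "realizable 1 G" by (simp add: rd_le_1_iff)
    show "\<not> has_minor_isomorphic_to G (lift_graph (complete_digraph 3) (\<lambda>_. 0))"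
      using of_minor[OF r _ target_facts(1-4)] K3_not_realizable by blast
    show "\<forall>z. simple_labelling K2_dot z \<longrightarrow> \<not> has_minor_isomorphic_to G (lift_graph K2_dot z)"
      using of_minor[OF r _ target_facts(5-7)] K2_dot_not_realizable by blast
  next
    assume "\<not> has_minor_isomorphic_to G (lift_graph (complete_digraph 3) (\<lambda>_. 0)) \<and>
      (\<forall>z. simple_labelling K2_dot z \<longrightarrow> \<not> has_minor_isomorphic_to G (lift_graph K2_dot z))"
    then have "lab_realizable 1 (D, z)" using lab_realizable_line[OF GG] K3 K2d by blast
    then show "rd G \<le> 1" by (simp add: rd_le_1_iff realizable_iff_quotient[OF Q])
  next
    assume "rd G \<le> 2"
    then have r: "realizable 2 G" by (simp add: rd_le_2_iff)
    show "\<not> has_minor_isomorphic_to G (lift_graph (complete_digraph 4) (\<lambda>_. 0))"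
      using of_minor[OF r _ target_facts(1-4)] K4_not_realizable by blast
    show "\<forall>z. simple_labelling K3_dot_dot z \<longrightarrow> \<not> has_minor_isomorphic_to G (lift_graph K3_dot_dot z)"
      using of_minor[OF r _ target_facts(8-10)] K3_dot_dot_not_realizable by blast
  next
    assume "\<not> has_minor_isomorphic_to G (lift_graph (complete_digraph 4) (\<lambda>_. 0)) \<and>
      (\<forall>z. simple_labelling K3_dot_dot z \<longrightarrow> \<not> has_minor_isomorphic_to G (lift_graph K3_dot_dot z))"
    then have "lab_realizable 2 (D, z)" using lab_realizable_plane[OF GG] K4 K3dd by blast
    then show "rd G \<le> 2" by (simp add: rd_le_2_iff realizable_iff_quotient[OF Q])
  qed
qed

end
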